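(* Let $T\in(0,\infty]$ be given. The following are equivalent for a function $f$ and initial datum $f_0$: (i) $f\in C([0,T),L_2(\mathbb{S}))\cap C^1((0,T),L_2(\mathbb{S}))$, and there are velocity fields $v_\pm$ and pressures $p_\pm$ such that $(f,v_\pm,p_\pm)$ solves the Muskat problem (M) stated in the context on the time interval $[0,T)$, with $$f(t)\in H^2(\mathbb{S}),\quad v_\pm(t)\in C(\overline{\Omega_\pm(t)})\cap C^1(\Omega_\pm(t)),\quad p_\pm(t)\in C^1(\overline{\Omega_\pm(t)})\cap C^2(\Omega_\pm(t))\qquad\text{for all } t\in(0,T);$$ (ii) $f\in C([0,T),L_2(\mathbb{S}))\cap C^1((0,T),L_2(\mathbb{S}))$, $f(t)\in H^2(\mathbb{S})$ for all $t\in(0,T)$, and $f$ solves the contour-integral problem $$\left\{\begin{aligned} \partial_t f(t,x)=&-\frac{k\Delta_\rho}{4\pi\mu} f'(t,x)\,\mathrm{PV}\!\int_{-\pi}^{\pi}f'(t,x-s)\frac{(T_{[x,s]} f(t))(1+t_{[s]}^2)}{t_{[s]}^2+(T_{[x,s]} f(t))^2}\, ds\\ &-\frac{k\Delta_\rho}{4\pi\mu}\,\mathrm{PV}\!\int_{-\pi}^{\pi}f'(t,x-s)\frac{t_{[s]}\,[1-(T_{[x,s]} f(t))^2]}{t_{[s]}^2+(T_{[x,s]} f(t))^2}\, ds,\qquad t\in(0,T),\ x\in\mathbb{R},\\ f(0)=&\ f_0. \end{aligned}\right.$$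
   Context: $\mathbb{S}:=\mathbb{R}/2\pi\mathbb{Z}$; functions on $\mathbb{S}$ are identified with $2\pi$-periodic functions of the real variable $x$; $L_2(\mathbb{S})$ and $H^r(\mathbb{S})$ are the usual spaces of periodic real-valued functions. The prime $(\cdot)'$ denotes $\partial_x$. $\mathrm{PV}$ denotes the principal value taken at $s=0$. Notation: $$\delta_{[x,s]}f:=f(x)-f(x-s),\qquad T_{[x,s]}f:=\tanh\Big(\frac{\delta_{[x,s]}f}{2}\Big),\qquad t_{[s]}:=\tan\Big(\frac{s}{2}\Big).$$ Constants: $k>0$ (permeability), $\mu>0$ (common viscosity of both fluids), $g$ (gravity), $\rho_\pm$ (densities), with $\Delta_\rho:=g(\rho_--\rho_+)>0$. Domains: $\Omega_-(t):=\{(x,y)\in\mathbb{R}^2: y<f(t,x)\}$, $\Omega_+(t):=\{(x,y)\in\mathbb{R}^2: y>f(t,x)\}$, and $[y=f(t,x)]$ denotes the graph of $f(t)$. Muskat problem (M): the unknowns are $f$, the velocities $v_\pm(t)=(v_\pm^1(t),v_\pm^2(t)):\Omega_\pm(t)\to\mathbb{R}^2$ and the pressures $p_\pm(t):\Omega_\pm(t)\to\mathbb{R}$, where $f(t)$, $v_\pm(t)$, $p_\pm(t)$ are $2\pi$-periodic with respect to $x$, and for all $t\in(0,T)$: - $\operatorname{div} v_\pm(t)=0$ and $v_\pm(t)=-\frac{k}{\mu}\big(\nabla p_\pm(t)+(0,\rho_\pm g)\big)$ in $\Omega_\pm(t)$; - $p_+(t)-p_-(t)=0$ and $\langle v_+(t)|\nu(t)\rangle=\langle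 v_-(t)|\nu(t)\rangle$ on $[y=f(t,x)]$, where $\nu(t)$ is the unit normal at $[y=f(t,x)]$ pointing into $\Omega_+(t)$ and $\langle\cdot|\cdot\rangle$ is the inner product in $\mathbb{R}^2$; - $v_\pm(t,x,y)\to0$ for $|y|\to\infty$, uniformly with respect to $x$; - $\partial_t f(t)=\langle v_\pm(t)|(-f'(t),1)\rangle$ on $[y=f(t,x)]$; together with the initial condition $f(0)=f_0$. *)

theory Defs
  imports "HOL-Analysis.Analysis"
begin

section \<open>Function spaces on the circle\<close>

text \<open>
  Functions on the circle are \<open>2 * pi\<close>-periodic functions on the real line. Elements of
  \<open>L2_circle\<close> and \<open>Sobolev_circle r\<close> are representatives of the classes modulo equality almost
  everywhere, so equality in \<open>L\<^sub>2\<close> is equality almost everywhere, and the topology is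
  the one of the seminorm \<open>L2_norm\<close>.
\<close>

definition periodic :: "(real \<Rightarrow> real) \<Rightarrow> bool" where
  "periodic h \<longleftrightarrow> (\<forall>x. h (x + 2 * pi) = h x)"

definition L2_circle :: "(real \<Rightarrow> real) set" where
  "L2_circle = {h. periodic h \<and> h \<in> borel_measurable lebesgue \<and>
     set_integrable lebesgue {-pi..pi} (\<lambda>x. (h x)\<^sup>2)}"

definition L2_norm :: "(real \<Rightarrow> real) \<Rightarrow> real" where
  "L2_norm h = sqrt (LINT x:{-pi..pi}|lebesgue. (h x)\<^sup>2)"

definition fourier_coeff :: "(real \<Rightarrow> real) \<Rightarrow> int \<Rightarrow> complex" where
  "fourier_coeff h n =
     (LINT x:{-pi..pi}|lebesgue. complex_of_real (h x) * cis (- of_int n * x)) / (2 * pi)"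

definition Sobolev_circle :: "real \<Rightarrow> (real \<Rightarrow> real) set" where
  "Sobolev_circle r = {h \<in> L2_circle.
     (\<lambda>n::int. (1 + (of_int n)\<^sup>2) powr r * (cmod (fourier_coeff h n))\<^sup>2) summable_on UNIV}"

definition continuous_L2 :: "real set \<Rightarrow> (real \<Rightarrow> real \<Rightarrow> real) \<Rightarrow> bool" where
  "continuous_L2 I f \<longleftrightarrow> (\<forall>t\<in>I. f t \<in> L2_circle) \<and>
     (\<forall>t\<in>I. ((\<lambda>s. L2_norm (\<lambda>x. f s x - f t x)) \<longlongrightarrow> 0) (at t within I))"

definition has_L2_derivative ::
  "real set \<Rightarrow> (real \<Rightarrow> real \<Rightarrow> real) \<Rightarrow> (real \<Rightarrow> real) \<Rightarrow> real \<Rightarrow> bool" where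
  "has_L2_derivative I f h t \<longleftrightarrow> (\<forall>s\<in>I. f s \<in> L2_circle) \<and> h \<in> L2_circle \<and>
     ((\<lambda>s. L2_norm (\<lambda>x. (f s x - f t x) / (s - t) - h x)) \<longlongrightarrow> 0) (at t within I)"

definition C1_L2 :: "real set \<Rightarrow> (real \<Rightarrow> real \<Rightarrow> real) \<Rightarrow> bool" where
  "C1_L2 I f \<longleftrightarrow> continuous_L2 I f \<and>
     (\<exists>df. continuous_L2 I df \<and> (\<forall>t\<in>I. has_L2_derivative I f (df t) t))"

definition time_closed :: "ereal \<Rightarrow> real set" where
  "time_closed T = {t. 0 \<le> t \<and> ereal t < T}"

definition time_open :: "ereal \<Rightarrow> real set" where
  "time_open T = {t. 0 < t \<and> ereal t < T}"

text \<open>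
  The regularity of \<open>f\<close> common to both formulations. For positive times the class
  \<open>f t\<close> lies in \<open>H\<^sup>2\<close> and so contains exactly one continuous function, which is of
  class \<open>C\<^sup>1\<close>; as usual \<open>f t\<close> stands for that function, so that the graph of \<open>f t\<close> and
  the pointwise values of \<open>f t\<close> and of \<open>deriv (f t)\<close> make sense.
\<close>

definition interface_regular :: "ereal \<Rightarrow> (real \<Rightarrow> real \<Rightarrow> real) \<Rightarrow> bool" where
  "interface_regular T f \<longleftrightarrow>
     continuous_L2 (time_closed T) f \<and> C1_L2 (time_open T) f \<and>
     (\<forall>t\<in>time_open T. f t \<in> Sobolev_circle 2 \<and> continuous_on UNIV (f t))"


section \<open>Functions of class \<open>C\<^sup>1\<close> and \<open>C\<^sup>2\<close> on planar domains\<close>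

definition C1_on :: "'a::real_normed_vector set \<Rightarrow> ('a \<Rightarrow> 'b::real_normed_vector) \<Rightarrow> bool" where
  "C1_on \<Omega> u \<longleftrightarrow> (\<exists>Du :: 'a \<Rightarrow> 'a \<Rightarrow>\<^sub>L 'b.
     (\<forall>z\<in>\<Omega>. (u has_derivative blinfun_apply (Du z)) (at z)) \<and> continuous_on \<Omega> Du)"

definition C2_on :: "'a::real_normed_vector set \<Rightarrow> ('a \<Rightarrow> 'b::real_normed_vector) \<Rightarrow> bool" where
  "C2_on \<Omega> u \<longleftrightarrow> (\<exists>Du :: 'a \<Rightarrow> 'a \<Rightarrow>\<^sub>L 'b.
     (\<forall>z\<in>\<Omega>. (u has_derivative blinfun_apply (Du z)) (at z)) \<and> C1_on \<Omega> Du)"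

text \<open>
  \<open>C\<^sup>1\<close> up to the boundary of the open set \<open>\<Omega>\<close>: \<open>u\<close> is differentiable in \<open>\<Omega>\<close>, and \<open>u\<close> and its
  derivative extend continuously to \<open>closure \<Omega>\<close>. The values of \<open>u\<close> on the boundary are those of
  its extension.
\<close>

definition C1_on_closure ::
  "'a::real_normed_vector set \<Rightarrow> ('a \<Rightarrow> 'b::real_normed_vector) \<Rightarrow> bool" where
  "C1_on_closure \<Omega> u \<longleftrightarrow> continuous_on (closure \<Omega>) u \<and> (\<exists>Du :: 'a \<Rightarrow> 'a \<Rightarrow>\<^sub>L 'b.
     (\<forall>z\<in>\<Omega>. (u has_derivative blinfun_apply (Du z)) (at z)) \<and> continuous_on (closure \<Omega>) Du)"

definition grad :: "(real \<times> real \<Rightarrow> real) \<Rightarrow> real \<times> real \<Rightarrow> real \<times> real" where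
  "grad p z = (frechet_derivative p (at z) (1, 0), frechet_derivative p (at z) (0, 1))"

definition divergence :: "(real \<times> real \<Rightarrow> real \<times> real) \<Rightarrow> real \<times> real \<Rightarrow> real" where
  "divergence v z =
     fst (frechet_derivative v (at z) (1, 0)) + snd (frechet_derivative v (at z) (0, 1))"


section \<open>The Muskat problem\<close>

definition Omega_minus :: "(real \<Rightarrow> real) \<Rightarrow> (real \<times> real) set" where
  "Omega_minus h = {(x, y). y < h x}"

definition Omega_plus :: "(real \<Rightarrow> real) \<Rightarrow> (real \<times> real) set" where
  "Omega_plus h = {(x, y). y > h x}"

definition unit_normal :: "(real \<Rightarrow> real) \<Rightarrow> real \<Rightarrow> real \<times> real" where
  "unit_normal h x = (1 / sqrt (1 + (deriv h x)\<^sup>2)) *\<^sub>R (- deriv h x, 1)"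

text \<open>
  The conditions on velocity and pressure inside one fluid domain \<open>\<Omega>\<close>, the density being \<open>\<rho>\<close>:
  periodicity, incompressibility, Darcy's law, and decay as \<open>\<bar>y\<bar> \<rightarrow> \<infinity>\<close> uniformly in \<open>x\<close>.
\<close>

definition bulk_equations ::
  "real \<Rightarrow> real \<Rightarrow> real \<Rightarrow> real \<Rightarrow> (real \<times> real) set \<Rightarrow>
   (real \<times> real \<Rightarrow> real \<times> real) \<Rightarrow> (real \<times> real \<Rightarrow> real) \<Rightarrow> bool" where
  "bulk_equations k \<mu> g \<rho> \<Omega> v p \<longleftrightarrow>
     (\<forall>x y. (x, y) \<in> \<Omega> \<longrightarrow> v (x + 2 * pi, y) = v (x, y) \<and> p (x + 2 * pi, y) = p (x, y)) \<and>
     (\<forall>z\<in>\<Omega>. divergence v z = 0 \<and> v z = - (k / \<mu>) *\<^sub>R (grad p z + (0, \<rho> * g))) \<and>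
     (\<forall>\<epsilon>>0. \<exists>R. \<forall>x y. (x, y) \<in> \<Omega> \<and> \<bar>y\<bar> > R \<longrightarrow> norm (v (x, y)) < \<epsilon>)"

text \<open>
  In the kinematic condition \<open>df\<close> is a representative of the \<open>L\<^sub>2\<close>-valued time derivative of \<open>f\<close>.
\<close>

definition solves_muskat ::
  "ereal \<Rightarrow> real \<Rightarrow> real \<Rightarrow> real \<Rightarrow> real \<Rightarrow> real \<Rightarrow> (real \<Rightarrow> real) \<Rightarrow>
   (real \<Rightarrow> real \<Rightarrow> real) \<Rightarrow>
   (real \<Rightarrow> real \<times> real \<Rightarrow> real \<times> real) \<Rightarrow> (real \<Rightarrow> real \<times> real \<Rightarrow> real \<times> real) \<Rightarrow>
   (real \<Rightarrow> real \<times> real \<Rightarrow> real) \<Rightarrow> (real \<Rightarrow> real \<times> real \<Rightarrow> real) \<Rightarrow> bool" where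
  "solves_muskat T k \<mu> g \<rho>plus \<rho>minus f0 f vplus vminus pplus pminus \<longleftrightarrow>
     (\<forall>t\<in>time_open T.
        periodic (f t) \<and>
        bulk_equations k \<mu> g \<rho>plus (Omega_plus (f t)) (vplus t) (pplus t) \<and>
        bulk_equations k \<mu> g \<rho>minus (Omega_minus (f t)) (vminus t) (pminus t) \<and>
        (\<forall>x. pplus t (x, f t x) - pminus t (x, f t x) = 0 \<and>
             vplus t (x, f t x) \<bullet> unit_normal (f t) x =
             vminus t (x, f t x) \<bullet> unit_normal (f t) x) \<and>
        (\<exists>df. has_L2_derivative (time_open T) f df t \<and>
           (\<forall>x. df x = vplus t (x, f t x) \<bullet> (- deriv (f t) x, 1) \<and>
                df x = vminus t (x, f t x) \<bullet> (- deriv (f t) x, 1)))) \<and>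
     (AE x in lebesgue. f 0 x = f0 x)"


section \<open>The contour integral problem\<close>

text \<open>Principal value, taken at \<open>0\<close>, of the integral over \<open>(-pi, pi)\<close>.\<close>

definition has_pv_integral :: "(real \<Rightarrow> real) \<Rightarrow> real \<Rightarrow> bool" where
  "has_pv_integral h J \<longleftrightarrow>
     (\<forall>\<epsilon>. 0 < \<epsilon> \<and> \<epsilon> < pi \<longrightarrow> set_integrable lebesgue ({-pi..-\<epsilon>} \<union> {\<epsilon>..pi}) h) \<and>
     ((\<lambda>\<epsilon>. LINT s:{-pi..-\<epsilon>} \<union> {\<epsilon>..pi}|lebesgue. h s) \<longlongrightarrow> J) (at_right 0)"

definition T_diff :: "(real \<Rightarrow> real) \<Rightarrow> real \<Rightarrow> real \<Rightarrow> real" where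
  "T_diff h x s = tanh ((h x - h (x - s)) / 2)"

text \<open>
  The principal values are required to exist at every \<open>x\<close>; \<open>df\<close> is again a representative of
  the \<open>L\<^sub>2\<close>-valued time derivative of \<open>f\<close>.
\<close>

definition solves_contour ::
  "ereal \<Rightarrow> real \<Rightarrow> real \<Rightarrow> real \<Rightarrow> (real \<Rightarrow> real) \<Rightarrow> (real \<Rightarrow> real \<Rightarrow> real) \<Rightarrow> bool" where
  "solves_contour T k \<mu> \<Delta> f0 f \<longleftrightarrow>
     (\<forall>t\<in>time_open T. \<exists>df. has_L2_derivative (time_open T) f df t \<and>
        (\<forall>x. \<exists>J1 J2.
           has_pv_integral (\<lambda>s. deriv (f t) (x - s) *
             (T_diff (f t) x s * (1 + (tan (s / 2))\<^sup>2) /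
              ((tan (s / 2))\<^sup>2 + (T_diff (f t) x s)\<^sup>2))) J1 \<and>
           has_pv_integral (\<lambda>s. deriv (f t) (x - s) *
             (tan (s / 2) * (1 - (T_diff (f t) x s)\<^sup>2) /
              ((tan (s / 2))\<^sup>2 + (T_diff (f t) x s)\<^sup>2))) J2 \<and>
           df x = - (k * \<Delta> / (4 * pi * \<mu>)) * deriv (f t) x * J1
                  - k * \<Delta> / (4 * pi * \<mu>) * J2)) \<and>
     (AE x in lebesgue. f 0 x = f0 x)"

end

theory Submission
  imports Defs "HOL-Complex_Analysis.Complex_Analysis"
begin

text \<open>
  At a fixed time the complex velocity \<open>F = v\<^sup>1 - \<i> v\<^sup>2\<close> is holomorphic on both sides of the graph
  \<open>\<zeta>(s) = s + \<i> f(s)\<close>: the Cauchy-Riemann equations are incompressibility and Darcy's law. Equality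
  of the pressures prescribes the tangential jump of the velocity, equality of the normal
  velocities says that there is no normal jump; together
  \<open>(F\<^sub>+ - F\<^sub>-) \<zeta>' = (k \<Delta>\<^sub>\<rho> / \<mu>) f'\<close>. The only periodic decaying solution of this jump problem is a
  multiple of the Cauchy integral \<open>\<integral> f'(s) cot ((z - \<zeta>(s)) / 2) ds\<close>, and the mean of its two boundary
  values, given by the principal value, is the right-hand side of the contour integral problem.

  No contour integration is needed. As the domains lie above and below a graph, the cotangent kernel
  at horizontal distance \<open>s\<close> is at most \<open>4 / \<bar>s\<bar>\<close> uniformly in the vertical distance, so
  dominated convergence gives the continuous extensions of the Cauchy integral to the graph.
\<close>

section \<open>The cotangent kernel\<close>

text \<open>The obstacle is the singularity of the cotangent on the graph. It is isolated in one
  explicit computation: for the density 1, the kernel times \<zeta>' has a logarithm as primitive,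
  so its integral is -2 pi i from above the graph, 2 pi i from below, and 0 as a principal value. A
  variable density f' / \<zeta>' differs from its value at the base point by a power of the
  distance, and the integral of this remainder passes continuously through the graph. The power gain
  is the Hoelder bound for f' that membership in H^2 supplies. The constants follow from this. The
  Cauchy integral, taken without prefactor, jumps by -4 pi i f' / \<zeta>', so the factor i k
  \<Delta> / (4 pi \<mu>) produces the required jump of the complex velocity. That jump times
  \<zeta>' is real, hence purely tangential, and the normal velocity sees only the mean of the two
  boundary values. Time is a mere parameter: the time derivative of f is the same function in both
  formulations, and velocities and pressures may be chosen separately at every instant.\<close>

lemma abs_sin_ge_half_abs:
  fixes a :: real
  assumes "\<bar>a\<bar> \<le> pi / 2"
  shows "\<bar>a\<bar> / 2 \<le> \<bar>sin a\<bar>"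
proof -
  have "\<bar>sin a - (\<Sum>m<3. sin_coeff m * a ^ m)\<bar> \<le> inverse (fact 3) * \<bar>a\<bar> ^ 3"
    by (rule Maclaurin_sin_bound)
  then have "\<bar>sin a - a\<bar> \<le> \<bar>a\<bar> ^ 3 / 6"
    by (simp add: sin_coeff_def numeral_eq_Suc)
  \<comment> \<open>On this range a^2 <= 1.6^2 < 3, so the cubic Taylor remainder is at most half of
    \<bar>a\<bar>. Jordan's inequality has the better constant 2 / pi; 1 / 2 suffices here.\<close>
  moreover have "\<bar>a\<bar> ^ 3 \<le> 3 * \<bar>a\<bar>"
  proof -
    have "pi < 3.2" using pi_approx by simp
    then have "\<bar>a\<bar> \<le> 1.6" using assms by simp
    then have "\<bar>a\<bar> * \<bar>a\<bar> \<le> 1.6 * 1.6" by (intro mult_mono) auto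
    then have "\<bar>a\<bar> * (\<bar>a\<bar> * \<bar>a\<bar>) \<le> \<bar>a\<bar> * 3" by (intro mult_left_mono) auto
    then show ?thesis by (simp add: power3_eq_cube mult.assoc mult.commute)
  qed
  ultimately show ?thesis by linarith
qed

lemma Re_sin_Complex: "Re (sin (Complex a b)) = sin a * cosh b"
  and Im_sin_Complex: "Im (sin (Complex a b)) = cos a * sinh b"
  by (simp_all add: Re_sin Im_sin cosh_def sinh_def)

lemma Re_cos_Complex: "Re (cos (Complex a b)) = cos a * cosh b"
  and Im_cos_Complex: "Im (cos (Complex a b)) = - (sin a * sinh b)"
  by (simp_all add: Re_cos Im_cos cosh_def sinh_def field_simps)

lemma sin_Complex_eq_0_iff: "sin (Complex a b) = 0 \<longleftrightarrow> sin a = 0 \<and> b = 0"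
proof -
  have "cosh b \<noteq> 0" using cosh_real_pos[of b] by linarith
  moreover have "cos a \<noteq> 0" if "sin a = 0" using sin_cos_squared_add[of a] that by auto
  ultimately show ?thesis
    by (auto simp: complex_eq_iff Re_sin_Complex Im_sin_Complex)
qed

text \<open>Since \<bar>sin\<bar>^2 and \<bar>cos\<bar>^2 at a + i b are sin^2 a + sinh^2 b and
  cos^2 a + sinh^2 b, the quotient is at most 1 / \<bar>sin a\<bar>, whatever b is. This uniformity
  in b yields one dominating function for all vertical distances.\<close>

lemma norm_cot_le:
  assumes "a \<noteq> 0" "\<bar>a\<bar> \<le> pi / 2"
  shows "norm (cot (Complex a b)) \<le> 2 / \<bar>a\<bar>"
proof -
  define S C where "S = norm (sin (Complex a b))" and "C = norm (cos (Complex a b))"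
  have sa: "\<bar>a\<bar> / 2 \<le> \<bar>sin a\<bar>" using assms abs_sin_ge_half_abs by blast
  then have s0: "sin a \<noteq> 0" using assms by auto
  have S2: "S\<^sup>2 = (sin a)\<^sup>2 + (sinh b)\<^sup>2"
    unfolding S_def cmod_power2 Re_sin_Complex Im_sin_Complex
    by (simp add: power_mult_distrib cosh_square_eq cos_squared_eq algebra_simps)
  have C2: "C\<^sup>2 = (cos a)\<^sup>2 + (sinh b)\<^sup>2"
    unfolding C_def cmod_power2 Re_cos_Complex Im_cos_Complex
    by (simp add: power_mult_distrib cosh_square_eq sin_squared_eq algebra_simps)
  have "(C * sin a)\<^sup>2 \<le> S\<^sup>2"
  proof -
    have "(sin a)\<^sup>2 \<le> 1" "(cos a)\<^sup>2 \<le> 1" by (simp_all add: abs_square_le_1)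
    then have "(cos a)\<^sup>2 * (sin a)\<^sup>2 \<le> (sin a)\<^sup>2" "(sinh b)\<^sup>2 * (sin a)\<^sup>2 \<le> (sinh b)\<^sup>2"
      by (simp_all add: mult_left_le mult_left_le_one_le)
    then show ?thesis unfolding power_mult_distrib C2 S2 by (simp add: algebra_simps)
  qed
  then have "\<bar>C * sin a\<bar> \<le> S" unfolding S_def by (rule abs_le_square_iff[THEN iffD2, of _ "norm _", simplified])
  then have "C * \<bar>sin a\<bar> \<le> S" by (simp add: abs_mult C_def)
  then have *: "C * (\<bar>a\<bar> / 2) \<le> S"
    using sa mult_left_mono[OF sa, of C] by (auto simp: C_def)
  have "S \<noteq> 0" using s0 S_def sin_Complex_eq_0_iff by auto
  then have "S > 0" by (simp add: S_def)
  have "norm (cot (Complex a b)) = C / S"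
    by (simp add: cot_def norm_divide C_def S_def)
  also have "\<dots> \<le> 2 / \<bar>a\<bar>"
    using * \<open>S > 0\<close> assms by (simp add: field_simps)
  finally show ?thesis .
qed

lemma cot_add_pi: "cot (w + of_real pi) = cot w" for w :: complex
  by (simp only: cot_def sin_add cos_add sin_of_real cos_of_real sin_pi cos_pi) simp

lemma sin_half_diff_nonzero:
  assumes "w \<noteq> z" "\<bar>Re w - Re z\<bar> \<le> pi"
  shows "sin ((w - z) / 2) \<noteq> 0"
proof
  assume "sin ((w - z) / 2) = 0"
  moreover have "(w - z) / 2 = Complex ((Re w - Re z) / 2) ((Im w - Im z) / 2)"
    by (simp add: complex_eq_iff)
  ultimately have "sin ((Re w - Re z) / 2) = 0" and i: "Im w = Im z"
    by (auto simp: sin_Complex_eq_0_iff)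
  moreover have "\<bar>(Re w - Re z) / 2\<bar> \<le> pi / 2" using assms(2) by auto
  ultimately have "Re w = Re z" using abs_sin_ge_half_abs[of "(Re w - Re z) / 2"] by auto
  with i assms(1) show False by (simp add: complex_eq_iff)
qed

text \<open>The components are, up to a sign, the kernels of the contour integral problem.\<close>

lemma cot_Complex_half:
  fixes s d :: real
  assumes "-pi < s" "s < pi" "s \<noteq> 0"
  defines "t \<equiv> tan (s / 2)" and "T \<equiv> tanh (d / 2)"
  shows "cot (Complex (s / 2) (d / 2)) =
    Complex (t * (1 - T\<^sup>2) / (t\<^sup>2 + T\<^sup>2)) (- (T * (1 + t\<^sup>2) / (t\<^sup>2 + T\<^sup>2)))"
proof -
  let ?s = "sin (s/2)" and ?c = "cos (s/2)" and ?S = "sinh (d/2)" and ?C = "cosh (d/2)"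
  have c: "?c > 0" using assms by (intro cos_gt_zero_pi) auto
  have C: "?C > 0" by simp
  have sq: "?s\<^sup>2 = 1 - ?c\<^sup>2" "?S\<^sup>2 = ?C\<^sup>2 - 1" by (simp_all add: sin_squared_eq sinh_square_eq)
  have s0: "?s \<noteq> 0"
  proof -
    have "\<bar>s/2\<bar> / 2 \<le> \<bar>?s\<bar>" using assms by (intro abs_sin_ge_half_abs) auto
    then show ?thesis using assms by auto
  qed
  have t: "t = ?s / ?c" and T: "T = ?S / ?C" by (simp_all add: t_def T_def tan_def tanh_def)
  have sn: "sin (Complex (s/2) (d/2)) = Complex (?c * ?C * t) (?c * ?C * T)"
    using c C by (simp add: complex_eq_iff Re_sin_Complex Im_sin_Complex t T)
  have cs: "cos (Complex (s/2) (d/2)) = Complex (?c * ?C) (- (?c * ?C * t * T))"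
    using c C by (simp add: complex_eq_iff Re_cos_Complex Im_cos_Complex t T)
  have t0: "t \<noteq> 0" using s0 c by (simp add: t)
  then have D: "t\<^sup>2 + T\<^sup>2 > 0" by (simp add: add_pos_nonneg)
  \<comment> \<open>Dividing sine and cosine by cos (s/2) cosh (d/2) turns the cotangent into (1 - i
    t T) / (t + i T); \<open>?R\<close> is this quotient with its denominator made real.\<close>
  let ?R = "Complex (t * (1 - T\<^sup>2) / (t\<^sup>2 + T\<^sup>2)) (- (T * (1 + t\<^sup>2) / (t\<^sup>2 + T\<^sup>2)))"
  have "?R * Complex t T = Complex 1 (- (t * T))"
    using D t0 by (simp add: complex_eq_iff divide_simps) (simp add: algebra_simps power2_eq_square)
  then have "?R * (of_real (?c * ?C) * Complex t T) = of_real (?c * ?C) * Complex 1 (- (t * T))"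
    by (simp only: mult.left_commute)
  then have "?R * sin (Complex (s/2) (d/2)) = cos (Complex (s/2) (d/2))"
    unfolding sn cs by (simp add: complex_eq_iff algebra_simps)
  moreover have "sin (Complex (s/2) (d/2)) \<noteq> 0"
    using s0 by (simp add: sin_Complex_eq_0_iff)
  ultimately show ?thesis by (simp add: cot_def field_simps)
qed

text \<open>In terms of q = exp (2 i w) the left-hand side is 2 i q / (q - 1). Its numerator decays
  like exp (-2 Im w), and \<bar>q\<bar> <= 1/2 keeps the denominator away from 0.\<close>

lemma cot_add_ii_bound:
  assumes "Im w \<ge> 1"
  shows "norm (cot w + \<i>) \<le> 4 * exp (- 2 * Im w)"
proof -
  define q where "q = exp (2 * \<i> * w)"
  have nq: "norm q = exp (- 2 * Im w)" by (simp add: q_def)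
  have "exp (-2 * Im w) \<le> exp (-1)" using assms by simp
  also have "\<dots> \<le> (1/2::real)" using exp_ge_add_one_self[of 1] by (simp add: exp_minus field_simps)
  finally have q2: "norm q \<le> 1/2" by (simp add: nq)
  then have d: "norm (q - 1) \<ge> 1/2"
    using norm_triangle_ineq2[of 1 q] by (simp add: norm_minus_commute)
  have e: "q = exp (\<i> * w) * exp (\<i> * w)" by (simp add: q_def mult.assoc flip: exp_add mult_2)
  have m: "exp (-(\<i> * w)) = 1 / exp (\<i> * w)" by (simp add: exp_minus field_simps)
  have q1: "q \<noteq> 1" using d by auto
  have "cot w + \<i> = 2 * \<i> * q / (q - 1)"
    unfolding cot_def sin_exp_eq cos_exp_eq m e using q1[unfolded e]
    by (simp add: field_simps)
  then have "norm (cot w + \<i>) = 2 * norm q / norm (q - 1)"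
    by (simp add: norm_mult norm_divide)
  also have "\<dots> \<le> 2 * norm q / (1/2)"
    using d by (intro divide_left_mono) auto
  finally show ?thesis by (simp add: nq)
qed

lemma cot_minus_ii_bound:
  assumes "Im w \<le> -1"
  shows "norm (cot w - \<i>) \<le> 4 * exp (2 * Im w)"
proof -
  have "cot (- w) = - cot w" by (simp add: cot_def)
  then have "norm (cot w - \<i>) = norm (cot (-w) + \<i>)"
    by (metis minus_diff_eq norm_minus_cancel uminus_add_conv_diff add.commute diff_conv_add_uminus minus_add_distrib minus_minus)
  then show ?thesis using cot_add_ii_bound[of "-w"] assms by simp
qed

section \<open>Cauchy integrals over periodic graphs\<close>

text \<open>A period integral may be centred at any point, with the orientation of the variable
  reversed. It is used to put the singularity of the kernel, or the point at which a Fourier series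
  is tested, at s = 0.\<close>

lemma integral_periodic_reflect_shift:
  fixes f :: "real \<Rightarrow> complex"
  assumes cont: "continuous_on UNIV f" and per: "\<And>x. f (x + 2 * pi) = f x"
  shows "integral {-pi..pi} (\<lambda>s. f (x - s)) = integral {-pi..pi} f"
proof -
  \<comment> \<open>The primitive \<open>g\<close> is only obtained on a compact interval;
    \<open>B\<close> has to exceed \<bar>x\<bar> + 1 + pi so that u + pi and u - pi stay in its
    interior below.\<close>
  define B where "B = \<bar>x\<bar> + 8"
  have pi4: "pi < 4" "0 < pi" using pi_less_4 by simp_all
  obtain g where g: "\<And>u. u \<in> {-B..B} \<Longrightarrow> (g has_vector_derivative f u) (at u within {-B..B})"
    using antiderivative_continuous[OF continuous_on_subset[OF cont subset_UNIV, of "{-B..B}"]] by blast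
  have g': "(g has_vector_derivative f u) (at u)" if "-B < u" "u < B" for u
    using g[of u] that at_within_Icc_at[of "-B" u B] by auto
  have 1: "(f has_integral g pi - g (-pi)) {-pi..pi}"
  proof (rule fundamental_theorem_of_calculus)
    fix u assume "u \<in> {-pi..pi}"
    then have "- B < u" "u < B" unfolding B_def atLeastAtMost_iff using pi4 by linarith+
    then show "(g has_vector_derivative f u) (at u within {-pi..pi})"
      by (intro has_vector_derivative_at_within[OF g'])
  qed auto
  have 2: "((\<lambda>s. f (x - s)) has_integral - g (x - pi) - (- g (x - - pi))) {-pi..pi}"
  proof (rule fundamental_theorem_of_calculus)
    fix s assume s: "s \<in> {-pi..pi}"
    have b: "- B < x - s" "x - s < B"
      unfolding B_def using pi4 s[unfolded atLeastAtMost_iff] by linarith+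
    have "(g \<circ> (\<lambda>s. x - s) has_vector_derivative ((0 - 1) *\<^sub>R f (x - s))) (at s)"
      using b by (intro vector_diff_chain_at has_vector_derivative_diff has_vector_derivative_const
          has_vector_derivative_id g')
    then have "((\<lambda>s. - g (x - s)) has_vector_derivative - ((0 - 1) *\<^sub>R f (x - s))) (at s)"
      unfolding o_def by (rule has_vector_derivative_minus)
    then have "((\<lambda>s. - g (x - s)) has_vector_derivative f (x - s)) (at s)" by simp
    then show "((\<lambda>s. - g (x - s)) has_vector_derivative f (x - s)) (at s within {-pi..pi})"
      by (rule has_vector_derivative_at_within)
  qed auto
  \<comment> \<open>\<open>Q\<close> is the integral of f over the window of length 2 pi around u.
    Its derivative f (u + pi) - f (u - pi) vanishes by periodicity.\<close>
  define Q where "Q u = g (u + pi) - g (u - pi)" for u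
  have Q: "(Q has_derivative (\<lambda>h. 0)) (at u)" if "u \<in> {-\<bar>x\<bar>-1..\<bar>x\<bar>+1}" for u
  proof -
    have "-\<bar>x\<bar> - 1 \<le> u" "u \<le> \<bar>x\<bar> + 1" using that by simp_all
    then have b: "- B < u + pi" "u + pi < B" "- B < u - pi" "u - pi < B"
      unfolding B_def using pi4 by linarith+
    have "(g \<circ> (\<lambda>s. s + pi) has_vector_derivative ((1 + 0) *\<^sub>R f (u + pi))) (at u)"
      using b by (intro vector_diff_chain_at has_vector_derivative_add has_vector_derivative_const
          has_vector_derivative_id g')
    moreover have "(g \<circ> (\<lambda>s. s - pi) has_vector_derivative ((1 - 0) *\<^sub>R f (u - pi))) (at u)"
      using b by (intro vector_diff_chain_at has_vector_derivative_diff has_vector_derivative_const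
          has_vector_derivative_id g')
    ultimately have "(Q has_vector_derivative ((1 + 0) *\<^sub>R f (u + pi) - (1 - 0) *\<^sub>R f (u - pi))) (at u)"
      unfolding o_def Q_def by (rule has_vector_derivative_diff)
    moreover have "f (u + pi) = f (u - pi)" using per[of "u - pi"] by (simp add: algebra_simps)
    ultimately show ?thesis by (simp add: has_vector_derivative_def)
  qed
  have x: "- \<bar>x\<bar> - 1 \<le> x" "x \<le> \<bar>x\<bar> + 1" by linarith+
  have "Q x = Q 0"
    by (rule has_derivative_zero_unique[of "{-\<bar>x\<bar>-1..\<bar>x\<bar>+1}" Q])
       (simp_all add: has_derivative_at_withinI[OF Q] x)
  then show ?thesis using integral_unique[OF 1] integral_unique[OF 2] by (simp add: Q_def)
qed

lemma continuous_on_sin_complex [continuous_intros]: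
  fixes f :: "'a::topological_space \<Rightarrow> complex"
  assumes "continuous_on A f"
  shows "continuous_on A (\<lambda>x. sin (f x))"
  by (rule continuous_on_compose2[OF continuous_on_sin[OF continuous_on_id, of UNIV] assms]) auto

lemma continuous_on_cot_complex [continuous_intros]:
  fixes f :: "'a::topological_space \<Rightarrow> complex"
  assumes "continuous_on A f" "\<And>x. x \<in> A \<Longrightarrow> sin (f x) \<noteq> 0"
  shows "continuous_on A (\<lambda>x. cot (f x))"
  using assms unfolding cot_def
  by (intro continuous_on_divide continuous_on_sin_complex
      continuous_on_compose2[OF continuous_on_cos[OF continuous_on_id, of UNIV] assms(1)]) auto

text \<open>A periodic C^1 graph is enough for the kernel with density 1, for holomorphy and decay
  of the Cauchy integral, and for the uniqueness theorem. The boundary values of the Cauchy integral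
  are treated in \<open>holder_graph\<close>.\<close>

locale periodic_graph =
  fixes h h' :: "real \<Rightarrow> real"
  assumes h_periodic: "h (x + 2 * pi) = h x"
    and h_deriv: "(h has_real_derivative h' x) (at x)"
    and h'_cont: "continuous_on UNIV h'"
begin

definition crv :: "real \<Rightarrow> complex" where "crv s = Complex s (h s)"
definition dcrv :: "real \<Rightarrow> complex" where "dcrv s = Complex 1 (h' s)"

text \<open>The argument of the cotangent when the evaluation point lies at signed height \<eta>
  over the graph point at x and s is the horizontal distance to the integration point; \<eta> = 0 is
  the principal value case.\<close>

definition hdiff :: "real \<Rightarrow> real \<Rightarrow> real \<Rightarrow> complex" where
  "hdiff x \<eta> s = Complex (s / 2) ((h x + \<eta> - h (x - s)) / 2)"

lemma hdiff_eq: "hdiff x \<eta> s = (crv x + \<i> * of_real \<eta> - crv (x - s)) / 2"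
  by (simp add: hdiff_def crv_def complex_eq_iff)

lemma h_cont: "continuous_on A h"
  using h_deriv by (intro continuous_at_imp_continuous_on) (auto intro: DERIV_isCont)

lemma h_continuous_on [continuous_intros]:
  "continuous_on A f \<Longrightarrow> continuous_on A (\<lambda>x. h (f x))"
  by (rule continuous_on_compose2[OF h_cont[of UNIV]]) auto

lemma h'_continuous_on [continuous_intros]:
  "continuous_on A f \<Longrightarrow> continuous_on A (\<lambda>x. h' (f x))"
  by (rule continuous_on_compose2[OF h'_cont]) auto

lemma h'_periodic: "h' (x + 2 * pi) = h' x"
proof -
  have "((\<lambda>x. h (x + 2 * pi)) has_real_derivative h' (x + 2 * pi)) (at x)"
    by (rule DERIV_shift[THEN iffD1]) (rule h_deriv)
  then show ?thesis using h_deriv[of x] by (simp add: h_periodic DERIV_unique)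
qed

lemma h_periodic_int: "h (x + 2 * pi * of_int n) = h x"
proof -
  interpret periodic_fun_simple h "2 * pi" by standard (rule h_periodic)
  show ?thesis using plus_of_int[of x n] by (simp add: mult.commute)
qed

lemma h_minus_pi: "h (x - pi) = h (x + pi)"
  using h_periodic[of "x - pi"] by (simp add: algebra_simps)

lemma crv_deriv: "(crv has_vector_derivative dcrv s) (at s)"
proof -
  have "((\<lambda>s. of_real s + \<i> * of_real (h s)) has_vector_derivative (of_real 1 + \<i> * of_real (h' s))) (at s)"
    by (intro has_vector_derivative_add has_vector_derivative_mult_right has_vector_derivative_of_real
        h_deriv h_deriv[unfolded has_real_derivative_iff_has_vector_derivative]
        DERIV_ident[unfolded has_real_derivative_iff_has_vector_derivative])
  then show ?thesis by (simp add: crv_def[abs_def] dcrv_def Complex_eq)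
qed

lemma crv_periodic: "crv (x + 2 * pi) = crv x + 2 * of_real pi"
  by (simp add: crv_def h_periodic complex_eq_iff)

lemma dcrv_continuous_on [continuous_intros]:
  "continuous_on A f \<Longrightarrow> continuous_on A (\<lambda>x. dcrv (f x))"
  unfolding dcrv_def by (intro continuous_intros)

lemma crv_continuous_on [continuous_intros]:
  "continuous_on A f \<Longrightarrow> continuous_on A (\<lambda>x. crv (f x))"
  unfolding crv_def by (intro continuous_intros)

lemma dcrv_nonzero: "dcrv x \<noteq> 0"
  by (simp add: dcrv_def complex_eq_iff)

lemma norm_dcrv_ge_1: "norm (dcrv x) \<ge> 1"
  using abs_Re_le_cmod[of "dcrv x"] by (simp add: dcrv_def)

lemma norm_dcrv_le: "\<bar>h' x\<bar> \<le> M \<Longrightarrow> norm (dcrv x) \<le> 1 + M"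
  using cmod_le[of "dcrv x"] by (simp add: dcrv_def)

lemma hdiff_continuous_on [continuous_intros]:
  "continuous_on A f \<Longrightarrow> continuous_on A g \<Longrightarrow> continuous_on A k \<Longrightarrow>
    continuous_on A (\<lambda>x. hdiff (f x) (g x) (k x))"
  unfolding hdiff_def by (intro continuous_intros) auto

lemma hdiff_deriv: "((\<lambda>s. hdiff x \<eta> s) has_vector_derivative dcrv (x - s) / 2) (at s)"
proof -
  have "(crv \<circ> (\<lambda>s. x - s) has_vector_derivative ((0 - 1) *\<^sub>R dcrv (x - s))) (at s)"
    by (rule vector_diff_chain_at) (auto intro!: derivative_eq_intros crv_deriv)
  then have "((\<lambda>s. crv (x - s)) has_vector_derivative - dcrv (x - s)) (at s)"
    by (simp add: o_def)
  then have "((\<lambda>s. (crv x + \<i> * of_real \<eta> - crv (x - s)) / 2) has_vector_derivative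
      (0 - (- dcrv (x - s))) / 2) (at s)"
    by (intro has_vector_derivative_divide has_vector_derivative_diff has_vector_derivative_const)
  then show ?thesis by (simp add: hdiff_eq)
qed

lemma sin_hdiff_nonzero:
  assumes "s \<in> {-pi..pi}" "s \<noteq> 0 \<or> \<eta> \<noteq> 0"
  shows "sin (hdiff x \<eta> s) \<noteq> 0"
proof
  assume "sin (hdiff x \<eta> s) = 0"
  then have s: "sin (s / 2) = 0" "h x + \<eta> - h (x - s) = 0"
    by (auto simp: hdiff_def sin_Complex_eq_0_iff)
  have "\<bar>s / 2\<bar> \<le> pi / 2" using assms(1) by auto
  then have "s = 0" using abs_sin_ge_half_abs[of "s/2"] s by auto
  then show False using s assms by simp
qed

text \<open>
  Along the graph, \<open>\<plusminus>\<i> sin\<close> of the half difference avoids the branch cut of the logarithm, so an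
  explicit antiderivative is available.
\<close>

lemma Ln_sin_hdiff_deriv:
  assumes "c \<noteq> 0" "c * sin (hdiff x \<eta> s) \<notin> \<real>\<^sub>\<le>\<^sub>0"
  shows "((\<lambda>s. 2 * Ln (c * sin (hdiff x \<eta> s))) has_vector_derivative
    dcrv (x - s) * cot (hdiff x \<eta> s)) (at s)"
proof -
  have "((\<lambda>w. 2 * Ln (c * sin w)) has_field_derivative
      (2 * (c * cos (hdiff x \<eta> s) / (c * sin (hdiff x \<eta> s))))) (at (hdiff x \<eta> s))"
    using assms by (auto intro!: derivative_eq_intros simp: field_simps)
  moreover have "2 * (c * cos (hdiff x \<eta> s) / (c * sin (hdiff x \<eta> s))) = 2 * cot (hdiff x \<eta> s)"
    using assms by (simp add: cot_def)
  ultimately have "((\<lambda>w. 2 * Ln (c * sin w)) \<circ> hdiff x \<eta> has_vector_derivative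
      (dcrv (x - s) / 2) * (2 * cot (hdiff x \<eta> s))) (at s)"
    using field_vector_diff_chain_at[OF hdiff_deriv] by metis
  then show ?thesis by (simp add: o_def)
qed

text \<open>This is the origin of the jump. The primitive is a logarithm whose argument has the same
  modulus at both ends of the period, while its angle changes by a half turn in a direction given by
  the side of the graph; the factor 2 in the primitive turns the half turn into 2 pi i.\<close>

lemma has_integral_dcrv_cot:
  assumes "\<eta> \<noteq> 0"
  shows "((\<lambda>s. dcrv (x - s) * cot (hdiff x \<eta> s)) has_integral - (2 * pi * \<i> * of_real (sgn \<eta>))) {-pi..pi}"
proof -
  \<comment> \<open>A value of \<open>c * sin (hdiff x \<eta> s)\<close> on the branch cut would
    need s = 0, and there this choice of \<open>c\<close> gives the positive number sinh
    (\<bar>\<eta>\<bar> / 2).\<close>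
  define c :: complex where "c = - (\<i> * of_real (sgn \<eta>))"
  have c0: "c \<noteq> 0" using assms by (simp add: c_def sgn_if)
  let ?V = "\<lambda>s. 2 * Ln (c * sin (hdiff x \<eta> s))"
  have 1: "((\<lambda>s. dcrv (x - s) * cot (hdiff x \<eta> s)) has_integral ?V pi - ?V (-pi)) {-pi..pi}"
  proof (rule fundamental_theorem_of_calculus)
    fix s :: real assume s: "s \<in> {-pi..pi}"
    have "c * sin (hdiff x \<eta> s) \<notin> \<real>\<^sub>\<le>\<^sub>0"
    proof
      assume "c * sin (hdiff x \<eta> s) \<in> \<real>\<^sub>\<le>\<^sub>0"
      then have "sgn \<eta> * Re (sin (hdiff x \<eta> s)) = 0" "sgn \<eta> * Im (sin (hdiff x \<eta> s)) \<le> 0"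
        by (auto simp: complex_nonpos_Reals_iff c_def)
      then have z: "sin (s/2) = 0" "sgn \<eta> * (cos (s/2) * sinh ((h x + \<eta> - h (x - s)) / 2)) \<le> 0"
        using assms cosh_real_pos[of "(h x + \<eta> - h (x - s)) / 2"]
        by (auto simp: hdiff_def Re_sin_Complex Im_sin_Complex sgn_eq_0_iff)
      have "s = 0" using abs_sin_ge_half_abs[of "s/2"] s z by auto
      then have "sgn \<eta> * sinh (\<eta> / 2) \<le> 0" using z by simp
      then show False using assms by (auto simp: sgn_if split: if_splits)
    qed
    then show "(?V has_vector_derivative dcrv (x - s) * cot (hdiff x \<eta> s)) (at s within {-pi..pi})"
      by (rule has_vector_derivative_at_within[OF Ln_sin_hdiff_deriv[OF c0]])
  qed auto
  define r where "r = cosh ((h x + \<eta> - h (x + pi)) / 2)"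
  have r: "r > 0" by (simp add: r_def)
  have p: "sin (hdiff x \<eta> pi) = of_real r" "sin (hdiff x \<eta> (-pi)) = - of_real r"
    by (simp_all add: hdiff_def complex_eq_iff Re_sin_Complex Im_sin_Complex r_def h_minus_pi)
  have "?V pi - ?V (-pi) = - (2 * pi * \<i> * of_real (sgn \<eta>))"
  proof (cases "\<eta> > 0")
    case True
    then have c: "c = -\<i>" by (simp add: c_def)
    have "Ln (-\<i> * of_real r) = Ln (-\<i>) + of_real (ln r)" "Ln (\<i> * of_real r) = Ln \<i> + of_real (ln r)"
      using r Ln_times_of_real[of r "-\<i>"] Ln_times_of_real[of r "\<i>"] by (simp_all add: mult.commute Ln_of_real add.commute)
    then show ?thesis unfolding c p using True by (simp add: field_simps)
  next
    case False
    then have c: "c = \<i>" using assms by (simp add: c_def)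
    have "Ln (-\<i> * of_real r) = Ln (-\<i>) + of_real (ln r)" "Ln (\<i> * of_real r) = Ln \<i> + of_real (ln r)"
      using r Ln_times_of_real[of r "-\<i>"] Ln_times_of_real[of r "\<i>"] by (simp_all add: mult.commute Ln_of_real add.commute)
    then show ?thesis unfolding c p using False assms by (simp add: field_simps)
  qed
  then show ?thesis using 1 by (simp only:)
qed

lemma dcrv_cot_continuous_on:
  assumes "A \<subseteq> {-pi..pi}" "\<eta> \<noteq> 0 \<or> 0 \<notin> A" "continuous_on A f"
  shows "continuous_on A (\<lambda>s. f s * cot (hdiff x \<eta> s))"
proof -
  have "sin (hdiff x \<eta> s) \<noteq> 0" if "s \<in> A" for s
    using assms that by (intro sin_hdiff_nonzero) auto
  then show ?thesis using assms by (intro continuous_intros) auto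
qed

text \<open>
  The two antiderivatives cancel at \<open>\<plusminus>\<pi>\<close> by periodicity, and at \<open>\<plusminus>\<epsilon>\<close> in the limit because the
  graph has a tangent.
\<close>

lemma tendsto_pv_dcrv_cot:
  "((\<lambda>\<epsilon>. integral {-pi..-\<epsilon>} (\<lambda>s. dcrv (x - s) * cot (hdiff x 0 s)) +
          integral {\<epsilon>..pi} (\<lambda>s. dcrv (x - s) * cot (hdiff x 0 s))) \<longlongrightarrow> 0) (at_right 0)"
proof -
  let ?k = "\<lambda>s. dcrv (x - s) * cot (hdiff x 0 s)"
  define S where "S s = sin (hdiff x 0 s)" for s
  have ReS: "Re (S s) = sin (s/2) * cosh ((h x - h (x - s)) / 2)" for s
    by (simp add: S_def hdiff_def Re_sin_Complex)
  \<comment> \<open>Dividing both arguments by \<epsilon> leaves the difference of the logarithms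
    unchanged and turns them into difference quotients of \<open>S\<close> at 0. Both tend to
    \<open>dcrv x / 2\<close>, whose real part is positive, so the logarithm is continuous at the
    limit.\<close>
  have eq: "integral {-pi..-\<epsilon>} ?k + integral {\<epsilon>..pi} ?k =
      2 * (Ln ((- S (-\<epsilon>)) / of_real \<epsilon>) - Ln (S \<epsilon> / of_real \<epsilon>))" if e: "0 < \<epsilon>" "\<epsilon> < pi" for \<epsilon>
  proof -
    have 1: "(?k has_integral 2 * Ln (1 * S pi) - 2 * Ln (1 * S \<epsilon>)) {\<epsilon>..pi}"
      unfolding S_def
    proof (rule fundamental_theorem_of_calculus)
      fix s assume s: "s \<in> {\<epsilon>..pi}"
      then have "0 < sin (s/2)" using e by (intro sin_gt_zero) auto
      then have "Re (1 * sin (hdiff x 0 s)) > 0" using ReS[of s] by (simp add: S_def)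
      then have "1 * sin (hdiff x 0 s) \<notin> \<real>\<^sub>\<le>\<^sub>0" by (auto simp: complex_nonpos_Reals_iff)
      then show "((\<lambda>s. 2 * Ln (1 * sin (hdiff x 0 s))) has_vector_derivative ?k s) (at s within {\<epsilon>..pi})"
        by (intro has_vector_derivative_at_within[OF Ln_sin_hdiff_deriv]) auto
    qed (use e in auto)
    have 2: "(?k has_integral 2 * Ln (-1 * S (-\<epsilon>)) - 2 * Ln (-1 * S (-pi))) {-pi..-\<epsilon>}"
      unfolding S_def
    proof (rule fundamental_theorem_of_calculus)
      fix s assume s: "s \<in> {-pi..-\<epsilon>}"
      then have "0 < sin (-s/2)" using e by (intro sin_gt_zero) auto
      then have "sin (s/2) < 0" by simp
      then have "Re (-1 * sin (hdiff x 0 s)) > 0" using ReS[of s] by (simp add: S_def mult_neg_pos)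
      then have "-1 * sin (hdiff x 0 s) \<notin> \<real>\<^sub>\<le>\<^sub>0" by (auto simp: complex_nonpos_Reals_iff)
      then show "((\<lambda>s. 2 * Ln (-1 * sin (hdiff x 0 s))) has_vector_derivative ?k s) (at s within {-pi..-\<epsilon>})"
        by (intro has_vector_derivative_at_within[OF Ln_sin_hdiff_deriv]) auto
    qed (use e in auto)
    have p: "S pi = -1 * S (-pi)"
      by (simp add: S_def hdiff_def complex_eq_iff Re_sin_Complex Im_sin_Complex h_minus_pi)
    have nz: "S \<epsilon> \<noteq> 0" "S (-\<epsilon>) \<noteq> 0"
      unfolding S_def using e by (intro sin_hdiff_nonzero; auto)+
    have l: "Ln ((- S (-\<epsilon>)) / of_real \<epsilon>) = Ln (- S (-\<epsilon>)) - ln \<epsilon>" "Ln (S \<epsilon> / of_real \<epsilon>) = Ln (S \<epsilon>) - ln \<epsilon>"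
      by (rule Ln_divide_of_real; use e nz in simp)+
    then show ?thesis
      unfolding integral_unique[OF 1] integral_unique[OF 2] l p by (simp add: algebra_simps)
  qed
  have "(S has_vector_derivative dcrv x / 2) (at 0)"
  proof -
    have "((\<lambda>w. sin w) has_field_derivative cos (hdiff x 0 0)) (at (hdiff x 0 0))"
      by (auto intro!: derivative_eq_intros)
    from field_vector_diff_chain_at[OF hdiff_deriv this]
    moreover have "hdiff x 0 0 = 0" by (simp add: hdiff_def complex_eq_iff)
    ultimately show ?thesis by (simp add: S_def[abs_def] o_def)
  qed
  moreover have S0: "S 0 = 0" by (simp add: S_def hdiff_def complex_eq_iff Re_sin_Complex Im_sin_Complex)
  ultimately have lim: "((\<lambda>s. S s /\<^sub>R s) \<longlongrightarrow> dcrv x / 2) (at 0)"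
  proof -
    assume "(S has_vector_derivative dcrv x / 2) (at 0)" "S 0 = 0"
    then have "((\<lambda>s. norm (S s - s *\<^sub>R (dcrv x / 2)) / norm s) \<longlongrightarrow> 0) (at 0)"
      by (simp add: has_vector_derivative_def has_derivative_at)
    then have "((\<lambda>s. norm (S s /\<^sub>R s - dcrv x / 2)) \<longlongrightarrow> 0) (at 0)"
    proof (rule Lim_transform_eventually)
      have "norm (S s - s *\<^sub>R (dcrv x / 2)) / norm s = norm (S s /\<^sub>R s - dcrv x / 2)" if "s \<noteq> 0" for s
      proof -
        have "S s /\<^sub>R s - dcrv x / 2 = (S s - s *\<^sub>R (dcrv x / 2)) /\<^sub>R s"
          unfolding scaleR_diff_right using that by simp
        then show ?thesis by (simp only: norm_scaleR real_norm_def abs_inverse divide_inverse mult.commute)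
      qed
      then show "\<forall>\<^sub>F s in at 0. norm (S s - s *\<^sub>R (dcrv x / 2)) / norm s = norm (S s /\<^sub>R s - dcrv x / 2)"
        unfolding eventually_at_filter by (intro always_eventually) blast
    qed
    then show ?thesis by (subst Lim_null) (rule tendsto_norm_zero_cancel)
  qed
  have nonneg: "dcrv x / 2 \<notin> \<real>\<^sub>\<le>\<^sub>0" by (simp add: complex_nonpos_Reals_iff dcrv_def)
  have r: "((\<lambda>\<epsilon>. S \<epsilon> /\<^sub>R \<epsilon>) \<longlongrightarrow> dcrv x / 2) (at_right 0)"
    by (rule tendsto_mono[OF at_le[OF subset_UNIV] lim])
  have l: "((\<lambda>\<epsilon>. S (-\<epsilon>) /\<^sub>R (-\<epsilon>)) \<longlongrightarrow> dcrv x / 2) (at_right 0)"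
  proof -
    have "((\<lambda>\<epsilon>. S \<epsilon> /\<^sub>R \<epsilon>) \<longlongrightarrow> dcrv x / 2) (at_left 0)"
      by (rule tendsto_mono[OF at_le[OF subset_UNIV] lim])
    then show ?thesis by (simp only: filterlim_at_left_to_right minus_zero)
  qed
  have "((\<lambda>\<epsilon>. 2 * (Ln (S (-\<epsilon>) /\<^sub>R (-\<epsilon>)) - Ln (S \<epsilon> /\<^sub>R \<epsilon>))) \<longlongrightarrow> 2 * (Ln (dcrv x / 2) - Ln (dcrv x / 2))) (at_right 0)"
    by (rule tendsto_mult[OF tendsto_const tendsto_diff[OF tendsto_Ln[OF l nonneg] tendsto_Ln[OF r nonneg]]])
  then have "((\<lambda>\<epsilon>. 2 * (Ln (S (-\<epsilon>) /\<^sub>R (-\<epsilon>)) - Ln (S \<epsilon> /\<^sub>R \<epsilon>))) \<longlongrightarrow> 0) (at_right 0)"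
    by simp
  then show ?thesis
  proof (rule Lim_transform_eventually)
    show "\<forall>\<^sub>F \<epsilon> in at_right 0. 2 * (Ln (S (-\<epsilon>) /\<^sub>R (-\<epsilon>)) - Ln (S \<epsilon> /\<^sub>R \<epsilon>)) =
        integral {-pi..-\<epsilon>} ?k + integral {\<epsilon>..pi} ?k"
      using eventually_at_right_real[OF pi_gt_zero]
    proof (rule eventually_mono)
      fix \<epsilon> :: real assume "\<epsilon> \<in> {0<..<pi}"
      then have e: "0 < \<epsilon>" "\<epsilon> < pi" by auto
      have quot: "S (-\<epsilon>) /\<^sub>R (-\<epsilon>) = - S (-\<epsilon>) / of_real \<epsilon>" "S \<epsilon> /\<^sub>R \<epsilon> = S \<epsilon> / of_real \<epsilon>"
        by (simp_all add: scaleR_conv_of_real divide_inverse)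
      then show "2 * (Ln (S (-\<epsilon>) /\<^sub>R (-\<epsilon>)) - Ln (S \<epsilon> /\<^sub>R \<epsilon>)) =
          integral {-pi..-\<epsilon>} ?k + integral {\<epsilon>..pi} ?k"
        by (simp only: eq[OF e] quot)
    qed
  qed
qed

end

section \<open>Bounds for periodic functions, and the Cauchy integral away from the graph\<close>

lemma periodic_continuous_bounded:
  fixes f :: "real \<Rightarrow> real"
  assumes cont: "continuous_on UNIV f" and per: "\<And>x. f (x + 2 * pi) = f x"
  obtains M where "\<And>x. \<bar>f x\<bar> \<le> M"
proof -
  interpret periodic_fun_simple f "2 * pi" by standard (rule per)
  have "bounded (f ` {0..2 * pi})"
    by (intro compact_imp_bounded compact_continuous_image continuous_on_subset[OF cont]) auto
  then obtain M where "\<forall>y\<in>f ` {0..2 * pi}. norm y \<le> M"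
    unfolding bounded_iff by blast
  then have M: "\<And>y. y \<in> {0..2 * pi} \<Longrightarrow> \<bar>f y\<bar> \<le> M" by simp
  have "\<bar>f x\<bar> \<le> M" for x
  proof -
    define n where "n = \<lfloor>x / (2 * pi)\<rfloor>"
    have "of_int n \<le> x / (2 * pi)" "x / (2 * pi) \<le> of_int n + 1" unfolding n_def by linarith+
    then have "of_int n * (2 * pi) \<le> x" "x \<le> (of_int n + 1) * (2 * pi)"
      by (simp_all only: pos_le_divide_eq pos_divide_le_eq pi_gt_zero zero_less_mult_iff zero_less_numeral simp_thms)
    then have "x + of_int (- n) * (2 * pi) \<in> {0..2 * pi}" by (simp add: algebra_simps)
    then have "\<bar>f (x + of_int (- n) * (2 * pi))\<bar> \<le> M" by (rule M)
    then show ?thesis by (simp only: plus_of_int)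
  qed
  then show ?thesis by (rule that)
qed

lemma integrable_on_abs_powr:
  assumes "a > -1" "c \<ge> 0"
  shows "(\<lambda>s::real. \<bar>s\<bar> powr a) integrable_on {-c..c}"
proof -
  have p: "(\<lambda>s. s powr a) integrable_on {0..c}" using assms by (rule integrable_on_powr_from_0)
  have "(\<lambda>s. (- s) powr a) integrable_on {-c..-0}"
    by (rule Henstock_Kurzweil_Integration.integrable_reflect_real[THEN iffD2, OF p])
  then have r: "(\<lambda>s. (- s) powr a) integrable_on {-c..0}" by simp
  have "(\<lambda>s. \<bar>s\<bar> powr a) integrable_on {0..c}" "(\<lambda>s. \<bar>s\<bar> powr a) integrable_on {-c..0}"
    by (rule integrable_eq[OF p], simp) (rule integrable_eq[OF r], simp)
  then show ?thesis using assms
    by (intro Henstock_Kurzweil_Integration.integrable_combine[of "-c" 0 c]) simp_all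
qed

context periodic_graph
begin

lemma h'_bounded: obtains M where "M \<ge> 0" "\<And>x. \<bar>h' x\<bar> \<le> M"
proof -
  obtain M where M: "\<And>x. \<bar>h' x\<bar> \<le> M" by (rule periodic_continuous_bounded[OF h'_cont h'_periodic]) blast
  then show ?thesis using that[OF _ M] M[of 0] by linarith
qed

lemma h_bounded: obtains M where "M \<ge> 0" "\<And>x. \<bar>h x\<bar> \<le> M"
proof -
  obtain M where M: "\<And>x. \<bar>h x\<bar> \<le> M" by (rule periodic_continuous_bounded[OF h_cont h_periodic]) blast
  then show ?thesis using that[OF _ M] M[of 0] by linarith
qed

lemma has_integral_h': "(h' has_integral 0) {-pi..pi}"
proof -
  have "(h' has_integral h pi - h (-pi)) {-pi..pi}"
    by (rule fundamental_theorem_of_calculus)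
      (auto intro!: DERIV_subset[OF h_deriv] simp: has_real_derivative_iff_has_vector_derivative[symmetric])
  moreover have "h pi = h (-pi)" using h_periodic[of "-pi"] by simp
  ultimately show ?thesis by simp
qed

text \<open>The density with respect to the complex line element \<zeta>' ds. Writing h' as
  \<open>dens\<close> times \<open>dcrv\<close> exposes the factor \<open>dcrv\<close> times
  cotangent, which has an explicit primitive.\<close>

definition dens :: "real \<Rightarrow> complex" where "dens x = of_real (h' x) / dcrv x"

lemma dens_mult_dcrv: "dens x * dcrv x = of_real (h' x)"
  by (simp add: dens_def dcrv_nonzero)

lemma dens_continuous_on [continuous_intros]:
  "continuous_on A f \<Longrightarrow> continuous_on A (\<lambda>x. dens (f x))"
  unfolding dens_def by (intro continuous_intros) (auto simp: dcrv_nonzero)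

text \<open>
  Subtracting the value of the density at the point of the graph below makes the integrand of the
  Cauchy integral absolutely integrable, uniformly in \<open>\<eta>\<close>.
\<close>

definition reg_kernel :: "real \<Rightarrow> real \<Rightarrow> real \<Rightarrow> complex" where
  "reg_kernel x \<eta> s = (dens (x - s) - dens x) * dcrv (x - s) * cot (hdiff x \<eta> s)"

definition reg_cauchy :: "real \<Rightarrow> real \<Rightarrow> complex" where
  "reg_cauchy x \<eta> = integral {-pi..pi} (reg_kernel x \<eta>)"

text \<open>The cotangent of half the difference is the periodic version of twice the Cauchy kernel.
  No factor 1 / (4 pi i) is included, so the jump from below to above the graph is -4 pi i
  \<open>dens\<close>.\<close>

definition cauchy :: "complex \<Rightarrow> complex" where
  "cauchy z = integral {-pi..pi} (\<lambda>s. of_real (h' s) * cot ((z - crv s) / 2))"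

lemma off_graph_sin_nonzero:
  assumes "Im z \<noteq> h (Re z)"
  shows "sin ((z - crv s) / 2) \<noteq> 0"
proof
  assume "sin ((z - crv s) / 2) = 0"
  moreover have "(z - crv s) / 2 = Complex ((Re z - s) / 2) ((Im z - h s) / 2)"
    by (simp add: crv_def complex_eq_iff)
  ultimately have "sin ((Re z - s) / 2) = 0" and i: "Im z = h s"
    by (auto simp: sin_Complex_eq_0_iff)
  then obtain n where n: "(Re z - s) / 2 = of_int n * pi"
    by (auto simp: sin_zero_iff_int2)
  have "Re z = s + 2 * pi * of_int n" using n by (simp add: field_simps)
  then have "h (Re z) = h s" using h_periodic_int[of s n] by simp
  with i assms show False by simp
qed

text \<open>For x = Re z this puts the near singularity at s = 0 and makes the argument of the
  cotangent a value of \<open>hdiff\<close>, whose real part s / 2 stays in the range of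
  \<open>norm_cot_le\<close>.\<close>

lemma cauchy_centered:
  assumes "Im z \<noteq> h (Re z)"
  shows "cauchy z = integral {-pi..pi} (\<lambda>s. of_real (h' (x - s)) * cot ((z - crv (x - s)) / 2))"
  unfolding cauchy_def
proof (rule integral_periodic_reflect_shift[symmetric])
  show "continuous_on UNIV (\<lambda>s. of_real (h' s) * cot ((z - crv s) / 2))"
    using assms off_graph_sin_nonzero by (intro continuous_intros) auto
  have "cot ((z - crv (s + 2 * pi)) / 2) = cot ((z - crv s) / 2)" for s
  proof -
    have e: "(z - crv (s + 2 * pi)) / 2 = (z - crv s) / 2 - of_real pi" by (simp add: crv_periodic diff_divide_distrib add_divide_distrib)
    show ?thesis unfolding e using cot_add_pi[of "(z - crv s) / 2 - of_real pi"] by (simp only: diff_add_cancel)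
  qed
  then show "of_real (h' (s + 2 * pi)) * cot ((z - crv (s + 2 * pi)) / 2) = of_real (h' s) * cot ((z - crv s) / 2)" for s
    by (simp add: h'_periodic)
qed

lemma cauchy_periodic: "cauchy (z + 2 * of_real pi) = cauchy z"
proof -
  have e: "(z + 2 * of_real pi - crv s) / 2 = (z - crv s) / 2 + of_real pi" for s
    by (simp add: diff_divide_distrib add_divide_distrib)
  show ?thesis unfolding cauchy_def e cot_add_pi ..
qed

lemma cauchy_field_differentiable:
  assumes "Im z \<noteq> h (Re z)"
  shows "cauchy field_differentiable at z"
proof -
  have "closed {z. Im z = h (Re z)}"
    by (intro closed_Collect_eq continuous_intros)
  then have "open (- {z. Im z = h (Re z)})" by (rule open_Compl)
  then obtain r where r: "r > 0" "ball z r \<subseteq> - {z. Im z = h (Re z)}"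
    using assms openE[of "- {z. Im z = h (Re z)}" z] by auto
  then have off: "\<And>w. w \<in> ball z r \<Longrightarrow> Im w \<noteq> h (Re w)" by auto
  have "(\<lambda>z. integral (cbox (-pi) pi) (\<lambda>s. of_real (h' s) * cot ((z - crv s) / 2))) holomorphic_on ball z r"
  proof (rule leibniz_rule_holomorphic[where fx = "\<lambda>z s. of_real (h' s) * (- inverse ((sin ((z - crv s) / 2))\<^sup>2) / 2)"])
    fix w s assume "w \<in> ball z r"
    then have nz: "sin ((w - crv s) / 2) \<noteq> 0" using off off_graph_sin_nonzero by blast
    have "((\<lambda>z. cot ((z - crv s) / 2)) has_field_derivative - inverse ((sin ((w - crv s) / 2))\<^sup>2) * (1/2)) (at w)"
      by (rule DERIV_chain2[where f = cot and g = "\<lambda>z. (z - crv s) / 2", OF DERIV_cot[OF nz]])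
        (auto intro!: derivative_eq_intros)
    then have "((\<lambda>z. of_real (h' s) * cot ((z - crv s) / 2)) has_field_derivative
        of_real (h' s) * (- inverse ((sin ((w - crv s) / 2))\<^sup>2) * (1/2))) (at w)"
      by (rule DERIV_cmult)
    then have "((\<lambda>z. of_real (h' s) * cot ((z - crv s) / 2)) has_field_derivative
        of_real (h' s) * (- inverse ((sin ((w - crv s) / 2))\<^sup>2) / 2)) (at w)"
      by simp
    then show "((\<lambda>z. of_real (h' s) * cot ((z - crv s) / 2)) has_field_derivative
        of_real (h' s) * (- inverse ((sin ((w - crv s) / 2))\<^sup>2) / 2)) (at w within ball z r)"
      by (rule has_field_derivative_at_within)
  next
    fix w assume w: "w \<in> ball z r"
    show "(\<lambda>s. of_real (h' s) * cot ((w - crv s) / 2)) integrable_on cbox (-pi) pi"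
      using off[OF w] off_graph_sin_nonzero by (intro integrable_continuous continuous_intros) auto
  next
    have c: "continuous_on (ball z r \<times> cbox (-pi) pi) (\<lambda>p. sin ((fst p - crv (snd p)) / 2))"
      by (intro continuous_intros) auto
    show "continuous_on (ball z r \<times> cbox (-pi) pi)
        (\<lambda>(z, s). of_real (h' s) * (- inverse ((sin ((z - crv s) / 2))\<^sup>2) / 2))"
      unfolding split_beta using off off_graph_sin_nonzero
      by (intro continuous_on_mult continuous_on_divide continuous_on_minus continuous_on_inverse
          continuous_on_power continuous_on_of_real h'_continuous_on continuous_on_snd
          continuous_on_id continuous_on_const c) (auto simp: power_eq_0_iff)
  qed auto
  then have "cauchy holomorphic_on ball z r" by (simp add: cauchy_def[abs_def])
  then show ?thesis using r by (simp add: holomorphic_on_imp_differentiable_at)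
qed

lemma cauchy_holomorphic:
  assumes "\<And>z. z \<in> A \<Longrightarrow> Im z \<noteq> h (Re z)"
  shows "cauchy holomorphic_on A"
  unfolding holomorphic_on_def
  using field_differentiable_at_within[OF cauchy_field_differentiable[OF assms]] by blast

text \<open>The density has mean zero, so only the deviation of the cotangent from its limit \<open>\<minusplus>\<i>\<close> counts.\<close>

lemma cauchy_decay:
  assumes "\<epsilon> > 0"
  obtains R where "\<And>z. \<bar>Im z\<bar> > R \<Longrightarrow> norm (cauchy z) < \<epsilon>"
proof -
  obtain M where M: "M \<ge> 0" "\<And>x. \<bar>h' x\<bar> \<le> M" using h'_bounded by blast
  obtain B where B: "B \<ge> 0" "\<And>x. \<bar>h x\<bar> \<le> B" using h_bounded by blast
  \<comment> \<open>The margin 2 above the bound of h makes the imaginary part of (z -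
    \<open>crv s\<close>) / 2 at least 1 in modulus, as the exponential estimates of the cotangent
    require.\<close>
  have bound: "norm (cauchy z) \<le> M * (4 * exp (B - \<bar>Im z\<bar>)) * (2 * pi)" if z: "\<bar>Im z\<bar> \<ge> B + 2" for z
  proof -
    define c where "c = (if Im z > 0 then \<i> else -\<i>)"
    have off: "Im z \<noteq> h (Re z)" using z B(2)[of "Re z"] by linarith
    have "((\<lambda>s. of_real (h' s) * c) has_integral of_real 0 * c) {-pi..pi}"
      by (intro has_integral_mult_left has_integral_of_real has_integral_h')
    moreover have int: "(\<lambda>s. of_real (h' s) * cot ((z - crv s) / 2)) integrable_on {-pi..pi}"
      using off off_graph_sin_nonzero by (intro integrable_continuous_real continuous_intros) auto
    ultimately have i: "((\<lambda>s. of_real (h' s) * cot ((z - crv s) / 2) + of_real (h' s) * c) has_integral cauchy z + 0) {-pi..pi}"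
      unfolding cauchy_def by (intro has_integral_add) auto
    have "norm (cauchy z + 0) \<le> (M * (4 * exp (B - \<bar>Im z\<bar>))) * measure lborel {-pi..pi}"
    proof (rule has_integral_bound_real[OF _ finite.emptyI i])
      fix s
      have Im: "Im ((z - crv s) / 2) = (Im z - h s) / 2" by (simp add: crv_def)
      have "norm (cot ((z - crv s) / 2) + c) \<le> 4 * exp (B - \<bar>Im z\<bar>)"
      proof (cases "Im z > 0")
        case True
        then have "norm (cot ((z - crv s) / 2) + c) \<le> 4 * exp (-2 * ((Im z - h s) / 2))"
          using z B(2)[of s] cot_add_ii_bound[of "(z - crv s) / 2"] unfolding Im c_def by auto
        also have "\<dots> \<le> 4 * exp (B - \<bar>Im z\<bar>)"
          using True B(2)[of s] by auto
        finally show ?thesis .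
      next
        case False
        then have "norm (cot ((z - crv s) / 2) + c) \<le> 4 * exp (2 * ((Im z - h s) / 2))"
          using z B(2)[of s] cot_minus_ii_bound[of "(z - crv s) / 2"] unfolding Im c_def by auto
        also have "\<dots> \<le> 4 * exp (B - \<bar>Im z\<bar>)"
          using False B(2)[of s] by auto
        finally show ?thesis .
      qed
      then have "norm (of_real (h' s) :: complex) * norm (cot ((z - crv s) / 2) + c) \<le> M * (4 * exp (B - \<bar>Im z\<bar>))"
        using M by (intro mult_mono) auto
      then show "norm (of_real (h' s) * cot ((z - crv s) / 2) + of_real (h' s) * c) \<le> M * (4 * exp (B - \<bar>Im z\<bar>))"
        by (simp add: norm_mult flip: distrib_left)
    qed (use M in auto)
    then show ?thesis by simp
  qed
  show ?thesis
  proof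
    \<comment> \<open>By exp (-u) <= 1 / u the bound 8 pi M exp (-u) falls below \<epsilon> once u
      exceeds 8 pi M / \<epsilon>.\<close>
    fix z assume z: "\<bar>Im z\<bar> > B + 2 + 8 * pi * M / \<epsilon>"
    define u where "u = \<bar>Im z\<bar> - B"
    have "8 * pi * M / \<epsilon> \<ge> 0" using M assms by simp
    then have u: "u > 8 * pi * M / \<epsilon>" "u > 0" and le: "\<bar>Im z\<bar> \<ge> B + 2"
      using z by (auto simp: u_def)
    have "exp (B - \<bar>Im z\<bar>) \<le> 1 / u"
    proof -
      have "u \<le> exp u" using exp_ge_add_one_self[of u] by linarith
      then have "inverse (exp u) \<le> inverse u" using u by (intro le_imp_inverse_le)
      moreover have "B - \<bar>Im z\<bar> = - u" by (simp add: u_def)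
      ultimately show ?thesis by (simp only: exp_minus inverse_eq_divide)
    qed
    then have "M * (4 * exp (B - \<bar>Im z\<bar>)) * (2 * pi) \<le> M * (4 * (1 / u)) * (2 * pi)"
      using M by (intro mult_left_mono mult_right_mono) auto
    also have "\<dots> < \<epsilon>" using u assms by (simp add: field_simps)
    finally show "norm (cauchy z) < \<epsilon>" using bound[OF le] by linarith
  qed
qed

end

section \<open>Graphs with a Hoelder continuous slope\<close>

text \<open>Near s = 0 the cotangent is of size 1 / \<bar>s\<bar>, and continuity of h' alone does
  not guarantee an integrable product with the increment of the density. The extra factor
  \<bar>s\<bar> powr \<alpha> does.\<close>

locale holder_graph = periodic_graph +
  fixes C \<alpha> :: real
  assumes exponent: "0 < \<alpha>"
    and h'_holder: "\<bar>h' x - h' y\<bar> \<le> C * \<bar>x - y\<bar> powr \<alpha>"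
begin

text \<open>For a, b real, a / (1 + i a) - b / (1 + i b) = (a - b) / ((1 + i a)(1 + i b)), and both
  denominators have modulus at least 1. Hence the Hoelder constant of h' serves for
  \<open>dens\<close> as well.\<close>

lemma dens_holder: "norm (dens x - dens y) \<le> C * \<bar>x - y\<bar> powr \<alpha>"
proof -
  have "dens x - dens y = of_real (h' x - h' y) / (dcrv x * dcrv y)"
    using dcrv_nonzero[of x] dcrv_nonzero[of y]
    by (simp add: dens_def diff_divide_eq_iff divide_diff_eq_iff field_simps) (simp add: dcrv_def complex_eq_iff algebra_simps)
  then have "norm (dens x - dens y) = \<bar>h' x - h' y\<bar> / (norm (dcrv x) * norm (dcrv y))"
    by (simp only: norm_divide norm_mult norm_of_real)
  also have "\<dots> \<le> \<bar>h' x - h' y\<bar> / 1"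
    using mult_mono[OF norm_dcrv_ge_1[of x] norm_dcrv_ge_1[of y]]
    by (intro divide_left_mono) auto
  finally show ?thesis using h'_holder[of x y] by simp
qed

text \<open>The Hoelder increment of the density meets a cotangent of size at most 4 /
  \<bar>s\<bar>. The point is that D depends neither on x nor on \<eta>, so one integrable function
  dominates the kernels along every sequence approaching the graph.\<close>

lemma reg_kernel_bound:
  obtains D where "\<And>x \<eta> s. s \<in> {-pi..pi} \<Longrightarrow> norm (reg_kernel x \<eta> s) \<le> D * \<bar>s\<bar> powr (\<alpha> - 1)"
proof -
  obtain M where M: "M \<ge> 0" "\<And>x. \<bar>h' x\<bar> \<le> M" using h'_bounded by blast
  \<comment> \<open>The sign of C is not part of the locale; it follows from the Hoelder inequality
    at the points 1 and 0.\<close>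
  have "C * \<bar>1 - 0\<bar> powr \<alpha> \<ge> 0" using h'_holder[of 1 0] abs_ge_zero order_trans by blast
  then have C: "C \<ge> 0" by simp
  note dc = norm_dcrv_le[OF M(2)]
  have "norm (reg_kernel x \<eta> s) \<le> (C * (1 + M) * 4) * \<bar>s\<bar> powr (\<alpha> - 1)" if s: "s \<in> {-pi..pi}" for x \<eta> s
  proof (cases "s = 0")
    case True
    then show ?thesis by (simp add: reg_kernel_def)
  next
    case False
    have "norm (reg_kernel x \<eta> s) = norm (dens (x - s) - dens x) * norm (dcrv (x - s)) * norm (cot (hdiff x \<eta> s))"
      by (simp add: reg_kernel_def norm_mult)
    also have "\<dots> \<le> (C * \<bar>s\<bar> powr \<alpha>) * (1 + M) * (2 / \<bar>s / 2\<bar>)"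
    proof (intro mult_mono)
      show "norm (dens (x - s) - dens x) \<le> C * \<bar>s\<bar> powr \<alpha>" using dens_holder[of "x - s" x] by simp
      show "norm (cot (hdiff x \<eta> s)) \<le> 2 / \<bar>s / 2\<bar>"
        unfolding hdiff_def using s False by (intro norm_cot_le) auto
    qed (use C M dc in auto)
    also have "\<dots> = (C * (1 + M) * 4) * (\<bar>s\<bar> powr \<alpha> / \<bar>s\<bar>)" by simp
    also have "\<bar>s\<bar> powr \<alpha> / \<bar>s\<bar> = \<bar>s\<bar> powr (\<alpha> - 1)"
      using False by (simp add: powr_diff)
    finally show ?thesis .
  qed
  then show ?thesis using that by blast
qed

lemma reg_kernel_integrable: "reg_kernel x \<eta> integrable_on {-pi..pi}"
proof -
  obtain D where D: "\<And>x \<eta> s. s \<in> {-pi..pi} \<Longrightarrow> norm (reg_kernel x \<eta> s) \<le> D * \<bar>s\<bar> powr (\<alpha> - 1)"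
    by (rule reg_kernel_bound) blast
  let ?S = "{-pi..pi} - {0}"
  have i: "(\<lambda>s. D * \<bar>s\<bar> powr (\<alpha> - 1)) integrable_on {-pi..pi}"
    using exponent by (intro integrable_on_mult_right integrable_on_abs_powr) auto
  have cont: "continuous_on ?S (reg_kernel x \<eta>)"
    unfolding reg_kernel_def[abs_def] using sin_hdiff_nonzero[of _ \<eta> x]
    by (intro continuous_intros) auto
  have "(\<lambda>s. D * \<bar>s\<bar> powr (\<alpha> - 1)) integrable_on ?S"
    by (rule integrable_spike_set[OF i]) (auto intro: negligible_subset[of "{0}"])
  then have "reg_kernel x \<eta> absolutely_integrable_on ?S"
    using D by (intro measurable_bounded_by_integrable_imp_absolutely_integrable
        continuous_imp_measurable_on_sets_lebesgue cont) auto
  then have "reg_kernel x \<eta> integrable_on ?S" by (simp add: absolutely_integrable_on_def)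
  then show ?thesis
    by (rule integrable_spike_set) (auto intro: negligible_subset[of "{0}"])
qed

text \<open>Continuity includes \<eta> = 0: the regular part has the same limit from both sides of
  the graph, so the whole discontinuity of the Cauchy integral sits in the explicit term of
  \<open>cauchy_off_graph\<close>.\<close>

lemma reg_cauchy_continuous: "continuous_on UNIV (\<lambda>p. reg_cauchy (fst p) (snd p))"
  unfolding continuous_on_sequentially
proof (intro allI ballI impI, elim conjE)
  fix u :: "nat \<Rightarrow> real \<times> real" and p assume u: "u \<longlonglongrightarrow> p"
  obtain D where D: "\<And>x \<eta> s. s \<in> {-pi..pi} \<Longrightarrow> norm (reg_kernel x \<eta> s) \<le> D * \<bar>s\<bar> powr (\<alpha> - 1)"
    by (rule reg_kernel_bound) blast
  have i: "(\<lambda>s. D * \<bar>s\<bar> powr (\<alpha> - 1)) integrable_on {-pi..pi}"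
    using exponent by (intro integrable_on_mult_right integrable_on_abs_powr) auto
  have "(\<lambda>k. integral {-pi..pi} (reg_kernel (fst (u k)) (snd (u k)))) \<longlonglongrightarrow>
      integral {-pi..pi} (reg_kernel (fst p) (snd p))"
  proof (rule dominated_convergence(2)[OF reg_kernel_integrable i D])
    fix s assume s: "s \<in> {-pi..pi}"
    show "(\<lambda>k. reg_kernel (fst (u k)) (snd (u k)) s) \<longlonglongrightarrow> reg_kernel (fst p) (snd p) s"
    \<comment> \<open>At s = 0 the cotangent need not converge as \<eta> tends to 0, but the
      increment of the density makes the kernel vanish there identically.\<close>
    proof (cases "s = 0")
      case True
      then show ?thesis by (simp add: reg_kernel_def)
    next
      case False
      have "continuous_on UNIV (\<lambda>p. reg_kernel (fst p) (snd p) s)"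
        unfolding reg_kernel_def using sin_hdiff_nonzero[OF s] False by (intro continuous_intros) auto
      then show ?thesis
        using u by (auto intro: continuous_on_tendsto_compose)
    qed
  qed
  then show "((\<lambda>p. reg_cauchy (fst p) (snd p)) \<circ> u) \<longlonglongrightarrow> reg_cauchy (fst p) (snd p)"
    by (simp add: reg_cauchy_def o_def)
qed

lemma reg_cauchy_continuous_on [continuous_intros]:
  "continuous_on A f \<Longrightarrow> continuous_on A g \<Longrightarrow> continuous_on A (\<lambda>x. reg_cauchy (f x) (g x))"
  using continuous_on_compose2[OF reg_cauchy_continuous, of A "\<lambda>x. (f x, g x)"]
  by (simp add: continuous_on_Pair)

lemma hdiff_eq_off: "hdiff x \<eta> s = (Complex x (h x + \<eta>) - crv (x - s)) / 2"
  by (simp add: hdiff_def crv_def complex_eq_iff)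

text \<open>The Sokhotski-Plemelj formula as an exact identity at every height: what was subtracted
  in \<open>reg_kernel\<close> is added back, and the integral with density 1 depends on \<eta> only
  through its sign.\<close>

theorem cauchy_off_graph:
  assumes "\<eta> \<noteq> 0"
  shows "cauchy (Complex x (h x + \<eta>)) = reg_cauchy x \<eta> - 2 * pi * \<i> * of_real (sgn \<eta>) * dens x"
proof -
  have "((\<lambda>s. reg_kernel x \<eta> s + dens x * (dcrv (x - s) * cot (hdiff x \<eta> s))) has_integral
      reg_cauchy x \<eta> + dens x * (- (2 * pi * \<i> * of_real (sgn \<eta>)))) {-pi..pi}"
    unfolding reg_cauchy_def
    by (intro has_integral_add has_integral_mult_right integrable_integral reg_kernel_integrable
        has_integral_dcrv_cot assms)
  moreover have "reg_kernel x \<eta> s + dens x * (dcrv (x - s) * cot (hdiff x \<eta> s)) =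
      of_real (h' (x - s)) * cot ((Complex x (h x + \<eta>) - crv (x - s)) / 2)" for s
    unfolding dens_mult_dcrv[symmetric] reg_kernel_def hdiff_eq_off by (simp add: algebra_simps)
  ultimately have "integral {-pi..pi} (\<lambda>s. of_real (h' (x - s)) * cot ((Complex x (h x + \<eta>) - crv (x - s)) / 2)) =
      reg_cauchy x \<eta> + dens x * (- (2 * pi * \<i> * of_real (sgn \<eta>)))"
    by (simp add: integral_unique)
  then show ?thesis
    using assms by (subst cauchy_centered[where x = x]) (simp_all add: algebra_simps)
qed

text \<open>The same splitting on the graph itself. There the density 1 has principal value 0, so
  only the regular part survives; it is therefore the mean of the two boundary values.\<close>

theorem cauchy_principal_value:
  "((\<lambda>\<epsilon>. integral {-pi..-\<epsilon>} (\<lambda>s. of_real (h' (x - s)) * cot (hdiff x 0 s)) +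
          integral {\<epsilon>..pi} (\<lambda>s. of_real (h' (x - s)) * cot (hdiff x 0 s))) \<longlongrightarrow> reg_cauchy x 0) (at_right 0)"
proof -
  let ?k = "reg_kernel x 0" and ?d = "\<lambda>s. dcrv (x - s) * cot (hdiff x 0 s)"
  let ?q = "\<lambda>s. of_real (h' (x - s)) * cot (hdiff x 0 s)"
  have q: "?q s = ?k s + dens x * ?d s" for s
    unfolding dens_mult_dcrv[symmetric] reg_kernel_def by (simp add: algebra_simps)
  have sub: "?k integrable_on {a..b}" if "-pi \<le> a" "b \<le> pi" for a b
    by (rule integrable_subinterval_real[OF reg_kernel_integrable]) (use that in auto)
  have d: "?d integrable_on {a..b}" if "-pi \<le> a" "b \<le> pi" "0 \<notin> {a..b}" for a b
    using that by (intro integrable_continuous_real dcrv_cot_continuous_on continuous_intros) auto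
  have split: "integral {a..b} ?q = integral {a..b} ?k + dens x * integral {a..b} ?d"
    if "-pi \<le> a" "b \<le> pi" "0 \<notin> {a..b}" for a b
    unfolding q using sub[of a b] d[of a b] that
    by (subst Henstock_Kurzweil_Integration.integral_add) (auto intro: integrable_on_mult_right)
  have "((\<lambda>\<epsilon>. integral {-pi..-\<epsilon>} ?k) \<longlongrightarrow> integral {-pi..-0} ?k) (at_right 0)"
  proof -
    have "continuous_on {-pi..0} (\<lambda>u. integral {-pi..u} ?k)"
      by (intro indefinite_integral_continuous_1 sub) auto
    then have "((\<lambda>u. integral {-pi..u} ?k) \<longlongrightarrow> integral {-pi..0} ?k) (at 0 within {-pi..0})"
      by (auto simp: continuous_on_def)
    then have "((\<lambda>u. integral {-pi..u} ?k) \<longlongrightarrow> integral {-pi..0} ?k) (at_left 0)"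
      by (simp add: at_within_Icc_at_left)
    then show ?thesis by (simp only: filterlim_at_left_to_right minus_zero)
  qed
  moreover have "((\<lambda>\<epsilon>. integral {\<epsilon>..pi} ?k) \<longlongrightarrow> integral {0..pi} ?k) (at_right 0)"
  proof -
    have "continuous_on {0..pi} (\<lambda>u. integral {u..pi} ?k)"
      by (intro indefinite_integral_continuous_1' sub) auto
    then have "((\<lambda>u. integral {u..pi} ?k) \<longlongrightarrow> integral {0..pi} ?k) (at 0 within {0..pi})"
      by (auto simp: continuous_on_def)
    then show ?thesis by (simp add: at_within_Icc_at_right)
  qed
  ultimately have "((\<lambda>\<epsilon>. (integral {-pi..-\<epsilon>} ?k + integral {\<epsilon>..pi} ?k) +
      dens x * (integral {-pi..-\<epsilon>} ?d + integral {\<epsilon>..pi} ?d)) \<longlongrightarrow>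
      (integral {-pi..-0} ?k + integral {0..pi} ?k) + dens x * 0) (at_right 0)"
    by (rule tendsto_add[OF tendsto_add tendsto_mult[OF tendsto_const tendsto_pv_dcrv_cot]])
  moreover have "(integral {-pi..-0} ?k + integral {0..pi} ?k) + dens x * 0 = reg_cauchy x 0"
    unfolding reg_cauchy_def
    using Henstock_Kurzweil_Integration.integral_combine[OF _ _ reg_kernel_integrable, of 0 x 0] by simp
  ultimately have "((\<lambda>\<epsilon>. (integral {-pi..-\<epsilon>} ?k + integral {\<epsilon>..pi} ?k) +
      dens x * (integral {-pi..-\<epsilon>} ?d + integral {\<epsilon>..pi} ?d)) \<longlongrightarrow> reg_cauchy x 0) (at_right 0)"
    by (simp only:)
  then show ?thesis
  proof (rule Lim_transform_eventually)
    show "\<forall>\<^sub>F \<epsilon> in at_right 0. (integral {-pi..-\<epsilon>} ?k + integral {\<epsilon>..pi} ?k) +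
        dens x * (integral {-pi..-\<epsilon>} ?d + integral {\<epsilon>..pi} ?d) =
        integral {-pi..-\<epsilon>} ?q + integral {\<epsilon>..pi} ?q"
      using eventually_at_right_real[OF pi_gt_zero]
    proof (rule eventually_mono)
      fix \<epsilon> :: real assume "\<epsilon> \<in> {0<..<pi}"
      then have "integral {-pi..-\<epsilon>} ?q = integral {-pi..-\<epsilon>} ?k + dens x * integral {-pi..-\<epsilon>} ?d"
        "integral {\<epsilon>..pi} ?q = integral {\<epsilon>..pi} ?k + dens x * integral {\<epsilon>..pi} ?d"
        by (intro split; auto)+
      then show "(integral {-pi..-\<epsilon>} ?k + integral {\<epsilon>..pi} ?k) +
        dens x * (integral {-pi..-\<epsilon>} ?d + integral {\<epsilon>..pi} ?d) =
        integral {-pi..-\<epsilon>} ?q + integral {\<epsilon>..pi} ?q"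
        by (simp only: distrib_left add_ac)
    qed
  qed
qed

end

section \<open>Uniqueness of periodic decaying holomorphic functions\<close>

text \<open>The zero of E w - E z cancels the simple pole of the cotangent at z, whose residue in w
  is 2; this is the origin of the value 2 E'. The closed strip of half width pi around z contains no
  other pole.\<close>

lemma continuous_on_cot_quotient:
  assumes E: "continuous_on UNIV E" and d: "(E has_field_derivative E') (at z)"
  shows "continuous_on {w. \<bar>Re w - Re z\<bar> \<le> pi}
    (\<lambda>w. if w = z then 2 * E' else (E w - E z) * cot ((w - z) / 2))"
    (is "continuous_on ?S ?\<Phi>")
  unfolding continuous_on_eq_continuous_within
proof
  fix w assume w: "w \<in> ?S"
  show "continuous (at w within ?S) ?\<Phi>"
  proof (cases "w = z")
    case True
    have "((\<lambda>u. (E u - E z) / (u - z)) \<longlongrightarrow> E') (at z)"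
      using d by (simp add: has_field_derivative_iff)
    moreover have "((\<lambda>u. (u - z) * cot ((u - z) / 2)) \<longlongrightarrow> 2) (at z)"
    proof -
      have "((\<lambda>u. sin ((u - z) / 2)) has_field_derivative cos ((z - z) / 2) * (1 / 2)) (at z)"
        by (auto intro!: derivative_eq_intros)
      then have s: "((\<lambda>u. sin ((u - z) / 2) / (u - z)) \<longlongrightarrow> 1 / 2) (at z)"
        by (simp add: has_field_derivative_iff)
      have c: "((\<lambda>u. cos ((u - z) / 2)) \<longlongrightarrow> cos ((z - z) / 2)) (at z)"
        by (intro tendsto_intros) auto
      have "((\<lambda>u. cos ((u - z) / 2) / (sin ((u - z) / 2) / (u - z))) \<longlongrightarrow> cos ((z - z) / 2) / (1 / 2)) (at z)"
        by (rule tendsto_divide[OF c s]) simp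
      then show ?thesis by (simp add: cot_def mult.commute)
    qed
    ultimately have "((\<lambda>u. (E u - E z) / (u - z) * ((u - z) * cot ((u - z) / 2))) \<longlongrightarrow> E' * 2) (at z)"
      by (rule tendsto_mult)
    then have "(?\<Phi> \<longlongrightarrow> ?\<Phi> z) (at z)"
    proof (rule Lim_transform_eventually[THEN tendsto_eq_rhs])
      show "\<forall>\<^sub>F u in at z. (E u - E z) / (u - z) * ((u - z) * cot ((u - z) / 2)) = ?\<Phi> u"
        by (simp add: eventually_at_filter)
    qed simp
    then have "isCont ?\<Phi> z" by (simp only: isCont_def)
    then show ?thesis unfolding True by (rule continuous_at_imp_continuous_within)
  next
    case False
    have nz: "sin ((w - z) / 2) \<noteq> 0" using sin_half_diff_nonzero False w by simp
    have Ew: "isCont E w" using E by (simp add: continuous_on_eq_continuous_at)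
    have "isCont (\<lambda>w. (E w - E z) * cot ((w - z) / 2)) w"
      by (intro continuous_intros Ew isCont_cot' nz) auto
    then have "isCont ?\<Phi> w"
    proof (rule isCont_cong[THEN iffD1, rotated])
      have "\<forall>\<^sub>F u in nhds w. u \<noteq> z" using False by (rule t1_space_nhds)
      then show "\<forall>\<^sub>F u in nhds w. (E u - E z) * cot ((u - z) / 2) = ?\<Phi> u"
        by (rule eventually_mono) auto
    qed
    then show ?thesis by (rule continuous_at_imp_continuous_within)
  qed
qed

context periodic_graph
begin

text \<open>The \<open>\<eta>\<close>-derivative of the integrand is an \<open>s\<close>-derivative.\<close>

lemma graph_integral_deriv_zero:
  assumes hol: "\<Phi> holomorphic_on Op" and op: "open Op"
    and r: "r > 0" and sub: "\<And>\<eta> s. \<eta> \<in> ball \<eta>0 r \<Longrightarrow> s \<in> {a..b} \<Longrightarrow> crv s + \<i> * of_real \<eta> \<in> Op"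
    and ab: "a \<le> b" and ends: "\<Phi> (crv b + \<i> * of_real \<eta>0) = \<Phi> (crv a + \<i> * of_real \<eta>0)"
  shows "((\<lambda>\<eta>. integral {a..b} (\<lambda>s. \<Phi> (crv s + \<i> * of_real \<eta>) * dcrv s)) has_vector_derivative 0) (at \<eta>0)"
proof -
  have d\<Phi>: "(\<Phi> has_field_derivative deriv \<Phi> w) (at w)" if "w \<in> Op" for w
    using hol op that by (rule holomorphic_derivI)
  have c1: "continuous_on Op \<Phi>" and c2: "continuous_on Op (deriv \<Phi>)"
    using hol op by (auto intro: holomorphic_on_imp_continuous_on holomorphic_deriv)
  have "((\<lambda>\<eta>. integral (cbox a b) (\<lambda>s. \<Phi> (crv s + \<i> * of_real \<eta>) * dcrv s)) has_vector_derivative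
      integral (cbox a b) (\<lambda>s. \<i> * deriv \<Phi> (crv s + \<i> * of_real \<eta>0) * dcrv s)) (at \<eta>0 within ball \<eta>0 r)"
  proof (rule leibniz_rule_vector_derivative[where fx = "\<lambda>\<eta> s. \<i> * deriv \<Phi> (crv s + \<i> * of_real \<eta>) * dcrv s"])
    fix \<eta> s assume *: "\<eta> \<in> ball \<eta>0 r" "s \<in> cbox a b"
    have "((\<lambda>\<eta>. crv s + \<i> * of_real \<eta>) has_vector_derivative 0 + \<i> * of_real 1) (at \<eta>)"
      by (intro has_vector_derivative_add has_vector_derivative_const has_vector_derivative_mult_right
          has_vector_derivative_of_real DERIV_ident)
    from field_vector_diff_chain_at[OF this d\<Phi>[OF sub]] *
    have "((\<lambda>\<eta>. \<Phi> (crv s + \<i> * of_real \<eta>)) has_vector_derivative \<i> * deriv \<Phi> (crv s + \<i> * of_real \<eta>)) (at \<eta>)"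
      by (simp add: o_def)
    then have "((\<lambda>\<eta>. \<Phi> (crv s + \<i> * of_real \<eta>) * dcrv s) has_vector_derivative
        \<i> * deriv \<Phi> (crv s + \<i> * of_real \<eta>) * dcrv s) (at \<eta>)"
      by (rule has_vector_derivative_mult_left)
    then show "((\<lambda>\<eta>. \<Phi> (crv s + \<i> * of_real \<eta>) * dcrv s) has_vector_derivative
        \<i> * deriv \<Phi> (crv s + \<i> * of_real \<eta>) * dcrv s) (at \<eta> within ball \<eta>0 r)"
      by (rule has_vector_derivative_at_within)
  next
    fix \<eta> assume "\<eta> \<in> ball \<eta>0 r"
    then show "(\<lambda>s. \<Phi> (crv s + \<i> * of_real \<eta>) * dcrv s) integrable_on cbox a b"
      using sub by (intro integrable_continuous continuous_intros continuous_on_compose2[OF c1]) auto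
  next
    show "continuous_on (ball \<eta>0 r \<times> cbox a b) (\<lambda>(\<eta>, s). \<i> * deriv \<Phi> (crv s + \<i> * of_real \<eta>) * dcrv s)"
      unfolding split_beta using sub
      by (intro continuous_intros continuous_on_compose2[OF c2]) auto
  qed (use r in auto)
  moreover have "((\<lambda>s. \<i> * deriv \<Phi> (crv s + \<i> * of_real \<eta>0) * dcrv s) has_integral
      \<i> * \<Phi> (crv b + \<i> * of_real \<eta>0) - \<i> * \<Phi> (crv a + \<i> * of_real \<eta>0)) {a..b}"
  proof (rule fundamental_theorem_of_calculus[OF ab])
    fix s assume s: "s \<in> {a..b}"
    have "((\<lambda>s. crv s + \<i> * of_real \<eta>0) has_vector_derivative dcrv s + 0) (at s)"
      by (intro has_vector_derivative_add has_vector_derivative_const crv_deriv)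
    from field_vector_diff_chain_at[OF this d\<Phi>[OF sub[OF _ s]]] r
    have "((\<lambda>s. \<Phi> (crv s + \<i> * of_real \<eta>0)) has_vector_derivative dcrv s * deriv \<Phi> (crv s + \<i> * of_real \<eta>0)) (at s)"
      by (simp add: o_def)
    then have "((\<lambda>s. \<i> * \<Phi> (crv s + \<i> * of_real \<eta>0)) has_vector_derivative
        \<i> * (dcrv s * deriv \<Phi> (crv s + \<i> * of_real \<eta>0))) (at s)"
      by (rule has_vector_derivative_mult_right)
    then have "((\<lambda>s. \<i> * \<Phi> (crv s + \<i> * of_real \<eta>0)) has_vector_derivative
        \<i> * deriv \<Phi> (crv s + \<i> * of_real \<eta>0) * dcrv s) (at s)"
      by (simp add: mult_ac)
    then show "((\<lambda>s. \<i> * \<Phi> (crv s + \<i> * of_real \<eta>0)) has_vector_derivative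
        \<i> * deriv \<Phi> (crv s + \<i> * of_real \<eta>0) * dcrv s) (at s within {a..b})"
      by (rule has_vector_derivative_at_within)
  qed
  ultimately show ?thesis
    using ends r at_within_open[of \<eta>0 "ball \<eta>0 r"] by (simp add: integral_unique)
qed

text \<open>
  Integrate \<open>(E w - E z) cot ((w - z) / 2)\<close> over the vertically shifted graph. The integral does not
  depend on the shift, and equals \<open>\<plusminus>2 \<pi> \<i> E z\<close> in the limits \<open>\<plusminus>\<infinity>\<close>.
\<close>

theorem periodic_decaying_eq_0:
  fixes E :: "complex \<Rightarrow> complex"
  assumes cont: "continuous_on UNIV E"
    and hol: "E holomorphic_on {z. Im z \<noteq> h (Re z)}"
    and per: "\<And>z. Im z \<noteq> h (Re z) \<Longrightarrow> E (z + 2 * of_real pi) = E z"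
    and decay: "\<And>\<epsilon>. \<epsilon> > 0 \<Longrightarrow> \<exists>R. \<forall>z. \<bar>Im z\<bar> > R \<longrightarrow> norm (E z) < \<epsilon>"
    and z: "Im z \<noteq> h (Re z)"
  shows "E z = 0"
proof -
  let ?off = "{z. Im z \<noteq> h (Re z)}"
  have op: "open ?off"
    by (intro open_Collect_neq continuous_intros)
  \<comment> \<open>\<open>\<eta>z\<close> is the shift at which the graph runs through z.
    Integrating over the period centred at \<open>x0\<close> keeps the curve in the strip where z is
    the only pole.\<close>
  define x0 \<eta>z where "x0 = Re z" and "\<eta>z = Im z - h x0"
  have \<eta>z: "\<eta>z \<noteq> 0" using z by (simp add: x0_def \<eta>z_def)
  have dE: "(E has_field_derivative deriv E z) (at z)"
    using hol op z by (intro holomorphic_derivI) auto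
  define \<Phi> where "\<Phi> w = (if w = z then 2 * deriv E z else (E w - E z) * cot ((w - z) / 2))" for w
  define J where "J \<eta> = integral {x0 - pi..x0 + pi} (\<lambda>s. \<Phi> (crv s + \<i> * of_real \<eta>) * dcrv s)" for \<eta>
  have c\<Phi>: "continuous_on {w. \<bar>Re w - x0\<bar> \<le> pi} \<Phi>"
    unfolding \<Phi>_def[abs_def] x0_def by (rule continuous_on_cot_quotient[OF cont dE])
  have Re_crv: "Re (crv s + \<i> * of_real \<eta>) = s" and Im_crv: "Im (crv s + \<i> * of_real \<eta>) = h s + \<eta>" for s \<eta>
    by (simp_all add: crv_def)
  have eq_z: "crv s + \<i> * of_real \<eta> = z \<longleftrightarrow> s = x0 \<and> \<eta> = \<eta>z" for s \<eta>
    unfolding complex_eq_iff Re_crv Im_crv x0_def[symmetric] by (auto simp: \<eta>z_def)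
  have cI: "continuous_on (U \<times> {x0 - pi..x0 + pi}) (\<lambda>(\<eta>, s). \<Phi> (crv s + \<i> * of_real \<eta>) * dcrv s)" for U
  proof -
    have "(\<lambda>p. crv (snd p) + \<i> * of_real (fst p)) ` (U \<times> {x0 - pi..x0 + pi}) \<subseteq> {w. \<bar>Re w - x0\<bar> \<le> pi}"
      by (auto simp: crv_def abs_le_iff)
    then show ?thesis unfolding split_beta
      by (intro continuous_on_mult continuous_on_compose2[OF c\<Phi>] continuous_intros) auto
  qed
  have cJ: "continuous_on U J" for U
    unfolding J_def[abs_def] using integral_continuous_on_param[of U "x0 - pi" "x0 + pi" "\<lambda>\<eta> s. \<Phi> (crv s + \<i> * of_real \<eta>) * dcrv s"] cI
    by simp
  \<comment> \<open>At shift 0 the function E is only known to be continuous, and at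
    \<open>\<eta>z\<close> the curve runs through the pole of the cotangent. At all other shifts
    \<Phi> is holomorphic near the curve.\<close>
  have dJ: "(J has_derivative (\<lambda>h. 0)) (at \<eta>)" if \<eta>: "\<eta> \<notin> {0, \<eta>z}" for \<eta>
  proof -
    have "open (- {0, \<eta>z})" by (intro open_Compl finite_imp_closed) auto
    then obtain r where r: "r > 0" "ball \<eta> r \<subseteq> - {0, \<eta>z}"
      using \<eta> unfolding open_contains_ball by blast
    define Op where "Op = ?off \<inter> {w. sin ((w - z) / 2) \<noteq> 0}"
    have opO: "open Op"
      unfolding Op_def by (intro open_Int op open_Collect_neq continuous_intros) auto
    have nz: "w \<noteq> z" "sin ((w - z) / 2) \<noteq> 0" if "w \<in> Op" for w
      using that by (auto simp: Op_def)
    have "(\<lambda>w. (E w - E z) * (cos ((w - z) / 2) / sin ((w - z) / 2))) holomorphic_on Op"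
    proof -
      have "E holomorphic_on Op" by (rule holomorphic_on_subset[OF hol]) (simp add: Op_def)
      then show ?thesis by (intro holomorphic_intros nz(2)) simp_all
    qed
    then have hol\<Phi>: "\<Phi> holomorphic_on Op"
      by (rule holomorphic_transform) (simp add: \<Phi>_def cot_def nz(1))
    have "((\<lambda>\<eta>. integral {x0 - pi..x0 + pi} (\<lambda>s. \<Phi> (crv s + \<i> * of_real \<eta>) * dcrv s)) has_vector_derivative 0) (at \<eta>)"
    proof (rule graph_integral_deriv_zero[OF hol\<Phi> opO r(1)])
      fix \<eta>' s assume *: "\<eta>' \<in> ball \<eta> r" "s \<in> {x0 - pi..x0 + pi}"
      then have "\<eta>' \<in> - {0, \<eta>z}" using r(2) by blast
      then have \<eta>': "\<eta>' \<noteq> 0" "\<eta>' \<noteq> \<eta>z" by simp_all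
      have "sin ((crv s + \<i> * of_real \<eta>' - z) / 2) \<noteq> 0"
      proof (rule sin_half_diff_nonzero)
        show "crv s + \<i> * of_real \<eta>' \<noteq> z" using \<eta>' unfolding eq_z by blast
        show "\<bar>Re (crv s + \<i> * of_real \<eta>') - Re z\<bar> \<le> pi"
          unfolding Re_crv x0_def[symmetric] using *(2) by auto
      qed
      then show "crv s + \<i> * of_real \<eta>' \<in> Op"
        using \<eta>' by (simp add: Op_def crv_def)
    next
      define w where "w = crv (x0 - pi) + \<i> * of_real \<eta>"
      have w: "crv (x0 + pi) + \<i> * of_real \<eta> = w + 2 * of_real pi"
        using crv_periodic[of "x0 - pi"] by (simp add: w_def add.commute)
      have "(w + 2 * of_real pi - z) / 2 = (w - z) / 2 + of_real pi"
        by (simp add: diff_divide_distrib add_divide_distrib)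
      then have "cot ((w + 2 * of_real pi - z) / 2) = cot ((w - z) / 2)"
        by (simp only: cot_add_pi)
      moreover have "w \<noteq> z" "w + 2 * of_real pi \<noteq> z"
        unfolding w[symmetric] unfolding w_def eq_z using pi_gt_zero by auto
      moreover have "Im w \<noteq> h (Re w)" using \<eta> by (simp add: w_def crv_def)
      ultimately show "\<Phi> (crv (x0 + pi) + \<i> * of_real \<eta>) = \<Phi> (crv (x0 - pi) + \<i> * of_real \<eta>)"
        unfolding w w_def[symmetric] by (simp add: \<Phi>_def per)
    qed auto
    then show ?thesis unfolding J_def[abs_def] has_vector_derivative_def by simp
  qed
  \<comment> \<open>The two exceptional shifts are harmless because J is continuous there too: E is
    continuous across the graph and the pole at z is removable.\<close>
  have const: "J b = J a" if "a \<le> b" for a b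
    by (rule has_derivative_zero_unique_strong_interval[where k = "{0, \<eta>z}" and f = J and a = a and b = b])
      (use that in \<open>simp_all add: cJ has_derivative_at_withinI[OF dJ]\<close>)
  obtain M where M: "M \<ge> 0" "\<And>x. \<bar>h' x\<bar> \<le> M" using h'_bounded by blast
  obtain B where B: "B \<ge> 0" "\<And>x. \<bar>h x\<bar> \<le> B" using h_bounded by blast
  note dc = norm_dcrv_le[OF M(2)]
  have int_dcrv: "(dcrv has_integral 2 * pi) {x0 - pi..x0 + pi}"
  proof -
    have "(dcrv has_integral crv (x0 + pi) - crv (x0 - pi)) {x0 - pi..x0 + pi}"
      by (intro fundamental_theorem_of_calculus has_vector_derivative_at_within[OF crv_deriv]) auto
    moreover have "crv (x0 + pi) - crv (x0 - pi) = 2 * pi"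
      using crv_periodic[of "x0 - pi"] by (simp add: add.commute)
    ultimately show ?thesis by simp
  qed
  \<comment> \<open>Both directions at once: for \<sigma> = 1 upwards and \<sigma> = -1 downwards, E
    w tends to 0 and the cotangent to -\<sigma> i, so \<Phi> tends to \<sigma> i E z, while
    \<open>dcrv\<close> integrates to 2 pi over a period.\<close>
  have J_lim: "\<exists>R. \<forall>\<eta>. \<sigma> * \<eta> > R \<longrightarrow> norm (J \<eta> - of_real \<sigma> * \<i> * E z * (2 * pi)) \<le> \<epsilon> * (1 + M) * (2 * pi)"
    if \<sigma>: "\<sigma> = 1 \<or> \<sigma> = -1" and \<epsilon>: "\<epsilon> > 0" for \<sigma> \<epsilon> :: real
  proof -
    obtain R where R: "\<And>z. \<bar>Im z\<bar> > R \<Longrightarrow> norm (E z) < \<epsilon> / 10"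
      using decay[of "\<epsilon> / 10"] \<epsilon> by auto
    \<comment> \<open>Beyond N the cotangent is at most 5 in modulus, so E w < \<epsilon> / 10 in
      norm contributes at most \<epsilon> / 2. The terms 2 and \<bar>Im z\<bar> give b >= 1, and the
      last one gives b >= 4 \<bar>E z\<bar> / \<epsilon>, which bounds the other contribution by
      \<epsilon> / 2.\<close>
    define N where "N = 2 + \<bar>R\<bar> + \<bar>Im z\<bar> + 8 * norm (E z) / \<epsilon>"
    have E0: "8 * norm (E z) / \<epsilon> \<ge> 0" using \<epsilon> by simp
    have far: "norm (\<Phi> w - of_real \<sigma> * \<i> * E z) \<le> \<epsilon>" if w: "\<sigma> * Im w > N" for w
    proof -
      define b where "b = \<sigma> * Im ((w - z) / 2)"
      have "\<bar>Im w\<bar> \<ge> \<sigma> * Im w" using \<sigma> by auto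
      then have Ew: "norm (E w) < \<epsilon> / 10" using R[of w] w E0 by (auto simp: N_def)
      have b: "b \<ge> 1" "b \<ge> 4 * norm (E z) / \<epsilon>"
        using w \<sigma> E0 by (auto simp: N_def b_def)
      have wz: "w \<noteq> z" using b by (auto simp: b_def)
      have "norm (cot u + of_real \<sigma> * \<i>) \<le> 4 * exp (- 2 * (\<sigma> * Im u))" if "\<sigma> * Im u \<ge> 1" for u
        using \<sigma> that cot_add_ii_bound[of u] cot_minus_ii_bound[of u] by auto
      from this[of "(w - z) / 2"] b(1)
      have c4: "norm (cot ((w - z) / 2) + of_real \<sigma> * \<i>) \<le> 4 * exp (- 2 * b)"
        unfolding b_def by blast
      have "2 * b \<le> exp (2 * b)" using exp_ge_add_one_self[of "2 * b"] by linarith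
      then have "inverse (exp (2 * b)) \<le> inverse (2 * b)" using b by (intro le_imp_inverse_le) auto
      then have e: "exp (- 2 * b) \<le> 1 / (2 * b)" by (simp add: exp_minus inverse_eq_divide)
      have "1 / (2 * b) \<le> 1" using b by simp
      with e have e1: "exp (- 2 * b) \<le> 1" by linarith
      have ns: "norm (of_real \<sigma> * \<i> :: complex) = 1" using \<sigma> by auto
      have c5: "norm (cot ((w - z) / 2)) \<le> 5"
      proof -
        have "norm (cot ((w - z) / 2)) \<le> norm (cot ((w - z) / 2) + of_real \<sigma> * \<i>) + norm (of_real \<sigma> * \<i> :: complex)"
          using norm_triangle_ineq4[of "cot ((w - z) / 2) + of_real \<sigma> * \<i>" "of_real \<sigma> * \<i>"] by simp
        then show ?thesis using c4 e1 ns by linarith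
      qed
      have "norm (E z) * (4 * exp (- 2 * b)) \<le> norm (E z) * (4 * (1 / (2 * b)))"
        using e by (intro mult_left_mono) auto
      also have "\<dots> \<le> \<epsilon> / 2" using b \<epsilon> by (simp add: field_simps)
      finally have t2: "norm (E z) * (4 * exp (- 2 * b)) \<le> \<epsilon> / 2" .
      have "\<Phi> w - of_real \<sigma> * \<i> * E z = E w * cot ((w - z) / 2) - E z * (cot ((w - z) / 2) + of_real \<sigma> * \<i>)"
        using wz by (simp add: \<Phi>_def algebra_simps)
      then have "norm (\<Phi> w - of_real \<sigma> * \<i> * E z) \<le>
          norm (E w) * norm (cot ((w - z) / 2)) + norm (E z) * norm (cot ((w - z) / 2) + of_real \<sigma> * \<i>)"
        unfolding norm_mult[symmetric] by (simp only: norm_triangle_ineq4)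
      also have "\<dots> \<le> \<epsilon> / 10 * 5 + norm (E z) * (4 * exp (- 2 * b))"
        using Ew c4 c5 \<epsilon> by (intro add_mono mult_mono mult_left_mono) auto
      also have "\<dots> \<le> \<epsilon>" using t2 by simp
      finally show ?thesis .
    qed
    have "norm (J \<eta> - of_real \<sigma> * \<i> * E z * (2 * pi)) \<le> \<epsilon> * (1 + M) * (2 * pi)" if \<eta>: "\<sigma> * \<eta> > N + B" for \<eta>
    proof -
      have "continuous_on {x0 - pi..x0 + pi} (\<lambda>s. \<Phi> (crv s + \<i> * of_real \<eta>) * dcrv s)"
      proof -
        have "continuous_on {x0 - pi..x0 + pi} (\<lambda>s. (\<eta>, s))" by (intro continuous_intros)
        from continuous_on_compose2[OF cI[of UNIV] this] show ?thesis by auto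
      qed
      then have "((\<lambda>s. \<Phi> (crv s + \<i> * of_real \<eta>) * dcrv s) has_integral J \<eta>) {x0 - pi..x0 + pi}"
        unfolding J_def by (intro integrable_integral integrable_continuous_real)
      then have i: "((\<lambda>s. \<Phi> (crv s + \<i> * of_real \<eta>) * dcrv s - of_real \<sigma> * \<i> * E z * dcrv s) has_integral
          J \<eta> - of_real \<sigma> * \<i> * E z * (2 * pi)) {x0 - pi..x0 + pi}"
        by (intro has_integral_diff has_integral_mult_right int_dcrv)
      have "norm (J \<eta> - of_real \<sigma> * \<i> * E z * (2 * pi)) \<le> (\<epsilon> * (1 + M)) * measure lborel {x0 - pi..x0 + pi}"
      proof (rule has_integral_bound_real[OF _ finite.emptyI i])
        fix s
        have "\<sigma> * Im (crv s + \<i> * of_real \<eta>) > N"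
          unfolding Im_crv using \<eta> \<sigma> B(2)[of s] by (auto simp: distrib_left)
        then have "norm (\<Phi> (crv s + \<i> * of_real \<eta>) - of_real \<sigma> * \<i> * E z) * norm (dcrv s) \<le> \<epsilon> * (1 + M)"
          using far dc \<epsilon> by (intro mult_mono) auto
        then show "norm (\<Phi> (crv s + \<i> * of_real \<eta>) * dcrv s - of_real \<sigma> * \<i> * E z * dcrv s) \<le> \<epsilon> * (1 + M)"
          by (simp only: norm_mult[symmetric] left_diff_distrib)
      qed (use M \<epsilon> in auto)
      then show ?thesis by simp
    qed
    then show ?thesis by blast
  qed
  have "norm (4 * pi * \<i> * E z) \<le> e" if "e > 0" for e
  proof -
    define \<epsilon> where "\<epsilon> = e / ((1 + M) * (4 * pi))"
    have \<epsilon>: "\<epsilon> > 0" using that M by (simp add: \<epsilon>_def)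
    obtain R1 where R1: "\<And>\<eta>. 1 * \<eta> > R1 \<Longrightarrow> norm (J \<eta> - of_real 1 * \<i> * E z * (2 * pi)) \<le> \<epsilon> * (1 + M) * (2 * pi)"
      using J_lim[OF _ \<epsilon>, of 1] by blast
    obtain R2 where R2: "\<And>\<eta>. (-1) * \<eta> > R2 \<Longrightarrow> norm (J \<eta> - of_real (-1) * \<i> * E z * (2 * pi)) \<le> \<epsilon> * (1 + M) * (2 * pi)"
      using J_lim[OF _ \<epsilon>, of "-1"] by blast
    define a where "a = \<bar>R1\<bar> + \<bar>R2\<bar> + 1"
    have a: "a > R1" "a > R2" "-a \<le> a" by (auto simp: a_def)
    \<comment> \<open>J has equal values at a and -a, but these are close to 2 pi i E z and -2 pi i
      E z. The difference of the two targets is thus at most twice the error, which \<epsilon> was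
      scaled to make e.\<close>
    have "4 * pi * \<i> * E z = (J (-a) - of_real (-1) * \<i> * E z * (2 * pi)) - (J a - of_real 1 * \<i> * E z * (2 * pi))"
      using const[OF a(3)] by (simp add: algebra_simps)
    also have "norm \<dots> \<le> \<epsilon> * (1 + M) * (2 * pi) + \<epsilon> * (1 + M) * (2 * pi)"
      using R1[of a] R2[of "-a"] a by (intro order_trans[OF norm_triangle_ineq4 add_mono]) simp_all
    also have "\<dots> = \<epsilon> * ((1 + M) * (4 * pi))" by (simp add: algebra_simps)
    also have "\<dots> = e" using M by (simp add: \<epsilon>_def)
    finally show ?thesis .
  qed
  then have "norm (4 * pi * \<i> * E z) \<le> 0" by (rule field_le_epsilon[of _ 0, simplified])
  then show ?thesis by simp
qed

end

section \<open>Regularity of functions in the Sobolev space\<close>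

lemma continuous_on_cis' [continuous_intros]:
  "continuous_on A f \<Longrightarrow> continuous_on A (\<lambda>x. cis (f x))"
  unfolding cis.ctr
  by (intro continuous_on_Complex continuous_on_compose2[OF continuous_on_cos[OF continuous_on_id, of UNIV]]
      continuous_on_compose2[OF continuous_on_sin[OF continuous_on_id, of UNIV]]) auto

lemma cis_times_cos: "of_real (cos t) * cis (of_int n * t) = (cis (of_int (n + 1) * t) + cis (of_int (n - 1) * t)) / 2"
proof -
  have "cis (of_int (n + 1) * t) = cis (of_int n * t) * cis t" "cis (of_int (n - 1) * t) = cis (of_int n * t) * cis (- t)"
    by (simp_all add: cis_mult algebra_simps)
  moreover have "cis t + cis (- t) = 2 * of_real (cos t)" by (simp add: complex_eq_iff)
  ultimately show ?thesis by (simp add: distrib_left[symmetric])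
qed

lemma cis_int_periodic: "cis (of_int n * (x + 2 * pi)) = cis (of_int n * x)"
proof -
  have "cis (of_int n * (x + 2 * pi)) = cis (of_int n * x) * cis (2 * pi * of_int n)"
    by (simp add: cis_mult algebra_simps)
  also have "cis (2 * pi * of_int n) = 1" by (intro cis_multiple_2pi) auto
  finally show ?thesis by simp
qed

text \<open>
  Around any point, the even part of a function with vanishing Fourier coefficients is
  orthogonal to all polynomials in the cosine, hence zero by Weierstrass.
\<close>

lemma fourier_coefficients_unique:
  fixes d :: "real \<Rightarrow> complex"
  assumes cont: "continuous_on UNIV d" and per: "\<And>x. d (x + 2 * pi) = d x"
    and zero: "\<And>n::int. integral {-pi..pi} (\<lambda>x. d x * cis (of_int n * x)) = 0"
  shows "d x0 = 0"
proof -
  let ?I = "{-pi..pi}"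
  have cd [continuous_intros]: "continuous_on A f \<Longrightarrow> continuous_on A (\<lambda>x. d (f x))" for f and A :: "real set"
    by (rule continuous_on_compose2[OF cont]) auto
  define E where "E t = d (x0 - t)" for t
  have cE [continuous_intros]: "continuous_on A f \<Longrightarrow> continuous_on A (\<lambda>x. E (f x))" for f and A :: "real set"
    unfolding E_def by (intro continuous_intros)
  have s1: "integral ?I (\<lambda>t. E t * cis (of_int n * t)) = 0" for n :: int
  proof -
    let ?f = "\<lambda>s. d s * cis (of_int (-n) * s)"
    have "integral ?I (\<lambda>s. ?f (x0 - s)) = integral ?I ?f"
      by (intro integral_periodic_reflect_shift continuous_intros) (simp_all only: per cis_int_periodic)
    then have "integral ?I (\<lambda>s. cis (of_int n * x0) * ?f (x0 - s)) = 0"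
      using zero[of "-n"] by simp
    moreover have "cis (of_int n * x0) * ?f (x0 - s) = E s * cis (of_int n * s)" for s
    proof -
      have "cis (of_int n * x0) * cis (of_int (-n) * (x0 - s)) = cis (of_int n * s)"
        by (simp add: cis_mult algebra_simps)
      then show ?thesis by (simp only: E_def mult.left_commute)
    qed
    ultimately show ?thesis by (simp only:)
  qed
  \<comment> \<open>The induction is over all frequencies simultaneously, since a factor cos t moves
    a frequency n to n + 1 and n - 1.\<close>
  have s2: "integral ?I (\<lambda>t. E t * of_real (cos t) ^ m * cis (of_int n * t)) = 0" for m and n :: int
  proof (induction m arbitrary: n)
    case 0
    then show ?case using s1 by simp
  next
    case (Suc m)
    have int: "(\<lambda>t. E t * of_real (cos t) ^ m * cis (of_int k * t)) integrable_on ?I" for k :: int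
      by (intro integrable_continuous_real continuous_intros)
    have eq: "E t * of_real (cos t) ^ Suc m * cis (of_int n * t) =
        (E t * of_real (cos t) ^ m * cis (of_int (n + 1) * t) + E t * of_real (cos t) ^ m * cis (of_int (n - 1) * t)) / 2" for t
    proof -
      have "E t * of_real (cos t) ^ Suc m * cis (of_int n * t) = E t * of_real (cos t) ^ m * (of_real (cos t) * cis (of_int n * t))"
        by (simp add: mult_ac)
      also have "\<dots> = E t * of_real (cos t) ^ m * ((cis (of_int (n + 1) * t) + cis (of_int (n - 1) * t)) / 2)"
        by (simp only: cis_times_cos)
      finally show ?thesis by (simp only: distrib_left times_divide_eq_right)
    qed
    show ?case
      unfolding eq using Suc.IH[of "n + 1"] Suc.IH[of "n - 1"] int[of "n + 1"] int[of "n - 1"]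
      by (simp only: Henstock_Kurzweil_Integration.integral_divide Henstock_Kurzweil_Integration.integral_add) simp
  qed
  define D where "D t = E t + E (- t)" for t
  have cD [continuous_intros]: "continuous_on A f \<Longrightarrow> continuous_on A (\<lambda>x. D (f x))" for f and A :: "real set"
    unfolding D_def by (intro continuous_intros)
  have s3: "integral ?I (\<lambda>t. D t * of_real (cos t) ^ m) = 0" for m
  proof -
    have 1: "integral ?I (\<lambda>t. E t * of_real (cos t) ^ m) = 0" using s2[of m 0] by simp
    have 2: "integral ?I (\<lambda>t. E (- t) * of_real (cos t) ^ m) = 0"
      using 1 Henstock_Kurzweil_Integration.integral_reflect_real[of pi "-pi" "\<lambda>t. E t * of_real (cos t) ^ m"] by simp
    have "integral ?I (\<lambda>t. E t * of_real (cos t) ^ m + E (- t) * of_real (cos t) ^ m) = 0 + 0"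
      by (subst Henstock_Kurzweil_Integration.integral_add)
        (auto intro!: integrable_continuous_real continuous_intros simp: 1 2)
    then show ?thesis by (simp add: D_def distrib_right)
  qed
  have s4: "integral ?I (\<lambda>t. D t * of_real (\<phi> (cos t))) = 0" if \<phi>: "continuous_on {-1..1} \<phi>" for \<phi>
  proof -
    have c\<phi>: "continuous_on ?I (\<lambda>t. \<phi> (cos t))"
      by (rule continuous_on_compose2[OF \<phi>]) (auto intro!: continuous_intros)
    have "bounded (D ` ?I)"
      by (intro compact_imp_bounded compact_continuous_image continuous_intros) auto
    then obtain B where B: "\<And>t. t \<in> ?I \<Longrightarrow> norm (D t) \<le> B" unfolding bounded_iff by blast
    have "norm (D 0) \<le> B" using pi_gt_zero by (intro B) auto
    then have B0: "B \<ge> 0" by (rule order_trans[OF norm_ge_zero])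
    have "norm (integral ?I (\<lambda>t. D t * of_real (\<phi> (cos t)))) \<le> 0 + e" if "e > 0" for e
    proof -
      define \<epsilon> where "\<epsilon> = e / (2 * pi * (B + 1))"
      have e: "\<epsilon> > 0" using that B0 by (simp add: \<epsilon>_def)
      obtain q where q: "real_polynomial_function q" "\<And>x. x \<in> {-1..1} \<Longrightarrow> \<bar>\<phi> x - q x\<bar> < \<epsilon>"
        by (rule Stone_Weierstrass_real_polynomial_function[OF _ \<phi> e]) auto
      then obtain a n where qa: "q = (\<lambda>x. \<Sum>i\<le>n. a i * x ^ i)"
        unfolding real_polynomial_function_iff_sum by blast
      have q0: "integral ?I (\<lambda>t. D t * of_real (q (cos t))) = 0"
      proof -
        have "D t * of_real (q (cos t)) = (\<Sum>i\<le>n. of_real (a i) * (D t * of_real (cos t) ^ i))" for t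
          by (simp add: qa sum_distrib_left mult_ac)
        moreover have "integral ?I (\<lambda>t. \<Sum>i\<le>n. of_real (a i) * (D t * of_real (cos t) ^ i)) =
            (\<Sum>i\<le>n. integral ?I (\<lambda>t. of_real (a i) * (D t * of_real (cos t) ^ i)))"
          by (intro integral_sum integrable_continuous_real continuous_intros) auto
        ultimately show ?thesis by (simp add: s3)
      qed
      have cq: "continuous_on ?I (\<lambda>t. q (cos t))" unfolding qa by (intro continuous_intros)
      have i: "((\<lambda>t. D t * of_real (\<phi> (cos t)) - D t * of_real (q (cos t))) has_integral
          integral ?I (\<lambda>t. D t * of_real (\<phi> (cos t))) - 0) ?I"
        unfolding q0[symmetric]
        by (intro has_integral_diff integrable_integral integrable_continuous_real continuous_intros c\<phi> cq)
      have "norm (integral ?I (\<lambda>t. D t * of_real (\<phi> (cos t))) - 0) \<le> (B * \<epsilon>) * measure lborel ?I"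
      proof (rule has_integral_bound_real[OF _ finite.emptyI i])
        fix t assume t: "t \<in> ?I - {}"
        have "norm (D t) * \<bar>\<phi> (cos t) - q (cos t)\<bar> \<le> B * \<epsilon>"
          using B[of t] q(2)[of "cos t"] t B0 by (intro mult_mono) auto
        then show "norm (D t * of_real (\<phi> (cos t)) - D t * of_real (q (cos t))) \<le> B * \<epsilon>"
          by (simp only: right_diff_distrib[symmetric] of_real_diff[symmetric] norm_mult norm_of_real)
      qed (use B0 e in auto)
      also have "\<dots> = B * \<epsilon> * (2 * pi)" by simp
      also have "\<dots> \<le> (B + 1) * \<epsilon> * (2 * pi)" using e by (intro mult_right_mono) auto
      also have "\<dots> = e" using B0 by (simp add: \<epsilon>_def)
      finally show ?thesis by simp
    qed
    then have "norm (integral ?I (\<lambda>t. D t * of_real (\<phi> (cos t)))) \<le> 0" by (rule field_le_epsilon)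
    then show ?thesis by simp
  qed
  \<comment> \<open>On the period arccos (cos t) is \<bar>t\<bar>, and D is even. So D itself is a
    continuous function of cos t and may serve as a test function against itself.\<close>
  have Deq: "D (arccos (cos t)) = D t" if "t \<in> ?I" for t
  proof (cases "t \<ge> 0")
    case True
    then show ?thesis using that by (simp add: arccos_cos)
  next
    case False
    then have "arccos (cos t) = - t" using that arccos_cos[of "-t"] by simp
    then show ?thesis by (simp add: D_def add.commute)
  qed
  have ca: "continuous_on {-1..1} (\<lambda>u. D (arccos u))"
    by (intro continuous_intros) auto
  have re: "integral ?I (\<lambda>t. D t * of_real (Re (D t))) = 0"
  proof -
    have "integral ?I (\<lambda>t. D t * of_real (Re (D (arccos (cos t))))) = 0"
      by (rule s4) (intro continuous_intros ca)
    also have "integral ?I (\<lambda>t. D t * of_real (Re (D (arccos (cos t))))) = integral ?I (\<lambda>t. D t * of_real (Re (D t)))"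
      by (intro integral_cong) (simp add: Deq)
    finally show ?thesis .
  qed
  have im: "integral ?I (\<lambda>t. D t * of_real (Im (D t))) = 0"
  proof -
    have "integral ?I (\<lambda>t. D t * of_real (Im (D (arccos (cos t))))) = 0"
      by (rule s4) (intro continuous_intros ca)
    also have "integral ?I (\<lambda>t. D t * of_real (Im (D (arccos (cos t))))) = integral ?I (\<lambda>t. D t * of_real (Im (D t)))"
      by (intro integral_cong) (simp add: Deq)
    finally show ?thesis .
  qed
  \<comment> \<open>The two real test functions are recombined into the conjugate of D, which gives
    the integral of \<bar>D\<bar>^2. At 0 the function D is twice the value d x0.\<close>
  have "((\<lambda>t. D t * of_real (Re (D t)) - \<i> * (D t * of_real (Im (D t)))) has_integral 0 - \<i> * 0) ?I"
  proof (intro has_integral_diff has_integral_mult_right)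
    show "((\<lambda>t. D t * of_real (Re (D t))) has_integral 0) ?I"
      unfolding has_integral_iff re by (auto intro!: integrable_continuous_real continuous_intros)
    show "((\<lambda>t. D t * of_real (Im (D t))) has_integral 0) ?I"
      unfolding has_integral_iff im by (auto intro!: integrable_continuous_real continuous_intros)
  qed
  moreover have "D t * of_real (Re (D t)) - \<i> * (D t * of_real (Im (D t))) = of_real ((norm (D t))\<^sup>2)" for t
    unfolding cmod_power2 by (simp add: complex_eq_iff power2_eq_square algebra_simps)
  ultimately have "((\<lambda>t. of_real ((norm (D t))\<^sup>2) :: complex) has_integral of_real 0) ?I" by simp
  from has_integral_Re[OF this] have "((\<lambda>t. (norm (D t))\<^sup>2) has_integral 0) ?I"
    by simp
  then have "integral ?I (\<lambda>t. (norm (D t))\<^sup>2) = 0" by (rule integral_unique)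
  then have "(norm (D 0))\<^sup>2 = 0"
    by (subst (asm) integral_eq_0_iff) (auto intro!: continuous_intros)
  then show ?thesis by (simp add: D_def E_def)
qed

section \<open>Hoelder estimates for trigonometric series and the embedding of H^2\<close>

lemma norm_cis_diff_le: "norm (cis a - cis b) \<le> 2 * \<bar>a - b\<bar>"
proof -
  have "\<bar>sin a - sin b\<bar> \<le> \<bar>a - b\<bar>"
  proof -
    have "\<bar>sin ((a - b) / 2) * cos ((a + b) / 2)\<bar> \<le> \<bar>(a - b) / 2\<bar> * 1"
      unfolding abs_mult by (intro mult_mono abs_sin_x_le_abs_x) auto
    then show ?thesis unfolding sin_diff_sin by (simp add: abs_mult)
  qed
  moreover have "\<bar>cos a - cos b\<bar> \<le> \<bar>a - b\<bar>"
  proof -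
    have "\<bar>sin ((a + b) / 2) * sin ((b - a) / 2)\<bar> \<le> 1 * \<bar>(b - a) / 2\<bar>"
      unfolding abs_mult by (intro mult_mono abs_sin_x_le_abs_x) auto
    then show ?thesis unfolding cos_diff_cos by (simp add: abs_mult abs_minus_commute)
  qed
  ultimately show ?thesis using cmod_le[of "cis a - cis b"] by simp
qed

text \<open>Interpolation between the Lipschitz bound and the trivial bound 2: for a distance of at
  most 1 a power p <= 1 only increases it, and beyond 1 the trivial bound is the smaller
  one.\<close>

lemma norm_cis_diff_le_powr:
  assumes "0 \<le> p" "p \<le> 1"
  shows "norm (cis a - cis b) \<le> 2 * \<bar>a - b\<bar> powr p"
proof (cases "\<bar>a - b\<bar> \<le> 1")
  case True
  have "\<bar>a - b\<bar> \<le> \<bar>a - b\<bar> powr p"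
  proof (cases "a = b")
    case False
    then have "\<bar>a - b\<bar> powr 1 \<le> \<bar>a - b\<bar> powr p"
      using True assms by (intro powr_mono') auto
    then show ?thesis by simp
  qed simp
  then have "2 * \<bar>a - b\<bar> \<le> 2 * \<bar>a - b\<bar> powr p" by simp
  then show ?thesis by (rule order_trans[OF norm_cis_diff_le])
next
  case False
  have "norm (cis a - cis b) \<le> 2"
    using norm_triangle_ineq4[of "cis a" "cis b"] by simp
  also have "\<dots> \<le> 2 * \<bar>a - b\<bar> powr p"
    using False assms by (simp add: ge_one_powr_ge_zero)
  finally show ?thesis .
qed

lemma has_integral_cis:
  "((\<lambda>x. cis (of_int k * x)) has_integral (if k = 0 then 2 * pi else 0)) {-pi..pi}"
proof (cases "k = 0")
  case True
  then show ?thesis using has_integral_const_real[of "1::complex" "-pi" pi] by (simp add: scaleR_conv_of_real)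
next
  case False
  have "((\<lambda>x. cis (of_int k * x)) has_integral
      cis (of_int k * pi) / (\<i> * of_int k) - cis (of_int k * (-pi)) / (\<i> * of_int k)) {-pi..pi}"
  proof (rule fundamental_theorem_of_calculus)
    fix x
    have "((\<lambda>x. cis (of_int k * x)) has_derivative (\<lambda>t. (of_int k * t) *\<^sub>R (\<i> * cis (of_int k * x)))) (at x within {-pi..pi})"
      by (auto intro!: derivative_eq_intros)
    then have "((\<lambda>x. cis (of_int k * x)) has_vector_derivative (\<i> * of_int k) * cis (of_int k * x)) (at x within {-pi..pi})"
      by (simp add: has_vector_derivative_def scaleR_conv_of_real mult_ac)
    from has_vector_derivative_divide[OF this, of "\<i> * of_int k"]
    show "((\<lambda>x. cis (of_int k * x) / (\<i> * of_int k)) has_vector_derivative cis (of_int k * x)) (at x within {-pi..pi})"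
      using False by simp
  qed auto
  moreover have "cis (of_int k * pi) = cis (of_int k * (-pi))"
    using cis_int_periodic[of k "-pi"] by simp
  ultimately show ?thesis using False by simp
qed

lemma fourier_coeff_eq_integral:
  assumes "continuous_on UNIV h"
  shows "fourier_coeff h n = integral {-pi..pi} (\<lambda>x. of_real (h x) * cis (- of_int n * x)) / (2 * pi)"
proof -
  have "(\<lambda>x. of_real (h x) * cis (- of_int n * x)) absolutely_integrable_on {-pi..pi}"
    by (intro absolutely_integrable_continuous_real continuous_intros continuous_on_subset[OF assms]) auto
  then show ?thesis
    unfolding fourier_coeff_def by (simp add: set_lebesgue_integral_eq_integral)
qed

lemma fourier_coeff_uminus:
  assumes "continuous_on UNIV h"
  shows "fourier_coeff h (- n) = cnj (fourier_coeff h n)"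
proof -
  have "integral {-pi..pi} (\<lambda>x. cnj (of_real (h x) * cis (- of_int n * x))) =
      cnj (integral {-pi..pi} (\<lambda>x. of_real (h x) * cis (- of_int n * x)))"
    by (rule integral_cnj[symmetric])
  then show ?thesis by (simp add: fourier_coeff_eq_integral[OF assms] cis_cnj)
qed

text \<open>
  By AM-GM, \<open>2 n\<^sup>5\<^sup>/\<^sup>4 \<bar>c\<^sub>n\<bar> \<le> n\<^sup>4 \<bar>c\<^sub>n\<bar>\<^sup>2 + n\<^sup>-\<^sup>3\<^sup>/\<^sup>2\<close>.
\<close>

lemma summable_fourier_coeff:
  assumes "h \<in> Sobolev_circle 2"
  shows "summable (\<lambda>n. of_nat n powr (5/4) * norm (fourier_coeff h (int n)))"
proof -
  let ?c = "\<lambda>n. norm (fourier_coeff h (int n))"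
  let ?F = "\<lambda>n::int. (1 + (of_int n)\<^sup>2) powr 2 * (norm (fourier_coeff h n))\<^sup>2"
  have "?F summable_on UNIV" using assms by (simp add: Sobolev_circle_def)
  then have "?F summable_on range int" by (rule summable_on_subset_banach) auto
  then have "(?F \<circ> int) summable_on UNIV" by (simp add: summable_on_reindex)
  then have 1: "summable (\<lambda>n. ?F (int n))"
    by (subst (asm) summable_on_UNIV_nonneg_real_iff) (auto simp: o_def)
  have 2: "summable (\<lambda>n. of_nat n powr (-3/2) :: real)"
    by (simp add: summable_real_powr_iff)
  show ?thesis
  proof (rule summable_comparison_test'[OF summable_add[OF 1 2], of 0])
    fix n :: nat
    show "norm (of_nat n powr (5/4) * ?c n) \<le> ?F (int n) + of_nat n powr (-3/2)"
    proof (cases "n = 0")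
      case True
      then show ?thesis by simp
    next
      case False
      define a b where "a = of_nat n ^ 2 * ?c n" and "b = of_nat n powr (-3/4 :: real)"
      have "of_nat n powr (5/4) * ?c n = a * b"
      proof -
        have "of_nat n powr (5/4) = of_nat n powr 2 * (of_nat n powr (-3/4) :: real)"
          unfolding powr_add[symmetric] by simp
        then show ?thesis using False by (simp add: a_def b_def)
      qed
      moreover have "a * b \<le> a\<^sup>2 + b\<^sup>2"
        using sum_squares_bound[of a b] zero_le_power2[of a] zero_le_power2[of b] by linarith
      moreover have "b\<^sup>2 = of_nat n powr (-3/2)"
        using False by (simp add: b_def power2_eq_square flip: powr_add)
      moreover have "a\<^sup>2 \<le> ?F (int n)"
      proof -
        have "(of_nat n ^ 2)\<^sup>2 \<le> (1 + (of_nat n)\<^sup>2 :: real)\<^sup>2" by (intro power_mono) auto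
        then have "(of_nat n ^ 2)\<^sup>2 * (?c n)\<^sup>2 \<le> (1 + (of_nat n)\<^sup>2)\<^sup>2 * (?c n)\<^sup>2"
          by (intro mult_right_mono) auto
        moreover have "(1 + (of_nat n)\<^sup>2) powr 2 = (1 + (of_nat n)\<^sup>2 :: real)\<^sup>2"
          by (simp add: powr_numeral add_pos_nonneg)
        ultimately show ?thesis by (simp add: a_def power_mult_distrib)
      qed
      moreover have "norm (of_nat n powr (5/4) * ?c n) = of_nat n powr (5/4) * ?c n" by simp
      ultimately show ?thesis by linarith
    qed
  qed
qed

text \<open>The Fourier series of h, differentiated termwise, defines a function g with Hoelder
  derivative; h and g are continuous with the same coefficients, hence equal. The weight n^(5/4) is
  chosen between n, which suffices for differentiability, and n^(3/2), below which the coefficients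
  of an H^2 function are summable by Cauchy-Schwarz; its excess over n is the exponent 1/4.\<close>

theorem Sobolev_circle_2_regular:
  assumes H2: "h \<in> Sobolev_circle 2" and cont: "continuous_on UNIV h"
  obtains h' C where "\<And>x. (h has_real_derivative h' x) (at x)"
    "\<And>x y. \<bar>h' x - h' y\<bar> \<le> C * \<bar>x - y\<bar> powr (1/4)"
proof -
  define c where "c n = fourier_coeff h n" for n
  have per: "h (x + 2 * pi) = h x" for x
    using H2 by (simp add: Sobolev_circle_def L2_circle_def periodic_def)
  have cnj: "c (- n) = cnj (c n)" for n
    unfolding c_def by (rule fourier_coeff_uminus[OF cont])
  define N where "N n = norm (c (int n))" for n
  have N0: "N n \<ge> 0" for n by (simp add: N_def)
  have S: "summable (\<lambda>n. of_nat n powr (5/4) * N n)"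
    unfolding N_def c_def by (rule summable_fourier_coeff[OF H2])
  have n1: "of_nat n \<le> (of_nat n powr (5/4) :: real)" for n
    using powr_mono[of 1 "5/4" "of_nat n"] by (cases "n = 0") simp_all
  have S1: "summable (\<lambda>n. of_nat n * N n)"
  proof (rule summable_comparison_test'[OF S, of 0])
    fix n show "norm (of_nat n * N n) \<le> of_nat n powr (5/4) * N n"
      using mult_right_mono[OF n1 N0] N0[of n] by simp
  qed
  have S0: "summable N"
  proof (rule summable_comparison_test'[OF S1, of 1])
    fix n :: nat assume "n \<ge> 1"
    then show "norm (N n) \<le> of_nat n * N n" using mult_right_mono[of 1 "of_nat n" "N n"] N0[of n] by simp
  qed
  \<comment> \<open>The frequencies n and -n are paired into one real term, using that h is real.
    The series then runs over the natural numbers and can be differentiated as a real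
    series.\<close>
  define u where "u n x = (if n = 0 then Re (c 0) else 2 * Re (c (int n) * cis (of_nat n * x)))" for n :: nat and x :: real
  define u' where "u' n x = 2 * Re (\<i> * of_nat n * c (int n) * cis (of_nat n * x))" for n :: nat and x :: real
  have du: "(u n has_real_derivative u' n x) (at x within UNIV)" for n x
  proof (cases "n = 0")
    case False
    have "((\<lambda>x. cis (of_nat n * x)) has_derivative (\<lambda>t. (of_nat n * t) *\<^sub>R (\<i> * cis (of_nat n * x)))) (at x)"
      by (auto intro!: derivative_eq_intros)
    then have "((\<lambda>x. cis (of_nat n * x)) has_vector_derivative (\<i> * of_nat n) * cis (of_nat n * x)) (at x)"
      by (simp add: has_vector_derivative_def scaleR_conv_of_real mult_ac)
    then have "((\<lambda>x. c (int n) * cis (of_nat n * x)) has_vector_derivative c (int n) * ((\<i> * of_nat n) * cis (of_nat n * x))) (at x)"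
      by (rule has_vector_derivative_mult_right)
    then have "((\<lambda>x. Re (c (int n) * cis (of_nat n * x))) has_vector_derivative Re (c (int n) * ((\<i> * of_nat n) * cis (of_nat n * x)))) (at x)"
      by (rule bounded_linear.has_vector_derivative[OF bounded_linear_Re])
    then have "((\<lambda>x. 2 * Re (c (int n) * cis (of_nat n * x))) has_real_derivative 2 * Re (c (int n) * ((\<i> * of_nat n) * cis (of_nat n * x)))) (at x)"
      unfolding has_real_derivative_iff_has_vector_derivative[symmetric] by (rule DERIV_cmult)
    moreover have "u n = (\<lambda>x. 2 * Re (c (int n) * cis (of_nat n * x)))" using False by (simp add: u_def fun_eq_iff)
    ultimately show ?thesis by (simp add: u'_def mult_ac)
  qed (simp add: u_def[abs_def] u'_def)
  have bu: "norm (u n x) \<le> 2 * N n" for n x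
  proof (cases "n = 0")
    case True
    then show ?thesis using abs_Re_le_cmod[of "c 0"] N0[of 0] by (simp add: u_def N_def)
  next
    case False
    have "\<bar>Re (c (int n) * cis (of_nat n * x))\<bar> \<le> N n"
      using abs_Re_le_cmod[of "c (int n) * cis (of_nat n * x)"] by (simp add: norm_mult N_def)
    then show ?thesis using False by (simp add: u_def abs_mult)
  qed
  have bu': "norm (u' n x) \<le> 2 * (of_nat n * N n)" for n x
    using abs_Re_le_cmod[of "\<i> * of_nat n * c (int n) * cis (of_nat n * x)"]
    by (simp only: u'_def N_def norm_mult norm_ii norm_of_nat norm_cis real_norm_def abs_mult)
  have hu': "norm (u' n x - u' n y) \<le> 4 * (of_nat n powr (5/4) * N n) * \<bar>x - y\<bar> powr (1/4)" for n x y
  proof -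
    have "u' n x - u' n y = 2 * Re (\<i> * of_nat n * c (int n) * (cis (of_nat n * x) - cis (of_nat n * y)))"
      by (simp only: u'_def right_diff_distrib minus_complex.simps)
    then have "norm (u' n x - u' n y) = 2 * \<bar>Re (\<i> * of_nat n * c (int n) * (cis (of_nat n * x) - cis (of_nat n * y)))\<bar>"
      by (simp only: real_norm_def abs_mult abs_numeral)
    also have "\<dots> \<le> 2 * norm (\<i> * of_nat n * c (int n) * (cis (of_nat n * x) - cis (of_nat n * y)))"
      by (intro mult_left_mono abs_Re_le_cmod) auto
    also have "\<dots> = 2 * of_nat n * N n * norm (cis (of_nat n * x) - cis (of_nat n * y))"
      by (simp add: norm_mult N_def)
    also have "\<dots> \<le> 2 * of_nat n * N n * (2 * \<bar>of_nat n * x - of_nat n * y\<bar> powr (1/4))"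
      using N0 by (intro mult_left_mono norm_cis_diff_le_powr) auto
    also have "\<bar>of_nat n * x - of_nat n * y\<bar> = of_nat n * \<bar>x - y\<bar>"
      by (simp add: right_diff_distrib[symmetric] abs_mult)
    also have "(of_nat n * \<bar>x - y\<bar>) powr (1/4) = of_nat n powr (1/4) * \<bar>x - y\<bar> powr (1/4)"
      by (simp add: powr_mult)
    also have "2 * of_nat n * N n * (2 * (of_nat n powr (1/4) * \<bar>x - y\<bar> powr (1/4))) =
        4 * ((of_nat n * of_nat n powr (1/4)) * N n) * \<bar>x - y\<bar> powr (1/4)" by simp
    also have "of_nat n * of_nat n powr (1/4) = (of_nat n powr (5/4) :: real)"
    proof (cases "n = 0")
      case False
      have "of_nat n powr 1 * of_nat n powr (1/4) = (of_nat n powr (5/4) :: real)"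
        unfolding powr_add[symmetric] by simp
      then show ?thesis by simp
    qed simp
    finally show ?thesis .
  qed
  define g g' where "g x = (\<Sum>n. u n x)" and "g' x = (\<Sum>n. u' n x)" for x
  have su': "summable (\<lambda>n. u' n x)" for x
    by (rule summable_comparison_test'[OF summable_mult[OF S1, of 2], of 0]) (use bu' in auto)
  have su: "summable (\<lambda>n. u n x)" for x
    by (rule summable_comparison_test'[OF summable_mult[OF S0, of 2], of 0]) (use bu in auto)
  have dg: "(g has_real_derivative g' x) (at x)" for x
    unfolding g_def[abs_def] g'_def
    by (rule has_field_derivative_series'(2)[where S = UNIV and ?x0.0 = 0, OF _ du
        Weierstrass_m_test'[OF bu' summable_mult[OF S1]] _ su]) auto
  define K where "K = (\<Sum>n. 4 * (of_nat n powr (5/4) * N n))"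
  have hg': "\<bar>g' x - g' y\<bar> \<le> K * \<bar>x - y\<bar> powr (1/4)" for x y
  proof -
    have sK: "summable (\<lambda>n. 4 * (of_nat n powr (5/4) * N n))" by (rule summable_mult[OF S])
    have sB: "summable (\<lambda>n. 4 * (of_nat n powr (5/4) * N n) * \<bar>x - y\<bar> powr (1/4))"
      by (rule summable_mult2[OF sK])
    have sn: "summable (\<lambda>n. norm (u' n x - u' n y))"
      by (rule summable_comparison_test'[OF sB, of 0]) (use hu' in auto)
    have "g' x - g' y = (\<Sum>n. u' n x - u' n y)"
      unfolding g'_def by (rule suminf_diff[OF su' su'])
    then have "\<bar>g' x - g' y\<bar> \<le> (\<Sum>n. norm (u' n x - u' n y))"
      using summable_norm[OF sn] by simp
    also have "\<dots> \<le> (\<Sum>n. 4 * (of_nat n powr (5/4) * N n) * \<bar>x - y\<bar> powr (1/4))"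
      by (rule suminf_le[OF hu' sn sB])
    also have "\<dots> = K * \<bar>x - y\<bar> powr (1/4)" unfolding K_def by (rule suminf_mult2[OF sK, symmetric])
    finally show ?thesis .
  qed
  have cg: "continuous_on A g" for A
    using dg by (intro continuous_at_imp_continuous_on) (auto intro: DERIV_isCont)
  have ur: "of_real (u n x) = (if n = 0 then c 0 else c (int n) * cis (of_int (int n) * x) + c (- int n) * cis (of_int (- int n) * x))" for n x
  proof (cases "n = 0")
    case True
    have "c 0 = cnj (c 0)" using cnj[of 0] by simp
    then have "Im (c 0) = 0" by (simp add: complex_eq_iff)
    then show ?thesis using True by (simp add: u_def complex_eq_iff)
  next
    case False
    have "c (- int n) * cis (of_int (- int n) * x) = cnj (c (int n) * cis (of_int (int n) * x))"
      by (simp add: cnj cis_cnj)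
    moreover have "w + cnj w = of_real (2 * Re w)" for w by (rule complex_add_cnj)
    ultimately show ?thesis using False by (simp only: u_def if_False of_int_of_nat_eq)
  qed
  \<comment> \<open>Testing against frequency m selects the coefficient at -m, which sits in the
    term with index \<bar>m\<bar>; by orthogonality all other terms vanish.\<close>
  have iu: "((\<lambda>x. of_real (u n x) * cis (of_int m * x)) has_integral (if n = nat \<bar>m\<bar> then 2 * pi * c (- m) else 0)) {-pi..pi}" for n and m :: int
  proof (cases "n = 0")
    case True
    have "((\<lambda>x. c 0 * cis (of_int m * x)) has_integral c 0 * (if m = 0 then 2 * pi else 0)) {-pi..pi}"
      by (intro has_integral_mult_right has_integral_cis)
    then show ?thesis using True by (auto simp: ur mult.commute)
  next
    case False
    have "((\<lambda>x. c (int n) * cis (of_int (int n + m) * x) + c (- int n) * cis (of_int (- int n + m) * x)) has_integral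
        c (int n) * (if int n + m = 0 then 2 * pi else 0) + c (- int n) * (if - int n + m = 0 then 2 * pi else 0)) {-pi..pi}"
      by (intro has_integral_add has_integral_mult_right has_integral_cis)
    moreover have "c (int n) * cis (of_int (int n + m) * x) + c (- int n) * cis (of_int (- int n + m) * x) =
        of_real (u n x) * cis (of_int m * x)" for x
    proof -
      have "cis (of_int (int n + m) * x) = cis (of_int (int n) * x) * cis (of_int m * x)"
        "cis (of_int (- int n + m) * x) = cis (of_int (- int n) * x) * cis (of_int m * x)"
        by (simp_all add: cis_mult algebra_simps)
      then show ?thesis using False by (simp only: ur if_False distrib_right mult.assoc)
    qed
    moreover have "c (int n) * (if int n + m = 0 then 2 * pi else 0) + c (- int n) * (if - int n + m = 0 then 2 * pi else 0) =
        (if n = nat \<bar>m\<bar> then 2 * pi * c (- m) else 0)"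
    proof -
      have "n = nat \<bar>m\<bar> \<longleftrightarrow> m = int n \<or> m = - int n" by auto
      then show ?thesis using False by (cases "m = int n"; cases "m = - int n") auto
    qed
    ultimately show ?thesis by simp
  qed
  have coeff: "integral {-pi..pi} (\<lambda>x. of_real (g x) * cis (of_int m * x)) = 2 * pi * c (- m)" for m :: int
  proof -
    have "uniform_limit {-pi..pi} (\<lambda>k x. \<Sum>i<k. of_real (u i x) * cis (of_int m * x)) (\<lambda>x. \<Sum>i. of_real (u i x) * cis (of_int m * x)) sequentially"
      by (rule Weierstrass_m_test[OF _ summable_mult[OF S0, of 2]]) (use bu in \<open>auto simp: norm_mult\<close>)
    moreover have "(\<Sum>i. of_real (u i x) * cis (of_int m * x)) = of_real (g x) * cis (of_int m * x)" for x
      unfolding g_def suminf_of_real[OF su]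
      by (rule suminf_mult2[OF summable_of_real[OF su], symmetric])
    ultimately have ul: "uniform_limit {-pi..pi} (\<lambda>k x. \<Sum>i<k. of_real (u i x) * cis (of_int m * x)) (\<lambda>x. of_real (g x) * cis (of_int m * x)) sequentially"
      by simp
    have cu: "continuous_on A (u i)" for A i
      using du by (intro continuous_at_imp_continuous_on) (auto intro: DERIV_isCont)
    obtain I J where I: "\<And>k. ((\<lambda>x. \<Sum>i<k. of_real (u i x) * cis (of_int m * x)) has_integral I k) {-pi..pi}"
      and J: "((\<lambda>x. of_real (g x) * cis (of_int m * x)) has_integral J) {-pi..pi}" and IJ: "I \<longlonglongrightarrow> J"
      by (rule uniform_limit_integral[OF ul]) (auto intro!: continuous_intros cu)
    have "I k = 2 * pi * c (- m)" if "k \<ge> Suc (nat \<bar>m\<bar>)" for k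
    proof -
      have "((\<lambda>x. \<Sum>i<k. of_real (u i x) * cis (of_int m * x)) has_integral (\<Sum>i<k. if i = nat \<bar>m\<bar> then 2 * pi * c (- m) else 0)) {-pi..pi}"
        by (intro has_integral_sum iu) auto
      from has_integral_unique[OF I this]
      show ?thesis using that by (simp only: sum.delta finite_lessThan) auto
    qed
    then have "\<forall>\<^sub>F k in sequentially. I k = 2 * pi * c (- m)"
      by (rule eventually_sequentiallyI)
    then have "I \<longlonglongrightarrow> 2 * pi * c (- m)" by (rule tendsto_eventually)
    then have "J = 2 * pi * c (- m)" by (rule LIMSEQ_unique[OF IJ])
    then show ?thesis using J by (simp add: integral_unique)
  qed
  have "of_real (h x) - of_real (g x) = (0 :: complex)" for x
  proof (rule fourier_coefficients_unique[where d = "\<lambda>x. of_real (h x) - of_real (g x)"])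
    show "continuous_on UNIV (\<lambda>x. of_real (h x) - of_real (g x) :: complex)"
      by (intro continuous_intros cont cg)
    show "of_real (h (x + 2 * pi)) - of_real (g (x + 2 * pi)) = (of_real (h x) - of_real (g x) :: complex)" for x
    proof -
      have "cis (of_nat n * (x + 2 * pi)) = cis (of_nat n * x)" for n
        using cis_int_periodic[of "int n" x] by simp
      then show ?thesis by (simp only: per g_def u_def)
    qed
    fix m :: int
    have "integral {-pi..pi} (\<lambda>x. of_real (h x) * cis (of_int m * x)) = 2 * pi * c (- m)"
      by (simp add: c_def fourier_coeff_eq_integral[OF cont])
    moreover have "integral {-pi..pi} (\<lambda>x. of_real (h x) * cis (of_int m * x) - of_real (g x) * cis (of_int m * x)) =
        integral {-pi..pi} (\<lambda>x. of_real (h x) * cis (of_int m * x)) - integral {-pi..pi} (\<lambda>x. of_real (g x) * cis (of_int m * x))"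
      by (intro Henstock_Kurzweil_Integration.integral_diff integrable_continuous_real continuous_intros cg continuous_on_subset[OF cont]) auto
    ultimately show "integral {-pi..pi} (\<lambda>x. (of_real (h x) - of_real (g x)) * cis (of_int m * x)) = 0"
      by (simp only: left_diff_distrib coeff) simp
  qed
  then have "h = g" by (simp add: fun_eq_iff flip: of_real_diff)
  then show ?thesis using that[of g' K] dg hg' by simp
qed

section \<open>Velocity fields and potentials in the plane\<close>

text \<open>The regularity classes are phrased with derivatives as bounded linear maps, Darcy's law
  with gradient vectors. The map sending a vector to its inner product functional is itself bounded
  linear, so continuity and differentiability carry over.\<close>

lemma gradient_field_regular:
  fixes p :: "real \<times> real \<Rightarrow> real" and G :: "real \<times> real \<Rightarrow> real \<times> real"
  assumes p: "\<And>z. z \<in> \<Omega> \<Longrightarrow> (p has_derivative (\<lambda>w. G z \<bullet> w)) (at z)"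
  shows "continuous_on (closure \<Omega>) p \<Longrightarrow> continuous_on (closure \<Omega>) G \<Longrightarrow> C1_on_closure \<Omega> p"
    and "C1_on \<Omega> G \<Longrightarrow> C2_on \<Omega> p"
    and "z \<in> \<Omega> \<Longrightarrow> grad p z = G z"
proof -
  have p': "(p has_derivative blinfun_apply (blinfun_inner_right (G z))) (at z)" if "z \<in> \<Omega>" for z
    using p[OF that] by simp
  show "C1_on_closure \<Omega> p" if "continuous_on (closure \<Omega>) p" "continuous_on (closure \<Omega>) G"
    unfolding C1_on_closure_def
    using p' that by (intro conjI exI[of _ "\<lambda>z. blinfun_inner_right (G z)"] ballI
        bounded_linear.continuous_on[OF bounded_linear_blinfun_inner_right]) auto
  show "C2_on \<Omega> p" if G: "C1_on \<Omega> G"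
  proof -
    obtain DG where DG: "\<forall>z\<in>\<Omega>. (G has_derivative blinfun_apply (DG z)) (at z)" and c: "continuous_on \<Omega> DG"
      using G unfolding C1_on_def by blast
    define L :: "(real \<times> real) \<Rightarrow>\<^sub>L ((real \<times> real) \<Rightarrow>\<^sub>L real)" where "L = Blinfun blinfun_inner_right"
    have L: "blinfun_apply L = blinfun_inner_right"
      unfolding L_def by (rule bounded_linear_Blinfun_apply[OF bounded_linear_blinfun_inner_right])
    have "((\<lambda>z. blinfun_inner_right (G z)) has_derivative blinfun_apply (L o\<^sub>L DG z)) (at z)" if "z \<in> \<Omega>" for z
    proof -
      have "((\<lambda>z. blinfun_inner_right (G z)) has_derivative (\<lambda>w. blinfun_inner_right (DG z w))) (at z)"
        by (rule bounded_linear.has_derivative[OF bounded_linear_blinfun_inner_right bspec[OF DG that]])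
      moreover have "blinfun_apply (L o\<^sub>L DG z) = (\<lambda>w. blinfun_inner_right (DG z w))"
        by (simp add: fun_eq_iff L)
      ultimately show ?thesis by (simp only:)
    qed
    moreover have "continuous_on \<Omega> (\<lambda>z. L o\<^sub>L DG z)"
      by (intro continuous_intros c)
    ultimately show ?thesis
      unfolding C2_on_def C1_on_def
      using p' by (intro exI[of _ "\<lambda>z. blinfun_inner_right (G z)"] conjI exI[of _ "\<lambda>z. L o\<^sub>L DG z"] ballI) auto
  qed
  show "grad p z = G z" if "z \<in> \<Omega>"
    unfolding grad_def frechet_derivative_at[OF p[OF that], symmetric]
    by (simp add: inner_prod_def)
qed

lemma box_in_open:
  fixes x0 y0 :: real
  assumes "open \<Omega>" "(x0, y0) \<in> \<Omega>"
  shows "\<exists>r>0. \<forall>x y. \<bar>x - x0\<bar> \<le> r \<longrightarrow> \<bar>y - y0\<bar> \<le> r \<longrightarrow> (x, y) \<in> \<Omega>"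
proof -
  obtain e where e: "e > 0" "ball (x0, y0) e \<subseteq> \<Omega>" using assms unfolding open_contains_ball by blast
  have "(x, y) \<in> \<Omega>" if "\<bar>x - x0\<bar> \<le> e / 3" "\<bar>y - y0\<bar> \<le> e / 3" for x y
  proof -
    have "dist (x0, y0) (x, y) \<le> \<bar>x0 - x\<bar> + \<bar>y0 - y\<bar>"
      unfolding dist_Pair_Pair dist_real_def using sqrt_sum_squares_le_sum_abs[of "x0 - x" "y0 - y"] by simp
    also have "\<dots> < e" using that e by linarith
    finally show ?thesis using e by auto
  qed
  then show ?thesis using e(1) by (intro exI[of _ "e / 3"]) simp
qed

text \<open>
  Differentiate
  \<open>p (x, y) - p (x0, y) = \<integral> \<partial>\<^sub>x p (\<xi>, y) d\<xi>\<close> first in \<open>y\<close> and then in \<open>x\<close>.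
\<close>

lemma gradient_derivative_symmetric:
  fixes p :: "real \<times> real \<Rightarrow> real" and G :: "real \<times> real \<Rightarrow> real \<times> real"
  assumes op: "open \<Omega>" and z: "z \<in> \<Omega>"
    and p: "\<And>z. z \<in> \<Omega> \<Longrightarrow> (p has_derivative (\<lambda>w. G z \<bullet> w)) (at z)"
    and DG: "\<And>z. z \<in> \<Omega> \<Longrightarrow> (G has_derivative blinfun_apply (DG z)) (at z)"
    and cDG: "continuous_on \<Omega> DG"
  shows "snd (DG z (1, 0)) = fst (DG z (0, 1))"
proof -
  obtain x0 y0 where z0: "z = (x0, y0)" by (cases z)
  obtain r where r: "r > 0" and "\<forall>x y. \<bar>x - x0\<bar> \<le> r \<longrightarrow> \<bar>y - y0\<bar> \<le> r \<longrightarrow> (x, y) \<in> \<Omega>"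
    using box_in_open[OF op z[unfolded z0]] by blast
  then have box: "\<And>x y. \<bar>x - x0\<bar> \<le> r \<Longrightarrow> \<bar>y - y0\<bar> \<le> r \<Longrightarrow> (x, y) \<in> \<Omega>"
    by blast
  have pairx: "((\<lambda>x. (x, y)) has_derivative (\<lambda>h. (h, 0))) (at x)"
    and pairy: "((\<lambda>y. (x, y)) has_derivative (\<lambda>h. (0, h))) (at y)" for x y :: real
    by (intro has_derivative_Pair has_derivative_ident has_derivative_const)+
  have px: "((\<lambda>x. p (x, y)) has_real_derivative fst (G (x, y))) (at x)"
    and py: "((\<lambda>y. p (x, y)) has_real_derivative snd (G (x, y))) (at y)" if "(x, y) \<in> \<Omega>" for x y
  proof -
    have "((\<lambda>x. p (x, y)) has_derivative (\<lambda>h. G (x, y) \<bullet> (h, 0))) (at x)"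
      using has_derivative_compose[OF pairx p[OF that]] .
    then show "((\<lambda>x. p (x, y)) has_real_derivative fst (G (x, y))) (at x)"
      by (rule has_derivative_imp_has_field_derivative) (simp add: inner_prod_def)
    have "((\<lambda>y. p (x, y)) has_derivative (\<lambda>h. G (x, y) \<bullet> (0, h))) (at y)"
      using has_derivative_compose[OF pairy p[OF that]] .
    then show "((\<lambda>y. p (x, y)) has_real_derivative snd (G (x, y))) (at y)"
      by (rule has_derivative_imp_has_field_derivative) (simp add: inner_prod_def)
  qed
  have Gx: "((\<lambda>x. G (x, y)) has_vector_derivative DG (x, y) (1, 0)) (at x)"
    and Gy: "((\<lambda>y. G (x, y)) has_vector_derivative DG (x, y) (0, 1)) (at y)" if "(x, y) \<in> \<Omega>" for x y
  proof -
    have d: "((\<lambda>x. G (x, y)) has_derivative (\<lambda>h. DG (x, y) (h, 0))) (at x)"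
      using has_derivative_compose[OF pairx DG[OF that]] .
    have eq: "DG (x, y) (h, 0) = h *\<^sub>R DG (x, y) (1, 0)" for h
      using blinfun.scaleR_right[of "DG (x, y)" h "(1, 0)"] by simp
    show "((\<lambda>x. G (x, y)) has_vector_derivative DG (x, y) (1, 0)) (at x)"
      unfolding has_vector_derivative_def by (rule has_derivative_eq_rhs[OF d]) (rule ext, rule eq)
    have d: "((\<lambda>y. G (x, y)) has_derivative (\<lambda>h. DG (x, y) (0, h))) (at y)"
      using has_derivative_compose[OF pairy DG[OF that]] .
    have eq: "DG (x, y) (0, h) = h *\<^sub>R DG (x, y) (0, 1)" for h
      using blinfun.scaleR_right[of "DG (x, y)" h "(0, 1)"] by simp
    show "((\<lambda>y. G (x, y)) has_vector_derivative DG (x, y) (0, 1)) (at y)"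
      unfolding has_vector_derivative_def by (rule has_derivative_eq_rhs[OF d]) (rule ext, rule eq)
  qed
  have cG: "continuous_on \<Omega> G"
    by (intro continuous_at_imp_continuous_on ballI has_derivative_continuous[OF DG])
  let ?A = "\<lambda>x. integral {x0..x} (\<lambda>\<xi>. fst (DG (\<xi>, y0) (0, 1)))"
  \<comment> \<open>The integral starts at x0, so only x >= x0 occurs. A one-sided derivative at x0
    is sufficient at the end, because derivatives within a nondegenerate closed interval are
    unique.\<close>
  have key: "snd (G (x, y0)) - snd (G (x0, y0)) = ?A x" if x: "x \<in> {x0..x0 + r}" for x
  proof -
    have in\<Omega>: "(\<xi>, y) \<in> \<Omega>" if "\<xi> \<in> {x0..x}" "y \<in> ball y0 r" for \<xi> y
      using that x by (intro box) (auto simp: dist_real_def)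
    have cont1: "continuous_on {x0..x} (\<lambda>\<xi>. fst (G (\<xi>, y)))" if "y \<in> ball y0 r" for y
    proof (intro continuous_on_fst continuous_on_compose2[OF cG] continuous_intros image_subsetI)
      show "(\<xi>, y) \<in> \<Omega>" if "\<xi> \<in> {x0..x}" for \<xi> by (rule in\<Omega>[OF that \<open>y \<in> ball y0 r\<close>])
    qed
    have I: "integral {x0..x} (\<lambda>\<xi>. fst (G (\<xi>, y))) = p (x, y) - p (x0, y)" if y: "y \<in> ball y0 r" for y
    proof (rule integral_unique, rule fundamental_theorem_of_calculus)
      fix \<xi> assume "\<xi> \<in> {x0..x}"
      from px[OF in\<Omega>[OF this y]]
      show "((\<lambda>x. p (x, y)) has_vector_derivative fst (G (\<xi>, y))) (at \<xi> within {x0..x})"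
        unfolding has_real_derivative_iff_has_vector_derivative by (rule has_vector_derivative_at_within)
    qed (use x in auto)
    have "((\<lambda>y. integral (cbox x0 x) (\<lambda>\<xi>. fst (G (\<xi>, y)))) has_vector_derivative
        integral (cbox x0 x) (\<lambda>\<xi>. fst (DG (\<xi>, y0) (0, 1)))) (at y0 within ball y0 r)"
    proof (rule leibniz_rule_vector_derivative[where fx = "\<lambda>y \<xi>. fst (DG (\<xi>, y) (0, 1))"])
      fix y \<xi> assume "y \<in> ball y0 r" "\<xi> \<in> cbox x0 x"
      then have "(\<xi>, y) \<in> \<Omega>" using in\<Omega> by simp
      from bounded_linear.has_vector_derivative[OF bounded_linear_fst Gy[OF this]]
      show "((\<lambda>y. fst (G (\<xi>, y))) has_vector_derivative fst (DG (\<xi>, y) (0, 1))) (at y within ball y0 r)"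
        by (rule has_vector_derivative_at_within)
    next
      fix y assume "y \<in> ball y0 r"
      then show "(\<lambda>\<xi>. fst (G (\<xi>, y))) integrable_on cbox x0 x"
        using integrable_continuous_real[OF cont1] by simp
    next
      have "continuous_on (ball y0 r \<times> cbox x0 x) (\<lambda>q. DG (snd q, fst q))"
      proof (intro continuous_on_compose2[OF cDG] continuous_intros image_subsetI)
        show "(snd q, fst q) \<in> \<Omega>" if "q \<in> ball y0 r \<times> cbox x0 x" for q
          using that by (intro in\<Omega>) auto
      qed
      then show "continuous_on (ball y0 r \<times> cbox x0 x) (\<lambda>(y, \<xi>). fst (DG (\<xi>, y) (0, 1)))"
        unfolding split_beta by (intro continuous_intros)
    qed (use r in auto)
    then have "((\<lambda>y. integral {x0..x} (\<lambda>\<xi>. fst (G (\<xi>, y)))) has_vector_derivative ?A x) (at y0)"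
      using r at_within_open[of y0 "ball y0 r"] by simp
    then have 1: "((\<lambda>y. p (x, y) - p (x0, y)) has_vector_derivative ?A x) (at y0)"
      by (rule has_vector_derivative_transform_within_open[of _ _ _ "ball y0 r"]) (simp_all add: r I del: mem_ball)
    have "((\<lambda>y. p (x, y) - p (x0, y)) has_real_derivative snd (G (x, y0)) - snd (G (x0, y0))) (at y0)"
      using x r by (intro DERIV_diff py box) auto
    then have 2: "((\<lambda>y. p (x, y) - p (x0, y)) has_vector_derivative snd (G (x, y0)) - snd (G (x0, y0))) (at y0)"
      by (simp add: has_real_derivative_iff_has_vector_derivative)
    show ?thesis by (rule vector_derivative_unique_at[OF 2 1])
  qed
  have "continuous_on {x0..x0 + r} (\<lambda>\<xi>. DG (\<xi>, y0))"
  proof (intro continuous_on_compose2[OF cDG] continuous_intros image_subsetI)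
    show "(\<xi>, y0) \<in> \<Omega>" if "\<xi> \<in> {x0..x0 + r}" for \<xi> using that r by (intro box) auto
  qed
  then have "continuous_on {x0..x0 + r} (\<lambda>\<xi>. fst (DG (\<xi>, y0) (0, 1)))"
    by (intro continuous_intros)
  then have "(?A has_vector_derivative fst (DG (x0, y0) (0, 1))) (at x0 within {x0..x0 + r})"
    using r by (intro integral_has_vector_derivative) auto
  then have "((\<lambda>x. snd (G (x, y0)) - snd (G (x0, y0))) has_vector_derivative fst (DG (x0, y0) (0, 1))) (at x0 within {x0..x0 + r})"
    by (rule has_vector_derivative_transform[rotated -1]) (use r key in auto)
  moreover have "((\<lambda>x. snd (G (x, y0)) - snd (G (x0, y0))) has_vector_derivative snd (DG (x0, y0) (1, 0)) - 0) (at x0 within {x0..x0 + r})"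
    by (rule has_vector_derivative_at_within[OF has_vector_derivative_diff[OF
          bounded_linear.has_vector_derivative[OF bounded_linear_snd Gx[OF z[unfolded z0]]] has_vector_derivative_const]])
  ultimately have "snd (DG (x0, y0) (1, 0)) - 0 = fst (DG (x0, y0) (0, 1))"
    using r by (intro vector_derivative_unique_within_closed_interval[of x0 "x0 + r" x0]) auto
  then show ?thesis by (simp add: z0)
qed

section \<open>Passage between plane vector fields and complex velocities\<close>

definition vel :: "(complex \<Rightarrow> complex) \<Rightarrow> real \<times> real \<Rightarrow> real \<times> real" where
  "vel F z = (Re (F (Complex (fst z) (snd z))), - Im (F (Complex (fst z) (snd z))))"

lemma bounded_linear_Complex: "bounded_linear (\<lambda>w. Complex (fst w) (snd w))"
  unfolding Complex_eq
  by (intro bounded_linear_add bounded_linear_const_mult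
      bounded_linear_compose[OF bounded_linear_of_real bounded_linear_fst]
      bounded_linear_compose[OF bounded_linear_of_real bounded_linear_snd])

lemma bounded_linear_vel_deriv:
  "bounded_linear (\<lambda>w. (Re (c * Complex (fst w) (snd w)), - Im (c * Complex (fst w) (snd w))))"
proof -
  have 1: "bounded_linear (\<lambda>w. c * Complex (fst w) (snd w))"
    by (rule bounded_linear_const_mult[OF bounded_linear_Complex])
  show ?thesis
    by (intro bounded_linear_Pair bounded_linear_minus bounded_linear_compose[OF bounded_linear_Re 1]
        bounded_linear_compose[OF bounded_linear_Im 1])
qed

text \<open>With c = F' the field has the x-derivative of its first component equal to Re c and the
  y-derivative of its second equal to - Im (i c) = - Re c, so the divergence cancels.\<close>

lemma holomorphic_velocity:
  assumes hol: "F holomorphic_on D" and op: "open D"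
  defines "\<Omega> \<equiv> {z. Complex (fst z) (snd z) \<in> D}"
  shows "C1_on \<Omega> (vel F)" and "z \<in> \<Omega> \<Longrightarrow> divergence (vel F) z = 0"
proof -
  let ?cx = "\<lambda>z. Complex (fst z) (snd z)"
  let ?L = "\<lambda>c w. (Re (c * ?cx w), - Im (c * ?cx w))"
  have d: "(vel F has_derivative ?L (deriv F (?cx z))) (at z)" if "z \<in> \<Omega>" for z
  proof -
    have "(F has_derivative (\<lambda>h. deriv F (?cx z) * h)) (at (?cx z))"
      using holomorphic_derivI[OF hol op] that by (simp add: \<Omega>_def has_field_derivative_def)
    from has_derivative_compose[OF bounded_linear_imp_has_derivative[OF bounded_linear_Complex] this]
    have "((\<lambda>z. F (?cx z)) has_derivative (\<lambda>w. deriv F (?cx z) * ?cx w)) (at z)" .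
    then show ?thesis unfolding vel_def[abs_def]
      by (intro has_derivative_Pair has_derivative_minus has_derivative_Re has_derivative_Im)
  qed
  have B: "blinfun_apply (Blinfun (?L c)) = ?L c" for c
    by (rule bounded_linear_Blinfun_apply[OF bounded_linear_vel_deriv])
  have "continuous_on D (deriv F)"
    using hol op by (intro holomorphic_on_imp_continuous_on holomorphic_deriv)
  then have cd: "continuous_on \<Omega> (\<lambda>z. deriv F (?cx z))"
    by (rule continuous_on_compose2) (auto intro!: continuous_intros simp: \<Omega>_def)
  have "continuous_on \<Omega> (\<lambda>z. Blinfun (?L (deriv F (?cx z))))"
  proof (rule continuous_on_blinfun_componentwise)
    show "continuous_on \<Omega> (\<lambda>z. Blinfun (?L (deriv F (?cx z))) i)" for i
      unfolding B by (intro continuous_intros cd)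
  qed
  then show "C1_on \<Omega> (vel F)"
    unfolding C1_on_def using d
    by (intro exI[of _ "\<lambda>z. Blinfun (?L (deriv F (?cx z)))"] conjI ballI) (simp_all only: B)
  show "divergence (vel F) z = 0" if "z \<in> \<Omega>"
    unfolding divergence_def frechet_derivative_at[OF d[OF that], symmetric] by simp
qed

text \<open>The Cauchy-Riemann equations are incompressibility and the symmetry of the second derivatives of the potential.\<close>

lemma velocity_holomorphic:
  fixes p :: "real \<times> real \<Rightarrow> real" and v :: "real \<times> real \<Rightarrow> real \<times> real"
  assumes op: "open \<Omega>"
    and p: "\<And>z. z \<in> \<Omega> \<Longrightarrow> (p has_derivative (\<lambda>w. v z \<bullet> w)) (at z)"
    and v: "C1_on \<Omega> v" and div: "\<And>z. z \<in> \<Omega> \<Longrightarrow> divergence v z = 0"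
  shows "(\<lambda>z. Complex (fst (v (Re z, Im z))) (- snd (v (Re z, Im z)))) holomorphic_on {z. (Re z, Im z) \<in> \<Omega>}"
proof -
  obtain Dv where Dv: "\<And>z. z \<in> \<Omega> \<Longrightarrow> (v has_derivative blinfun_apply (Dv z)) (at z)" and c: "continuous_on \<Omega> Dv"
    using v unfolding C1_on_def by blast
  show ?thesis
    unfolding holomorphic_on_def
  proof
    fix z assume "z \<in> {z. (Re z, Im z) \<in> \<Omega>}"
    then have z: "(Re z, Im z) \<in> \<Omega>" by simp
    let ?D = "Dv (Re z, Im z)"
    \<comment> \<open>The Jacobian of v is symmetric with trace 0, with rows (a, b) and (b, -a). For
      v^1 - i v^2 this is multiplication by a - i b.\<close>
    define a b where "a = fst (?D (1, 0))" and "b = fst (?D (0, 1))"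
    have sym: "snd (?D (1, 0)) = b"
      unfolding b_def by (rule gradient_derivative_symmetric[OF op z p Dv c])
    have "a + snd (?D (0, 1)) = 0"
      using div[OF z] unfolding divergence_def frechet_derivative_at[OF Dv[OF z], symmetric] a_def .
    then have dv: "snd (?D (0, 1)) = - a" by simp
    have D: "?D w = (a * fst w + b * snd w, b * fst w - a * snd w)" for w
    proof -
      have "?D w = ?D (fst w *\<^sub>R (1, 0) + snd w *\<^sub>R (0, 1))" by (cases w) simp
      also have "\<dots> = fst w *\<^sub>R ?D (1, 0) + snd w *\<^sub>R ?D (0, 1)"
        by (simp only: blinfun.add_right blinfun.scaleR_right)
      also have "\<dots> = fst w *\<^sub>R (a, b) + snd w *\<^sub>R (b, - a)"
      proof -
        have e: "?D (1, 0) = (a, b)" "?D (0, 1) = (b, - a)"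
          using sym dv by (simp_all add: a_def b_def prod_eq_iff)
        show ?thesis unfolding e ..
      qed
      finally show ?thesis by (simp add: mult.commute)
    qed
    have "((\<lambda>z. (Re z, Im z)) has_derivative (\<lambda>w. (Re w, Im w))) (at z)"
      by (auto intro!: derivative_eq_intros)
    from has_derivative_compose[OF this Dv[OF z]]
    have v': "((\<lambda>z. v (Re z, Im z)) has_derivative (\<lambda>w. ?D (Re w, Im w))) (at z)" .
    have "((\<lambda>z. of_real (fst (v (Re z, Im z))) + \<i> * of_real (- snd (v (Re z, Im z)))) has_derivative
        (\<lambda>w. of_real (fst (?D (Re w, Im w))) + \<i> * of_real (- snd (?D (Re w, Im w))))) (at z)"
      by (intro has_derivative_add has_derivative_mult_right has_derivative_of_real has_derivative_minus
          has_derivative_fst has_derivative_snd v')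
    moreover have "of_real (fst (?D (Re w, Im w))) + \<i> * of_real (- snd (?D (Re w, Im w))) = Complex a (- b) * w" for w
      by (simp add: D complex_eq_iff)
    ultimately have "((\<lambda>z. Complex (fst (v (Re z, Im z))) (- snd (v (Re z, Im z)))) has_field_derivative Complex a (- b)) (at z)"
      by (simp add: has_field_derivative_def Complex_eq)
    then have "(\<lambda>z. Complex (fst (v (Re z, Im z))) (- snd (v (Re z, Im z)))) field_differentiable (at z)"
      unfolding field_differentiable_def by blast
    then show "(\<lambda>z. Complex (fst (v (Re z, Im z))) (- snd (v (Re z, Im z)))) field_differentiable (at z within {z. (Re z, Im z) \<in> \<Omega>})"
      by (rule field_differentiable_at_within)
  qed
qed

section \<open>The bulk equations on one side of the graph\<close>

context periodic_graph
begin

text \<open>The two sides of the graph are treated together: \<open>\<sigma> = 1\<close> is above, \<open>\<sigma> = -1\<close> below.\<close>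

definition side :: "real \<Rightarrow> complex set" where
  "side \<sigma> = {z. \<sigma> * (Im z - h (Re z)) > 0}"

definition region :: "real \<Rightarrow> (real \<times> real) set" where
  "region \<sigma> = {z. \<sigma> * (snd z - h (fst z)) > 0}"

lemma Omega_eq_region: "Omega_plus h = region 1" "Omega_minus h = region (-1)"
  by (auto simp: Omega_plus_def Omega_minus_def region_def)

lemma region_eq_side: "region \<sigma> = {z. Complex (fst z) (snd z) \<in> side \<sigma>}"
  by (simp add: region_def side_def)

lemma open_side: "open (side \<sigma>)"
  unfolding side_def by (intro open_Collect_less continuous_intros)

lemma open_region: "open (region \<sigma>)"
  unfolding region_def by (intro open_Collect_less continuous_intros)

lemma side_off_graph: "z \<in> side \<sigma> \<Longrightarrow> Im z \<noteq> h (Re z)"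
  by (auto simp: side_def)

lemma side_periodic: "z \<in> side \<sigma> \<Longrightarrow> z + 2 * of_real pi \<in> side \<sigma>"
  by (simp add: side_def h_periodic)

text \<open>Graph points are limits of their vertical shifts into the region. Hence regularity on
  the closure includes the points (x, h x) at which the interface conditions are imposed.\<close>

lemma closure_region:
  assumes \<sigma>: "\<sigma> = 1 \<or> \<sigma> = -1"
  shows "closure (region \<sigma>) = {z. \<sigma> * (snd z - h (fst z)) \<ge> 0}"
proof (rule antisym)
  have "closed {z. \<sigma> * (snd z - h (fst z)) \<ge> 0}"
    by (intro closed_Collect_le continuous_intros)
  then show "closure (region \<sigma>) \<subseteq> {z. \<sigma> * (snd z - h (fst z)) \<ge> 0}"
    by (rule closure_minimal[rotated]) (auto simp: region_def)
  show "{z. \<sigma> * (snd z - h (fst z)) \<ge> 0} \<subseteq> closure (region \<sigma>)"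
  proof
    fix z assume z: "z \<in> {z. \<sigma> * (snd z - h (fst z)) \<ge> 0}"
    let ?u = "\<lambda>n::nat. (fst z, snd z + \<sigma> * inverse (of_nat (Suc n)))"
    have "\<sigma> * (snd z + \<sigma> * e - h (fst z)) > 0" if "e > 0" for e :: real
      using z \<sigma> that by auto
    then have "?u n \<in> region \<sigma>" for n by (simp add: region_def)
    moreover have "?u \<longlonglongrightarrow> (fst z, snd z + \<sigma> * 0)"
      by (intro tendsto_intros LIMSEQ_inverse_real_of_nat)
    ultimately show "z \<in> closure (region \<sigma>)"
      unfolding closure_sequential by (intro exI[of _ ?u]) simp
  qed
qed

text \<open>Take the limit of the fundamental theorem of calculus along vertical shifts of the graph.\<close>

lemma has_integral_gradient_along_graph:
  fixes p :: "real \<times> real \<Rightarrow> real" and G :: "real \<times> real \<Rightarrow> real \<times> real"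
  assumes \<sigma>: "\<sigma> = 1 \<or> \<sigma> = -1" and ab: "a \<le> b"
    and p: "\<And>z. z \<in> region \<sigma> \<Longrightarrow> (p has_derivative (\<lambda>w. G z \<bullet> w)) (at z)"
    and cp: "continuous_on (closure (region \<sigma>)) p" and cG: "continuous_on (closure (region \<sigma>)) G"
  shows "((\<lambda>s. G (s, h s) \<bullet> (1, h' s)) has_integral p (b, h b) - p (a, h a)) {a..b}"
proof -
  let ?z = "\<lambda>\<eta> s. (s, h s + \<sigma> * \<eta>)"
  let ?I = "\<lambda>\<eta>. integral (cbox a b) (\<lambda>s. G (?z \<eta> s) \<bullet> (1, h' s))"
  let ?L = "\<lambda>\<eta>. p (?z \<eta> b) - p (?z \<eta> a)"
  have \<sigma>2: "\<sigma> * (\<sigma> * \<eta>) = \<eta>" for \<eta> using \<sigma> by auto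
  have cl: "?z \<eta> s \<in> closure (region \<sigma>)" if "\<eta> \<ge> 0" for \<eta> s
    using that by (simp add: closure_region[OF \<sigma>] \<sigma>2)
  have cI: "continuous_on {0..1} ?I"
  proof (rule integral_continuous_on_param)
    have "continuous_on ({0..1} \<times> cbox a b) (\<lambda>q. G (?z (fst q) (snd q)))"
      by (intro continuous_on_compose2[OF cG] continuous_intros) (auto intro!: cl)
    then show "continuous_on ({0..1} \<times> cbox a b) (\<lambda>(\<eta>, s). G (?z \<eta> s) \<bullet> (1, h' s))"
      unfolding split_beta by (intro continuous_intros)
  qed
  have cL: "continuous_on {0..1} ?L"
    by (intro continuous_intros continuous_on_compose2[OF cp]) (auto intro!: cl)
  have eq: "?I \<eta> = ?L \<eta>" if \<eta>: "\<eta> > 0" for \<eta>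
  proof -
    have "((\<lambda>s. G (?z \<eta> s) \<bullet> (1, h' s)) has_integral ?L \<eta>) {a..b}"
    proof (rule fundamental_theorem_of_calculus[OF ab])
      fix s
      have z: "?z \<eta> s \<in> region \<sigma>" using \<eta> by (simp add: region_def \<sigma>2)
      have "(h has_derivative (\<lambda>t. t * h' s)) (at s)"
        using h_deriv[of s] by (simp add: has_field_derivative_def mult_commute_abs)
      then have "(?z \<eta> has_derivative (\<lambda>t. (t, t * h' s + 0))) (at s)"
        by (intro has_derivative_Pair has_derivative_add has_derivative_ident has_derivative_const)
      from has_derivative_compose[OF this p[OF z]]
      have "((\<lambda>s. p (?z \<eta> s)) has_derivative (\<lambda>t. G (?z \<eta> s) \<bullet> (t, t * h' s + 0))) (at s)" .
      moreover have "G (?z \<eta> s) \<bullet> (t, t * h' s + 0) = t *\<^sub>R (G (?z \<eta> s) \<bullet> (1, h' s))" for t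
        by (simp add: inner_prod_def algebra_simps)
      ultimately have "((\<lambda>s. p (?z \<eta> s)) has_vector_derivative G (?z \<eta> s) \<bullet> (1, h' s)) (at s)"
        by (simp add: has_vector_derivative_def)
      then show "((\<lambda>s. p (?z \<eta> s)) has_vector_derivative G (?z \<eta> s) \<bullet> (1, h' s)) (at s within {a..b})"
        by (rule has_vector_derivative_at_within)
    qed
    then show ?thesis by (simp add: integral_unique)
  qed
  have u: "(\<lambda>n. inverse (of_nat (Suc n)) :: real) \<longlonglongrightarrow> 0" by (rule LIMSEQ_inverse_real_of_nat)
  have u01: "inverse (of_nat (Suc n)) \<in> {0..1::real}" for n by (simp add: field_simps)
  have limI: "(\<lambda>n. ?I (inverse (of_nat (Suc n)))) \<longlonglongrightarrow> ?I 0"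
    by (rule continuous_on_tendsto_compose[OF cI u]) (use u01 in auto)
  have limL: "(\<lambda>n. ?L (inverse (of_nat (Suc n)))) \<longlonglongrightarrow> ?L 0"
    by (rule continuous_on_tendsto_compose[OF cL u]) (use u01 in auto)
  have "?I (inverse (of_nat (Suc n))) = ?L (inverse (of_nat (Suc n)))" for n
    by (rule eq) simp
  then have "(\<lambda>n. ?I (inverse (of_nat (Suc n)))) = (\<lambda>n. ?L (inverse (of_nat (Suc n))))"
    by (rule ext)
  from LIMSEQ_unique[OF limI[unfolded this] limL] have "?I 0 = ?L 0" .
  moreover have "(\<lambda>s. G (s, h s) \<bullet> (1, h' s)) integrable_on {a..b}"
    by (intro integrable_continuous_real continuous_intros continuous_on_compose2[OF cG])
      (use cl[of 0] in auto)
  ultimately show ?thesis by (simp add: has_integral_iff)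
qed

text \<open>The vertical shear by h maps a half plane homeomorphically onto the side. Simple
  connectedness supplies a global primitive of the complex velocity.\<close>

lemma simply_connected_side:
  assumes \<sigma>: "\<sigma> = 1 \<or> \<sigma> = -1"
  shows "simply_connected (side \<sigma>)"
proof -
  let ?H = "{z. \<sigma> * Im z > 0}"
  let ?f = "\<lambda>z. z + \<i> * of_real (h (Re z))" and ?g = "\<lambda>z. z - \<i> * of_real (h (Re z))"
  have "convex ?H"
    using \<sigma> convex_halfspace_Im_gt[of 0] convex_halfspace_Im_lt[of 0] by (auto simp: zero_less_mult_iff)
  then have sc: "simply_connected ?H" by (rule convex_imp_simply_connected)
  have fg: "?f (?g z) = z" "?g (?f z) = z" for z by simp_all
  have "?H homeomorphic side \<sigma>"
  proof (rule homeomorphicI[of ?f _ _ ?g])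
    have 1: "?f z \<in> side \<sigma>" if "z \<in> ?H" for z using that by (simp add: side_def)
    have 2: "?g z \<in> ?H" if "z \<in> side \<sigma>" for z using that by (simp add: side_def)
    show "?f ` ?H = side \<sigma>"
    proof (intro antisym image_subsetI subsetI)
      show "z \<in> ?f ` ?H" if "z \<in> side \<sigma>" for z
        by (rule image_eqI[of _ _ "?g z"]) (use 2[OF that] fg in simp_all)
    qed (rule 1)
    show "?g ` side \<sigma> = ?H"
    proof (intro antisym image_subsetI subsetI)
      show "z \<in> ?g ` side \<sigma>" if "z \<in> ?H" for z
        by (rule image_eqI[of _ _ "?f z"]) (use 1[OF that] fg in simp_all)
    qed (rule 2)
    show "continuous_on ?H ?f" "continuous_on (side \<sigma>) ?g" by (intro continuous_intros)+
  qed (simp_all add: fg)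
  then show ?thesis using sc homeomorphic_simply_connected by blast
qed

text \<open>The potential is the real part of a primitive \<open>Q0\<close> of F, because Re (F dz)
  is the inner product of \<open>vel F\<close> with the displacement. It remains to continue it to
  the graph and to see that it is periodic.\<close>

lemma velocity_potential:
  assumes \<sigma>: "\<sigma> = 1 \<or> \<sigma> = -1"
    and cont: "continuous_on UNIV F" and hol: "F holomorphic_on side \<sigma>"
    and per: "\<And>z. z \<in> side \<sigma> \<Longrightarrow> F (z + 2 * of_real pi) = F z"
    and decay: "\<And>\<epsilon>. \<epsilon> > 0 \<Longrightarrow> \<exists>R. \<forall>z\<in>side \<sigma>. \<bar>Im z\<bar> > R \<longrightarrow> norm (F z) < \<epsilon>"
  shows "\<exists>q :: real \<times> real \<Rightarrow> real. continuous_on UNIV q \<and>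
    (\<forall>z\<in>region \<sigma>. (q has_derivative (\<lambda>w. vel F z \<bullet> w)) (at z)) \<and>
    (\<forall>x y. (x, y) \<in> region \<sigma> \<longrightarrow> q (x + 2 * pi, y) = q (x, y))"
proof -
  have conn: "connected (side \<sigma>)" by (rule simply_connected_imp_connected[OF simply_connected_side[OF \<sigma>]])
  obtain Q0 where Q0: "\<And>z. z \<in> side \<sigma> \<Longrightarrow> (Q0 has_field_derivative F z) (at z)"
    using simply_connected_side[OF \<sigma>] hol unfolding simply_connected_eq_global_primitive[OF open_side] by blast
  have cQ0: "continuous_on (side \<sigma>) Q0"
    by (intro continuous_at_imp_continuous_on ballI DERIV_isCont[OF Q0])
  define top where "top z = Complex (Re z) (h (Re z) + \<sigma>)" for z
  have \<sigma>2: "\<sigma> * \<sigma> = 1" using \<sigma> by auto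
  have top: "top z \<in> side \<sigma>" for z by (simp add: top_def side_def \<sigma>2)
  \<comment> \<open>\<open>Q0\<close> is only controlled inside the side. Going to the point
    \<open>top z\<close> at unit height from the graph and integrating F back along the vertical
    segment uses only the continuity of F, so \<open>Q\<close> is continuous on the graph as
    well.\<close>
  define Q where "Q z = Q0 (top z) - integral {0..1} (\<lambda>\<tau>. F (linepath z (top z) \<tau>) * (top z - z))" for z
  have ctop: "continuous_on UNIV top" unfolding top_def by (intro continuous_intros)
  have cQ: "continuous_on UNIV Q"
  proof -
    have "continuous_on UNIV (\<lambda>z. integral (cbox 0 1) (\<lambda>\<tau>. F (linepath z (top z) \<tau>) * (top z - z)))"
    proof (rule integral_continuous_on_param)
      have ct: "continuous_on A (\<lambda>q. top (fst q))" for A :: "(complex \<times> real) set"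
        by (rule continuous_on_compose2[OF ctop]) (auto intro: continuous_intros)
      have "continuous_on (UNIV \<times> cbox 0 1) (\<lambda>q. F (linepath (fst q) (top (fst q)) (snd q)))"
        unfolding linepath_def by (rule continuous_on_compose2[OF cont]) (auto intro!: continuous_intros ct)
      then show "continuous_on (UNIV \<times> cbox 0 1) (\<lambda>(z, \<tau>). F (linepath z (top z) \<tau>) * (top z - z))"
        unfolding split_beta by (intro continuous_intros ct)
    qed
    moreover have "continuous_on UNIV (\<lambda>z. Q0 (top z))"
      by (rule continuous_on_compose2[OF cQ0 ctop]) (use top in auto)
    ultimately show ?thesis unfolding Q_def[abs_def] by (intro continuous_on_diff) simp_all
  qed
  have Q_eq: "Q z = Q0 z" if z: "z \<in> side \<sigma>" for z
  proof -
    have "path_image (linepath z (top z)) \<subseteq> side \<sigma>"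
    proof (clarsimp simp: path_image_def linepath_def)
      fix \<tau> :: real assume \<tau>: "0 \<le> \<tau>" "\<tau> \<le> 1"
      let ?w = "(1 - \<tau>) *\<^sub>R z + \<tau> *\<^sub>R top z"
      have Re: "Re ?w = Re z" by (simp add: top_def algebra_simps)
      have "\<sigma> * (Im ?w - h (Re ?w)) = (1 - \<tau>) * (\<sigma> * (Im z - h (Re z))) + \<tau> * (\<sigma> * \<sigma>)"
        unfolding Re by (simp add: top_def algebra_simps)
      also have "\<dots> > 0"
      proof (cases "\<tau> = 1")
        case False
        then have "(1 - \<tau>) * (\<sigma> * (Im z - h (Re z))) > 0"
          using z[unfolded side_def mem_Collect_eq] \<tau> by (rule_tac mult_pos_pos) simp_all
        then show ?thesis using \<tau> by (simp add: \<sigma>2)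
      qed (simp add: \<sigma>2)
      finally show "?w \<in> side \<sigma>" by (simp add: side_def)
    qed
    from contour_integral_primitive[OF has_field_derivative_at_within[OF Q0] valid_path_linepath this]
    have "((\<lambda>\<tau>. F (linepath z (top z) \<tau>) * (top z - z)) has_integral Q0 (top z) - Q0 z) {0..1}"
      by (simp add: has_contour_integral_linepath)
    from integral_unique[OF this] show ?thesis by (simp only: Q_def) simp
  qed
  have Q_per: "Q0 (z + 2 * of_real pi) = Q0 z" if z: "z \<in> side \<sigma>" for z
  proof -
    have d: "((\<lambda>z. Q0 (z + 2 * of_real pi) - Q0 z) has_field_derivative 0) (at z)" if "z \<in> side \<sigma>" for z
    proof -
      have "((\<lambda>z. Q0 (z + 2 * of_real pi)) has_field_derivative F (z + 2 * of_real pi)) (at z)"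
        using Q0[OF side_periodic[OF that]] by (simp only: DERIV_shift)
      from DERIV_diff[OF this Q0[OF that]] show ?thesis by (simp add: per[OF that])
    qed
    have cd: "continuous_on (side \<sigma>) (\<lambda>z. Q0 (z + 2 * of_real pi) - Q0 z)"
      by (intro continuous_at_imp_continuous_on ballI DERIV_isCont[OF d])
    obtain c where c: "\<And>z. z \<in> side \<sigma> \<Longrightarrow> Q0 (z + 2 * of_real pi) - Q0 z = c"
      using DERIV_zero_connected_constant[OF conn open_side finite.emptyI cd] d by auto
    \<comment> \<open>The increment c over a period is the same everywhere, hence may be measured
      far from the graph, where \<bar>F\<bar> < e / (2 pi). The half plane \<open>S\<close> is
      convex, so the mean value bound applies to a horizontal segment of length 2 pi.\<close>
    have "norm c \<le> 0 + e" if e: "e > 0" for e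
    proof -
      obtain R where R: "\<And>z. z \<in> side \<sigma> \<Longrightarrow> \<bar>Im z\<bar> > R \<Longrightarrow> norm (F z) < e / (2 * pi)"
        using decay[of "e / (2 * pi)"] e by auto
      obtain B where B: "B \<ge> 0" "\<And>x. \<bar>h x\<bar> \<le> B" using h_bounded by blast
      define S where "S = {z. \<sigma> * Im z > \<bar>R\<bar> + B}"
      have S: "z \<in> side \<sigma>" "\<bar>Im z\<bar> > R" if "z \<in> S" for z
        using that \<sigma> B(2)[of "Re z"] by (auto simp: S_def side_def)
      have "convex S"
      proof (cases "\<sigma> = 1")
        case True
        then have "S = {z. Im z > \<bar>R\<bar> + B}" by (auto simp: S_def)
        then show ?thesis using convex_halfspace_Im_gt by simp
      next
        case False
        then have "S = {z. Im z < - (\<bar>R\<bar> + B)}" using \<sigma> by (auto simp: S_def)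
        then show ?thesis using convex_halfspace_Im_lt by simp
      qed
      define z0 where "z0 = Complex 0 (\<sigma> * (\<bar>R\<bar> + B + 1))"
      have z0: "z0 \<in> S" "z0 + 2 * of_real pi \<in> S" using \<sigma> by (auto simp: z0_def S_def)
      have "norm (Q0 (z0 + 2 * of_real pi) - Q0 z0) \<le> e / (2 * pi) * norm (z0 + 2 * of_real pi - z0)"
      proof (rule field_differentiable_bound[OF \<open>convex S\<close>, where f' = F])
        fix z assume "z \<in> S"
        then show "(Q0 has_field_derivative F z) (at z within S)" "norm (F z) \<le> e / (2 * pi)"
          using has_field_derivative_at_within[OF Q0[OF S(1)]] R[OF S] by (auto intro: less_imp_le)
      qed (use z0 in auto)
      then show ?thesis using c[OF S(1)[OF z0(1)]] by (simp add: norm_mult)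
    qed
    then have "norm c \<le> 0" by (rule field_le_epsilon)
    then show ?thesis using c[OF z] by simp
  qed
  define q where "q z = Re (Q (Complex (fst z) (snd z)))" for z :: "real \<times> real"
  show ?thesis
  proof (intro exI[of _ q] conjI ballI allI impI)
    show "continuous_on UNIV q"
      unfolding q_def by (intro continuous_intros continuous_on_compose2[OF cQ]) auto
    fix z assume z: "z \<in> region \<sigma>"
    have "((\<lambda>z. Re (Q0 (Complex (fst z) (snd z)))) has_derivative (\<lambda>w. vel F z \<bullet> w)) (at z)"
    proof -
      have "(Q0 has_derivative (\<lambda>h. F (Complex (fst z) (snd z)) * h)) (at (Complex (fst z) (snd z)))"
        using Q0[of "Complex (fst z) (snd z)"] z by (simp add: region_eq_side has_field_derivative_def)
      from has_derivative_Re[OF has_derivative_compose[OF bounded_linear_imp_has_derivative[OF bounded_linear_Complex] this]]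
      show ?thesis
        by (rule has_derivative_eq_rhs) (simp add: vel_def inner_prod_def fun_eq_iff)
    qed
    then show "(q has_derivative (\<lambda>w. vel F z \<bullet> w)) (at z)"
      by (rule has_derivative_transform_within_open[OF _ open_region z])
        (simp add: q_def Q_eq region_eq_side)
  next
    fix x y assume "(x, y) \<in> region \<sigma>"
    then have z: "Complex x y \<in> side \<sigma>" by (simp add: region_eq_side)
    have "Complex (x + 2 * pi) y = Complex x y + 2 * of_real pi" by (simp add: complex_eq_iff)
    then show "q (x + 2 * pi, y) = q (x, y)"
      using Q_per[OF z] Q_eq[OF z] Q_eq[OF side_periodic[OF z]] by (simp add: q_def)
  qed
qed

end

section \<open>The boundary values and the principal values\<close>

lemma has_pv_integral_unique:
  assumes "has_pv_integral f J" "has_pv_integral f J'"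
  shows "J = J'"
  using assms unfolding has_pv_integral_def by (intro tendsto_unique[OF trivial_limit_at_right_real]) auto

text \<open>Agreement is asked only inside the period: at s = pi and s = -pi the term tan (s / 2)
  has the default value 0 of a division by zero, while the cotangent is regular there. Two points
  form a null set.\<close>

lemma has_pv_integralI:
  fixes f g :: "real \<Rightarrow> real"
  assumes cont: "\<And>a b. -pi \<le> a \<Longrightarrow> b \<le> pi \<Longrightarrow> 0 \<notin> {a..b} \<Longrightarrow> continuous_on {a..b} g"
    and eq: "\<And>s. -pi < s \<Longrightarrow> s < pi \<Longrightarrow> s \<noteq> 0 \<Longrightarrow> f s = g s"
    and lim: "((\<lambda>\<epsilon>. integral {-pi..-\<epsilon>} g + integral {\<epsilon>..pi} g) \<longlongrightarrow> J) (at_right 0)"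
  shows "has_pv_integral f J"
proof -
  let ?S = "\<lambda>\<epsilon>. {-pi..-\<epsilon>} \<union> {\<epsilon>..pi}"
  have int: "f absolutely_integrable_on ?S \<epsilon>"
    and val: "integral (?S \<epsilon>) f = integral {-pi..-\<epsilon>} g + integral {\<epsilon>..pi} g" if \<epsilon>: "0 < \<epsilon>" "\<epsilon> < pi" for \<epsilon>
  proof -
    have N: "negligible {-pi, pi}" by simp
    have fg: "f s = g s" if "s \<in> ?S \<epsilon> - {-pi, pi}" for s
      using that \<epsilon> by (intro eq) auto
    have c: "continuous_on {-pi..-\<epsilon>} g" "continuous_on {\<epsilon>..pi} g" using \<epsilon> by (intro cont; simp)+
    have gint: "g absolutely_integrable_on {-pi..-\<epsilon>}" "g absolutely_integrable_on {\<epsilon>..pi}"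
      by (intro absolutely_integrable_continuous_real c)+
    then have "g absolutely_integrable_on ?S \<epsilon>" by (rule absolutely_integrable_Un)
    then show "f absolutely_integrable_on ?S \<epsilon>"
      by (rule absolutely_integrable_spike[OF _ N]) (rule fg)
    have "integral (?S \<epsilon>) f = integral (?S \<epsilon>) g"
      by (rule integral_spike[OF N]) (simp only: fg)
    also have "\<dots> = integral {-pi..-\<epsilon>} g + integral {\<epsilon>..pi} g"
    proof (rule integral_Un)
      have "{-pi..-\<epsilon>} \<inter> {\<epsilon>..pi} = {}" using \<epsilon> by auto
      then show "negligible ({-pi..-\<epsilon>} \<inter> {\<epsilon>..pi})" by simp
    qed (intro integrable_continuous_real c)+
    finally show "integral (?S \<epsilon>) f = integral {-pi..-\<epsilon>} g + integral {\<epsilon>..pi} g" .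
  qed
  have "((\<lambda>\<epsilon>. LINT s:?S \<epsilon>|lebesgue. f s) \<longlongrightarrow> J) (at_right 0)"
    using lim
  proof (rule Lim_transform_eventually)
    show "\<forall>\<^sub>F \<epsilon> in at_right 0. integral {-pi..-\<epsilon>} g + integral {\<epsilon>..pi} g = (LINT s:?S \<epsilon>|lebesgue. f s)"
      using eventually_at_right_real[OF pi_gt_zero]
    proof (rule eventually_mono)
      fix \<epsilon> :: real assume "\<epsilon> \<in> {0<..<pi}"
      then have e: "0 < \<epsilon>" "\<epsilon> < pi" by auto
      show "integral {-pi..-\<epsilon>} g + integral {\<epsilon>..pi} g = (LINT s:?S \<epsilon>|lebesgue. f s)"
        unfolding set_lebesgue_integral_eq_integral(2)[OF int[OF e]] val[OF e] ..
    qed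
  qed
  then show ?thesis unfolding has_pv_integral_def using int by blast
qed

context holder_graph
begin

lemma deriv_h: "deriv h x = h' x"
  using h_deriv by (rule DERIV_imp_deriv)

text \<open>Both real principal values come from a single complex one: by
  \<open>cot_Complex_half\<close> the integrand of \<open>cauchy_principal_value\<close> has the
  second contour integrand as real part and minus the first as imaginary part.\<close>

lemma contour_principal_values:
  shows "has_pv_integral (\<lambda>s. deriv h (x - s) * (T_diff h x s * (1 + (tan (s / 2))\<^sup>2) /
      ((tan (s / 2))\<^sup>2 + (T_diff h x s)\<^sup>2))) (- Im (reg_cauchy x 0))" (is ?T)
    and "has_pv_integral (\<lambda>s. deriv h (x - s) * (tan (s / 2) * (1 - (T_diff h x s)\<^sup>2) /
      ((tan (s / 2))\<^sup>2 + (T_diff h x s)\<^sup>2))) (Re (reg_cauchy x 0))" (is ?t)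
proof -
  define q where "q s = of_real (h' (x - s)) * cot (hdiff x 0 s)" for s
  have cq: "continuous_on {a..b} q" if "-pi \<le> a" "b \<le> pi" "0 \<notin> {a..b}" for a b
    unfolding q_def by (rule dcrv_cot_continuous_on) (use that in \<open>auto intro!: continuous_intros\<close>)
  have iq: "q integrable_on {-pi..-\<epsilon>}" "q integrable_on {\<epsilon>..pi}" if "\<epsilon> \<in> {0<..<pi}" for \<epsilon>
    using that by (intro integrable_continuous_real cq; simp)+
  have eq: "q s = Complex (h' (x - s) * (tan (s / 2) * (1 - (T_diff h x s)\<^sup>2) / ((tan (s / 2))\<^sup>2 + (T_diff h x s)\<^sup>2)))
      (- (h' (x - s) * (T_diff h x s * (1 + (tan (s / 2))\<^sup>2) / ((tan (s / 2))\<^sup>2 + (T_diff h x s)\<^sup>2))))"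
    if "-pi < s" "s < pi" "s \<noteq> 0" for s
    unfolding q_def hdiff_def T_diff_def add_0_right cot_Complex_half[OF that]
    by (simp add: complex_eq_iff)
  have lim: "((\<lambda>\<epsilon>. integral {-pi..-\<epsilon>} q + integral {\<epsilon>..pi} q) \<longlongrightarrow> reg_cauchy x 0) (at_right 0)"
    unfolding q_def[abs_def] by (rule cauchy_principal_value)
  have re: "integral S (\<lambda>s. Re (q s)) = Re (integral S q)" if "q integrable_on S" for S
    using has_integral_Re[OF integrable_integral[OF that]] by (rule integral_unique)
  have im: "integral S (\<lambda>s. Im (q s)) = Im (integral S q)" if "q integrable_on S" for S
    using has_integral_Im[OF integrable_integral[OF that]] by (rule integral_unique)
  have ev: "\<forall>\<^sub>F \<epsilon> in at_right 0. \<epsilon> \<in> {0<..<pi}" by (rule eventually_at_right_real[OF pi_gt_zero])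
  show ?T
  proof (rule has_pv_integralI[where g = "\<lambda>s. - Im (q s)"])
    show "continuous_on {a..b} (\<lambda>s. - Im (q s))" if "-pi \<le> a" "b \<le> pi" "0 \<notin> {a..b}" for a b
      by (intro continuous_intros cq that)
    have "((\<lambda>\<epsilon>. - Im (integral {-pi..-\<epsilon>} q + integral {\<epsilon>..pi} q)) \<longlongrightarrow> - Im (reg_cauchy x 0)) (at_right 0)"
      by (intro tendsto_intros lim)
    then show "((\<lambda>\<epsilon>. integral {-pi..-\<epsilon>} (\<lambda>s. - Im (q s)) + integral {\<epsilon>..pi} (\<lambda>s. - Im (q s))) \<longlongrightarrow> - Im (reg_cauchy x 0)) (at_right 0)"
      by (rule Lim_transform_eventually) (rule eventually_mono[OF ev], simp add: im iq del: greaterThanLessThan_iff)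
  qed (simp add: eq deriv_h)
  show ?t
  proof (rule has_pv_integralI[where g = "\<lambda>s. Re (q s)"])
    show "continuous_on {a..b} (\<lambda>s. Re (q s))" if "-pi \<le> a" "b \<le> pi" "0 \<notin> {a..b}" for a b
      by (intro continuous_intros cq that)
    have "((\<lambda>\<epsilon>. Re (integral {-pi..-\<epsilon>} q + integral {\<epsilon>..pi} q)) \<longlongrightarrow> Re (reg_cauchy x 0)) (at_right 0)"
      by (intro tendsto_intros lim)
    then show "((\<lambda>\<epsilon>. integral {-pi..-\<epsilon>} (\<lambda>s. Re (q s)) + integral {\<epsilon>..pi} (\<lambda>s. Re (q s))) \<longlongrightarrow> Re (reg_cauchy x 0)) (at_right 0)"
      by (rule Lim_transform_eventually) (rule eventually_mono[OF ev], simp add: re iq del: greaterThanLessThan_iff)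
  qed (simp add: eq deriv_h)
qed

text \<open>The continuous extension across the graph of the restriction of \<^const>\<open>cauchy\<close> to one side.\<close>

definition cauchy_ext :: "real \<Rightarrow> complex \<Rightarrow> complex" where
  "cauchy_ext \<sigma> z = reg_cauchy (Re z) (Im z - h (Re z)) - 2 * pi * \<i> * of_real \<sigma> * dens (Re z)"

lemma cauchy_ext_continuous: "continuous_on UNIV (cauchy_ext \<sigma>)"
  unfolding cauchy_ext_def by (intro continuous_intros)

lemma cauchy_ext_graph: "cauchy_ext \<sigma> (crv x) = reg_cauchy x 0 - 2 * pi * \<i> * of_real \<sigma> * dens x"
  by (simp add: cauchy_ext_def crv_def)

lemma cauchy_ext_eq:
  assumes \<sigma>: "\<sigma> = 1 \<or> \<sigma> = -1" and z: "z \<in> side \<sigma>"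
  shows "cauchy_ext \<sigma> z = cauchy z"
proof -
  define \<eta> where "\<eta> = Im z - h (Re z)"
  have "\<eta> \<noteq> 0" "sgn \<eta> = \<sigma>" using z \<sigma> by (auto simp: side_def \<eta>_def)
  moreover have "z = Complex (Re z) (h (Re z) + \<eta>)" by (simp add: \<eta>_def)
  ultimately show ?thesis using cauchy_off_graph[of \<eta> "Re z"] by (simp add: cauchy_ext_def \<eta>_def)
qed

lemma cauchy_ext_side:
  assumes \<sigma>: "\<sigma> = 1 \<or> \<sigma> = -1"
  shows "cauchy_ext \<sigma> holomorphic_on side \<sigma>"
    and "z \<in> side \<sigma> \<Longrightarrow> cauchy_ext \<sigma> (z + 2 * of_real pi) = cauchy_ext \<sigma> z"
    and "\<epsilon> > 0 \<Longrightarrow> \<exists>R. \<forall>z\<in>side \<sigma>. \<bar>Im z\<bar> > R \<longrightarrow> norm (cauchy_ext \<sigma> z) < \<epsilon>"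
proof -
  have "cauchy holomorphic_on side \<sigma>" by (rule cauchy_holomorphic) (rule side_off_graph)
  then show "cauchy_ext \<sigma> holomorphic_on side \<sigma>"
    by (rule holomorphic_transform) (simp add: cauchy_ext_eq[OF \<sigma>])
  show "cauchy_ext \<sigma> (z + 2 * of_real pi) = cauchy_ext \<sigma> z" if "z \<in> side \<sigma>"
    using cauchy_periodic by (simp add: cauchy_ext_eq[OF \<sigma>] that side_periodic)
  show "\<exists>R. \<forall>z\<in>side \<sigma>. \<bar>Im z\<bar> > R \<longrightarrow> norm (cauchy_ext \<sigma> z) < \<epsilon>" if \<epsilon>: "\<epsilon> > 0"
  proof -
    obtain R where "\<And>z. \<bar>Im z\<bar> > R \<Longrightarrow> norm (cauchy z) < \<epsilon>" by (rule cauchy_decay[OF \<epsilon>]) blast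
    then show ?thesis by (intro exI[of _ R]) (simp add: cauchy_ext_eq[OF \<sigma>])
  qed
qed

text \<open>The component along (-h', 1) is - Im (F \<zeta>'). The jump term of
  \<open>cauchy_ext\<close> times \<zeta>' is purely imaginary, so after multiplication by i
  \<kappa> it is real and drops out: the value does not depend on \<sigma>.\<close>

lemma vel_graph_normal:
  assumes "F (crv x) = \<i> * of_real \<kappa> * cauchy_ext \<sigma> (crv x)"
  shows "vel F (x, h x) \<bullet> (- h' x, 1) = - \<kappa> * (Re (reg_cauchy x 0) + h' x * (- Im (reg_cauchy x 0)))"
proof -
  have "vel F (x, h x) \<bullet> (- h' x, 1) = - Im (F (crv x) * dcrv x)"
    by (simp add: vel_def crv_def dcrv_def inner_prod_def algebra_simps)
  also have "F (crv x) * dcrv x = \<i> * of_real \<kappa> * (reg_cauchy x 0 * dcrv x - 2 * pi * \<i> * of_real \<sigma> * (dens x * dcrv x))"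
    unfolding assms cauchy_ext_graph by (simp add: algebra_simps)
  also have "- Im \<dots> = - \<kappa> * (Re (reg_cauchy x 0) + h' x * (- Im (reg_cauchy x 0)))"
    unfolding dens_mult_dcrv by (simp add: dcrv_def algebra_simps)
  finally show ?thesis .
qed

end

section \<open>From complex velocities to solutions of the bulk equations and back\<close>

abbreviation regular_flow ::
  "(real \<times> real) set \<Rightarrow> (real \<times> real) set \<Rightarrow> (real \<times> real \<Rightarrow> real \<times> real) \<Rightarrow>
   (real \<times> real \<Rightarrow> real \<times> real) \<Rightarrow> (real \<times> real \<Rightarrow> real) \<Rightarrow> (real \<times> real \<Rightarrow> real) \<Rightarrow> bool" where
  "regular_flow \<Omega>p \<Omega>m vp vm pp pm \<equiv>
     continuous_on (closure \<Omega>p) vp \<and> C1_on \<Omega>p vp \<and> continuous_on (closure \<Omega>m) vm \<and> C1_on \<Omega>m vm \<and>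
     C1_on_closure \<Omega>p pp \<and> C2_on \<Omega>p pp \<and> C1_on_closure \<Omega>m pm \<and> C2_on \<Omega>m pm"

lemma inner_0_Pair: "(0, c) \<bullet> w = c * snd w" for c :: real and w :: "real \<times> real"
  by (simp add: inner_prod_def)

context periodic_graph
begin

abbreviation darcy_gradient ::
  "real \<Rightarrow> real \<Rightarrow> real \<Rightarrow> real \<Rightarrow> (real \<times> real \<Rightarrow> real \<times> real) \<Rightarrow> real \<times> real \<Rightarrow> real \<times> real" where
  "darcy_gradient k \<mu> g \<rho> v z \<equiv> - (\<mu> / k) *\<^sub>R v z - (0, \<rho> * g)"

lemma darcy_iff:
  fixes v G :: "real \<times> real" and c :: real
  assumes "0 < k" "0 < \<mu>"
  shows "v = - (k / \<mu>) *\<^sub>R (G + (0, c)) \<longleftrightarrow> G = - (\<mu> / k) *\<^sub>R v - (0, c)"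
  using assms by (cases v; cases G) (auto simp: field_simps)

text \<open>Darcy's law is solved for the pressure by integrating it: p is a multiple of the
  velocity potential plus the hydrostatic term. The integral formula along the graph is recorded for
  comparing the pressures of the two fluids.\<close>

lemma bulk_solution:
  assumes \<sigma>: "\<sigma> = 1 \<or> \<sigma> = -1" and k: "0 < k" and \<mu>: "0 < \<mu>"
    and cont: "continuous_on UNIV F" and hol: "F holomorphic_on side \<sigma>"
    and per: "\<And>z. z \<in> side \<sigma> \<Longrightarrow> F (z + 2 * of_real pi) = F z"
    and decay: "\<And>\<epsilon>. \<epsilon> > 0 \<Longrightarrow> \<exists>R. \<forall>z\<in>side \<sigma>. \<bar>Im z\<bar> > R \<longrightarrow> norm (F z) < \<epsilon>"
  shows "\<exists>p. p (0, h 0) = 0 \<and> bulk_equations k \<mu> g \<rho> (region \<sigma>) (vel F) p \<and>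
    continuous_on (closure (region \<sigma>)) (vel F) \<and> C1_on (region \<sigma>) (vel F) \<and>
    C1_on_closure (region \<sigma>) p \<and> C2_on (region \<sigma>) p \<and>
    (\<forall>a b. a \<le> b \<longrightarrow> ((\<lambda>s. darcy_gradient k \<mu> g \<rho> (vel F) (s, h s) \<bullet> (1, h' s)) has_integral
      p (b, h b) - p (a, h a)) {a..b})"
proof -
  let ?\<Omega> = "region \<sigma>" and ?G = "darcy_gradient k \<mu> g \<rho> (vel F)"
  obtain q where cq: "continuous_on UNIV q"
    and dq: "\<And>z. z \<in> ?\<Omega> \<Longrightarrow> (q has_derivative (\<lambda>w. vel F z \<bullet> w)) (at z)"
    and perq: "\<And>x y. (x, y) \<in> ?\<Omega> \<Longrightarrow> q (x + 2 * pi, y) = q (x, y)"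
    using velocity_potential[OF \<sigma> cont hol per decay] by blast
  \<comment> \<open>The constant normalises p to 0 at (0, h 0). With both pressures normalised
    there, equal tangential derivatives along the graph make them equal on all of it.\<close>
  define c where "c = \<mu> / k * q (0, h 0) + \<rho> * g * h 0"
  define p where "p z = - (\<mu> / k) * q z - \<rho> * g * snd z + c" for z :: "real \<times> real"
  have dp: "(p has_derivative (\<lambda>w. ?G z \<bullet> w)) (at z)" if "z \<in> ?\<Omega>" for z
  proof -
    have "(p has_derivative (\<lambda>w. - (\<mu> / k) * (vel F z \<bullet> w) - \<rho> * g * snd w + 0)) (at z)"
      unfolding p_def[abs_def]
      by (intro has_derivative_add has_derivative_diff has_derivative_mult_right dq[OF that]
          has_derivative_const bounded_linear_imp_has_derivative[OF bounded_linear_snd])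
    then show ?thesis
      by (rule has_derivative_eq_rhs) (simp add: fun_eq_iff inner_diff_left inner_0_Pair del: split_paired_All)
  qed
  have cp: "continuous_on UNIV p" unfolding p_def[abs_def] by (intro continuous_intros cq)
  have cv: "continuous_on UNIV (vel F)"
    unfolding vel_def by (intro continuous_intros continuous_on_compose2[OF cont]) auto
  have cG: "continuous_on UNIV ?G" by (intro continuous_intros cv)
  have Cv: "C1_on ?\<Omega> (vel F)" and div: "\<And>z. z \<in> ?\<Omega> \<Longrightarrow> divergence (vel F) z = 0"
    using holomorphic_velocity[OF hol open_side] by (simp_all add: region_eq_side)
  have CG: "C1_on ?\<Omega> ?G"
  proof -
    obtain Dv where Dv: "\<forall>z\<in>?\<Omega>. (vel F has_derivative blinfun_apply (Dv z)) (at z)" and cD: "continuous_on ?\<Omega> Dv"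
      using Cv unfolding C1_on_def by blast
    have "(?G has_derivative blinfun_apply (- (\<mu> / k) *\<^sub>R Dv z)) (at z)" if "z \<in> ?\<Omega>" for z
    proof -
      have "(?G has_derivative (\<lambda>w. - (\<mu> / k) *\<^sub>R Dv z w - 0)) (at z)"
        by (intro has_derivative_diff has_derivative_scaleR_right bspec[OF Dv that] has_derivative_const)
      then show ?thesis by (rule has_derivative_eq_rhs) (simp add: fun_eq_iff scaleR_blinfun.rep_eq uminus_blinfun.rep_eq)
    qed
    moreover have "continuous_on ?\<Omega> (\<lambda>z. - (\<mu> / k) *\<^sub>R Dv z)" by (intro continuous_intros cD)
    ultimately show ?thesis
      unfolding C1_on_def by (intro exI[of _ "\<lambda>z. - (\<mu> / k) *\<^sub>R Dv z"] conjI ballI)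
  qed
  note reg = gradient_field_regular[where G = ?G, OF dp]
  show ?thesis
  proof (intro exI[of _ p] conjI allI impI)
    show "p (0, h 0) = 0" by (simp add: p_def c_def)
    show "bulk_equations k \<mu> g \<rho> ?\<Omega> (vel F) p"
      unfolding bulk_equations_def
    proof (intro conjI allI impI ballI)
      fix x y assume xy: "(x, y) \<in> ?\<Omega>"
      have "Complex (x + 2 * pi) y = Complex x y + 2 * of_real pi" by (simp add: complex_eq_iff)
      then show "vel F (x + 2 * pi, y) = vel F (x, y)"
        using per[of "Complex x y"] xy by (simp add: vel_def region_eq_side)
      show "p (x + 2 * pi, y) = p (x, y)" using perq[OF xy] by (simp add: p_def)
    next
      fix z assume z: "z \<in> ?\<Omega>"
      show "divergence (vel F) z = 0" by (rule div[OF z])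
      show "vel F z = - (k / \<mu>) *\<^sub>R (grad p z + (0, \<rho> * g))"
        unfolding darcy_iff[OF k \<mu>] by (rule reg(3)[OF _ z])
    next
      fix \<epsilon> :: real assume "\<epsilon> > 0"
      then obtain R where R: "\<forall>z\<in>side \<sigma>. \<bar>Im z\<bar> > R \<longrightarrow> norm (F z) < \<epsilon>" using decay by blast
      have "norm (vel F (x, y)) < \<epsilon>" if "(x, y) \<in> ?\<Omega>" "\<bar>y\<bar> > R" for x y
      proof -
        have "norm (vel F (x, y)) = norm (F (Complex x y))"
          by (simp add: vel_def norm_Pair cmod_def)
        then show ?thesis using R that by (simp add: region_eq_side)
      qed
      then show "\<exists>R. \<forall>x y. (x, y) \<in> ?\<Omega> \<and> \<bar>y\<bar> > R \<longrightarrow> norm (vel F (x, y)) < \<epsilon>" by blast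
    qed
    show "continuous_on (closure ?\<Omega>) (vel F)" by (rule continuous_on_subset[OF cv]) simp
    show "C1_on ?\<Omega> (vel F)" by (rule Cv)
    show "C1_on_closure ?\<Omega> p"
      by (rule reg(1)[OF _ continuous_on_subset[OF cp] continuous_on_subset[OF cG]]) simp_all
    show "C2_on ?\<Omega> p" by (rule reg(2)[OF _ CG])
    show "((\<lambda>s. ?G (s, h s) \<bullet> (1, h' s)) has_integral p (b, h b) - p (a, h a)) {a..b}" if "a \<le> b" for a b
      by (rule has_integral_gradient_along_graph[OF \<sigma> that dp continuous_on_subset[OF cp] continuous_on_subset[OF cG]]) simp_all
  qed
qed

definition cvel :: "(real \<times> real \<Rightarrow> real \<times> real) \<Rightarrow> complex \<Rightarrow> complex" where
  "cvel v z = Complex (fst (v (Re z, Im z))) (- snd (v (Re z, Im z)))"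

lemma vel_cvel: "vel (cvel v) = v"
  by (simp add: vel_def cvel_def fun_eq_iff)

lemma bulk_solution_conv:
  assumes \<sigma>: "\<sigma> = 1 \<or> \<sigma> = -1" and k: "0 < k" and \<mu>: "0 < \<mu>"
    and bulk: "bulk_equations k \<mu> g \<rho> (region \<sigma>) v p"
    and cv: "continuous_on (closure (region \<sigma>)) v" and Cv: "C1_on (region \<sigma>) v"
    and Cp: "C1_on_closure (region \<sigma>) p"
  shows "cvel v holomorphic_on side \<sigma>"
    and "continuous_on {z. \<sigma> * (Im z - h (Re z)) \<ge> 0} (cvel v)"
    and "z \<in> side \<sigma> \<Longrightarrow> cvel v (z + 2 * of_real pi) = cvel v z"
    and "\<epsilon> > 0 \<Longrightarrow> \<exists>R. \<forall>z\<in>side \<sigma>. \<bar>Im z\<bar> > R \<longrightarrow> norm (cvel v z) < \<epsilon>"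
    and "a \<le> b \<Longrightarrow> ((\<lambda>s. darcy_gradient k \<mu> g \<rho> v (s, h s) \<bullet> (1, h' s)) has_integral
      p (b, h b) - p (a, h a)) {a..b}"
proof -
  let ?\<Omega> = "region \<sigma>" and ?G = "darcy_gradient k \<mu> g \<rho> v"
  obtain Dp where Dp: "\<And>z. z \<in> ?\<Omega> \<Longrightarrow> (p has_derivative blinfun_apply (Dp z)) (at z)"
    and cp: "continuous_on (closure ?\<Omega>) p"
    using Cp unfolding C1_on_closure_def by blast
  note b = bulk[unfolded bulk_equations_def]
  note bper = conjunct1[OF b] and beq = conjunct1[OF conjunct2[OF b]] and bdecay = conjunct2[OF conjunct2[OF b]]
  have div: "divergence v z = 0" if "z \<in> ?\<Omega>" for z using beq that by blast
  have darcy: "grad p z = ?G z" if "z \<in> ?\<Omega>" for z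
    using conjunct2[OF bspec[OF beq that]] unfolding darcy_iff[OF k \<mu>] .
  have dp: "(p has_derivative (\<lambda>w. ?G z \<bullet> w)) (at z)" if z: "z \<in> ?\<Omega>" for z
  proof -
    have "Dp z w = ?G z \<bullet> w" for w
    proof -
      have "Dp z w = Dp z (fst w *\<^sub>R (1, 0) + snd w *\<^sub>R (0, 1))" by (cases w) simp
      also have "\<dots> = fst w * Dp z (1, 0) + snd w * Dp z (0, 1)"
        by (simp only: blinfun.add_right blinfun.scaleR_right real_scaleR_def)
      also have "\<dots> = grad p z \<bullet> w"
        unfolding grad_def frechet_derivative_at[OF Dp[OF z], symmetric] by (simp add: inner_prod_def)
      finally show ?thesis by (simp only: darcy[OF z])
    qed
    then show ?thesis by (intro has_derivative_eq_rhs[OF Dp[OF z]] ext)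
  qed
  \<comment> \<open>By Darcy's law v is the gradient of this scaled pressure with the gravity
    potential added; that is the irrotational half of the Cauchy-Riemann equations.\<close>
  have dv: "((\<lambda>z. - (k / \<mu>) * (p z + \<rho> * g * snd z)) has_derivative (\<lambda>w. v z \<bullet> w)) (at z)" if "z \<in> ?\<Omega>" for z
  proof -
    have "((\<lambda>z. - (k / \<mu>) * (p z + \<rho> * g * snd z)) has_derivative
        (\<lambda>w. - (k / \<mu>) * (?G z \<bullet> w + \<rho> * g * snd w))) (at z)"
      by (intro has_derivative_add has_derivative_mult_right dp[OF that]
          bounded_linear_imp_has_derivative[OF bounded_linear_snd])
    then show ?thesis
      by (rule has_derivative_eq_rhs)
        (use k \<mu> in \<open>simp add: fun_eq_iff inner_diff_left inner_0_Pair del: split_paired_All\<close>)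
  qed
  have "{z. (Re z, Im z) \<in> ?\<Omega>} = side \<sigma>" by (simp add: region_def side_def)
  then show "cvel v holomorphic_on side \<sigma>"
    using velocity_holomorphic[OF open_region dv Cv div] by (simp only: cvel_def[abs_def])
  show "continuous_on {z. \<sigma> * (Im z - h (Re z)) \<ge> 0} (cvel v)"
  proof -
    have "continuous_on {z. \<sigma> * (Im z - h (Re z)) \<ge> 0} (\<lambda>z. v (Re z, Im z))"
      by (rule continuous_on_compose2[OF cv]) (auto intro!: continuous_intros simp: closure_region[OF \<sigma>])
    then show ?thesis unfolding cvel_def by (intro continuous_intros)
  qed
  show "cvel v (z + 2 * of_real pi) = cvel v z" if "z \<in> side \<sigma>"
  proof -
    have "v (Re z + 2 * pi, Im z) = v (Re z, Im z)"
    proof -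
      have "(Re z, Im z) \<in> ?\<Omega>" using that by (simp add: region_def side_def)
      then show ?thesis using bper by blast
    qed
    then show ?thesis by (simp add: cvel_def)
  qed
  show "\<exists>R. \<forall>z\<in>side \<sigma>. \<bar>Im z\<bar> > R \<longrightarrow> norm (cvel v z) < \<epsilon>" if \<epsilon>: "\<epsilon> > 0"
  proof -
    obtain R where R: "\<forall>x y. (x, y) \<in> ?\<Omega> \<and> \<bar>y\<bar> > R \<longrightarrow> norm (v (x, y)) < \<epsilon>"
      using bdecay \<epsilon> by blast
    have "norm (cvel v z) < \<epsilon>" if "z \<in> side \<sigma>" "\<bar>Im z\<bar> > R" for z
    proof -
      have "norm (cvel v z) = norm (v (Re z, Im z))"
        by (cases "v (Re z, Im z)") (simp add: cvel_def norm_Pair cmod_def)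
      moreover have "(Re z, Im z) \<in> ?\<Omega>" using that by (simp add: region_def side_def)
      ultimately show ?thesis using R that(2) by simp
    qed
    then show ?thesis by blast
  qed
  have cG: "continuous_on (closure ?\<Omega>) ?G" by (intro continuous_intros cv)
  show "((\<lambda>s. ?G (s, h s) \<bullet> (1, h' s)) has_integral p (b, h b) - p (a, h a)) {a..b}" if "a \<le> b"
    by (rule has_integral_gradient_along_graph[OF \<sigma> that dp cp cG])
qed

end

context holder_graph
begin

text \<open>The velocity is i \<kappa> \<open>cauchy_ext\<close> on each side. Its normal components
  agree by \<open>vel_graph_normal\<close>, and its jump 4 pi \<kappa> \<open>dens\<close> is just
  what compensates the different weights of the fluids in the tangential pressure gradients.\<close>

lemma contour_imp_muskat:
  fixes k \<mu> g \<rho>plus \<rho>minus :: real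
  assumes k: "0 < k" and \<mu>: "0 < \<mu>"
  defines "\<kappa> \<equiv> k * (g * (\<rho>minus - \<rho>plus)) / (4 * pi * \<mu>)"
  shows "\<exists>vp vm pp pm.
    bulk_equations k \<mu> g \<rho>plus (region 1) vp pp \<and> bulk_equations k \<mu> g \<rho>minus (region (-1)) vm pm \<and>
    (\<forall>x. pp (x, h x) = pm (x, h x) \<and>
      vp (x, h x) \<bullet> (- h' x, 1) = - \<kappa> * (Re (reg_cauchy x 0) + h' x * (- Im (reg_cauchy x 0))) \<and>
      vm (x, h x) \<bullet> (- h' x, 1) = - \<kappa> * (Re (reg_cauchy x 0) + h' x * (- Im (reg_cauchy x 0)))) \<and>
    regular_flow (region 1) (region (-1)) vp vm pp pm"
proof -
  define F where "F \<sigma> z = \<i> * of_real \<kappa> * cauchy_ext \<sigma> z" for \<sigma> z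
  have cF: "continuous_on UNIV (F \<sigma>)" for \<sigma>
    unfolding F_def[abs_def] by (intro continuous_intros cauchy_ext_continuous)
  have hF: "F \<sigma> holomorphic_on side \<sigma>"
    and pF: "\<And>z. z \<in> side \<sigma> \<Longrightarrow> F \<sigma> (z + 2 * of_real pi) = F \<sigma> z"
    and dF: "\<And>\<epsilon>. \<epsilon> > 0 \<Longrightarrow> \<exists>R. \<forall>z\<in>side \<sigma>. \<bar>Im z\<bar> > R \<longrightarrow> norm (F \<sigma> z) < \<epsilon>"
    if \<sigma>: "\<sigma> = 1 \<or> \<sigma> = -1" for \<sigma>
  proof -
    show "F \<sigma> holomorphic_on side \<sigma>"
      unfolding F_def[abs_def] by (intro holomorphic_intros cauchy_ext_side(1)[OF \<sigma>])
    show "F \<sigma> (z + 2 * of_real pi) = F \<sigma> z" if "z \<in> side \<sigma>" for z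
      using cauchy_ext_side(2)[OF \<sigma> that] by (simp add: F_def)
    show "\<exists>R. \<forall>z\<in>side \<sigma>. \<bar>Im z\<bar> > R \<longrightarrow> norm (F \<sigma> z) < \<epsilon>" if \<epsilon>: "\<epsilon> > 0" for \<epsilon>
    proof -
      \<comment> \<open>The summand 1 keeps the denominator positive also when \<kappa> = 0.\<close>
      have "\<epsilon> / (\<bar>\<kappa>\<bar> + 1) > 0" using \<epsilon> by simp
      from cauchy_ext_side(3)[OF \<sigma> this]
      obtain R where R: "\<forall>z\<in>side \<sigma>. \<bar>Im z\<bar> > R \<longrightarrow> norm (cauchy_ext \<sigma> z) < \<epsilon> / (\<bar>\<kappa>\<bar> + 1)" by blast
      have "norm (F \<sigma> z) < \<epsilon>" if z: "z \<in> side \<sigma>" "\<bar>Im z\<bar> > R" for z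
      proof -
        have "norm (cauchy_ext \<sigma> z) < \<epsilon> / (\<bar>\<kappa>\<bar> + 1)" using R z by blast
        then have "(\<bar>\<kappa>\<bar> + 1) * norm (cauchy_ext \<sigma> z) < \<epsilon>" by (simp add: field_simps)
        moreover have "norm (F \<sigma> z) \<le> (\<bar>\<kappa>\<bar> + 1) * norm (cauchy_ext \<sigma> z)"
          by (simp add: F_def norm_mult distrib_right)
        ultimately show ?thesis by linarith
      qed
      then show ?thesis by blast
    qed
  qed
  obtain pp where pp: "pp (0, h 0) = 0" "bulk_equations k \<mu> g \<rho>plus (region 1) (vel (F 1)) pp"
    "continuous_on (closure (region 1)) (vel (F 1))" "C1_on (region 1) (vel (F 1))"
    "C1_on_closure (region 1) pp" "C2_on (region 1) pp"
    and ip: "\<And>a b. a \<le> b \<Longrightarrow> ((\<lambda>s. darcy_gradient k \<mu> g \<rho>plus (vel (F 1)) (s, h s) \<bullet> (1, h' s)) has_integral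
      pp (b, h b) - pp (a, h a)) {a..b}"
    using bulk_solution[OF disjI1[OF refl] k \<mu> cF hF[OF disjI1[OF refl]] pF[OF disjI1[OF refl]]
        dF[OF disjI1[OF refl]], of g \<rho>plus] by blast
  obtain pm where pm: "pm (0, h 0) = 0" "bulk_equations k \<mu> g \<rho>minus (region (-1)) (vel (F (-1))) pm"
    "continuous_on (closure (region (-1))) (vel (F (-1)))" "C1_on (region (-1)) (vel (F (-1)))"
    "C1_on_closure (region (-1)) pm" "C2_on (region (-1)) pm"
    and im: "\<And>a b. a \<le> b \<Longrightarrow> ((\<lambda>s. darcy_gradient k \<mu> g \<rho>minus (vel (F (-1))) (s, h s) \<bullet> (1, h' s)) has_integral
      pm (b, h b) - pm (a, h a)) {a..b}"
    using bulk_solution[OF disjI2[OF refl] k \<mu> cF hF[OF disjI2[OF refl]] pF[OF disjI2[OF refl]]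
        dF[OF disjI2[OF refl]], of g \<rho>minus] by blast
  have same: "darcy_gradient k \<mu> g \<rho>plus (vel (F 1)) (s, h s) \<bullet> (1, h' s) =
      darcy_gradient k \<mu> g \<rho>minus (vel (F (-1))) (s, h s) \<bullet> (1, h' s)" for s
  proof -
    have tan: "vel F' (s, h s) \<bullet> (1, h' s) = Re (F' (crv s) * dcrv s)" for F'
      by (simp add: vel_def crv_def dcrv_def inner_prod_def)
    have "(F 1 (crv s) - F (-1) (crv s)) * dcrv s = of_real (4 * pi * \<kappa>) * (dens s * dcrv s)"
      by (simp add: F_def cauchy_ext_graph algebra_simps)
    also have "\<dots> = of_real (k / \<mu> * (g * (\<rho>minus - \<rho>plus)) * h' s)"
      unfolding dens_mult_dcrv by (simp add: \<kappa>_def)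
    finally have "Re ((F 1 (crv s) - F (-1) (crv s)) * dcrv s) = k / \<mu> * (g * (\<rho>minus - \<rho>plus)) * h' s"
      by (simp only: Re_complex_of_real)
    then have "vel (F 1) (s, h s) \<bullet> (1, h' s) - vel (F (-1)) (s, h s) \<bullet> (1, h' s) = k / \<mu> * (g * (\<rho>minus - \<rho>plus)) * h' s"
      by (simp only: tan left_diff_distrib minus_complex.simps)
    then have "\<mu> / k * (vel (F 1) (s, h s) \<bullet> (1, h' s) - vel (F (-1)) (s, h s) \<bullet> (1, h' s)) = g * (\<rho>minus - \<rho>plus) * h' s"
      using k \<mu> by simp
    moreover have "darcy_gradient k \<mu> g \<rho> v z \<bullet> (1, h' s) = - (\<mu> / k) * (v z \<bullet> (1, h' s)) - \<rho> * g * h' s" for \<rho> v z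
      by (simp add: inner_diff_left)
    ultimately show ?thesis by (simp only:) (simp add: algebra_simps)
  qed
  have "pp (x, h x) = pm (x, h x)" for x
  proof (cases "x \<ge> 0")
    case True
    have "pp (x, h x) - pp (0, h 0) = pm (x, h x) - pm (0, h 0)"
      using has_integral_unique[OF ip[OF True, unfolded same] im[OF True]] .
    then show ?thesis by (simp add: pp(1) pm(1))
  next
    case False
    then have x: "x \<le> 0" by simp
    have "pp (0, h 0) - pp (x, h x) = pm (0, h 0) - pm (x, h x)"
      using has_integral_unique[OF ip[OF x, unfolded same] im[OF x]] .
    then show ?thesis by (simp add: pp(1) pm(1))
  qed
  moreover have "vel (F \<sigma>) (x, h x) \<bullet> (- h' x, 1) = - \<kappa> * (Re (reg_cauchy x 0) + h' x * (- Im (reg_cauchy x 0)))" for \<sigma> x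
    by (rule vel_graph_normal[where \<sigma> = \<sigma>]) (simp add: F_def)
  ultimately show ?thesis
    using pp pm by (intro exI[of _ "vel (F 1)"] exI[of _ "vel (F (-1))"] exI[of _ pp] exI[of _ pm]) blast
qed

end

section \<open>The equivalence\<close>

lemma eq_0_if_integrals_eq_0:
  fixes f :: "real \<Rightarrow> real"
  assumes cont: "continuous_on UNIV f" and int: "\<And>a b. a \<le> b \<Longrightarrow> (f has_integral 0) {a..b}"
  shows "f x = 0"
proof -
  have "((\<lambda>u. integral {x..u} f) has_vector_derivative f x) (at x within {x..x + 1})"
    by (rule integral_has_vector_derivative) (auto intro: continuous_on_subset[OF cont])
  then have "((\<lambda>u. 0) has_vector_derivative f x) (at x within {x..x + 1})"
    by (rule has_vector_derivative_transform[rotated -1]) (auto simp: integral_unique[OF int])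
  then show ?thesis
    using vector_derivative_unique_within_closed_interval[of x "x + 1" x "\<lambda>u. 0" "f x" 0]
    by (simp add: has_vector_derivative_const)
qed

context holder_graph
begin

text \<open>Subtracting i \<kappa> \<open>cauchy_ext\<close> from the given complex velocity on each
  side removes the jump. The two remainders glue to a periodic decaying function, continuous
  everywhere and holomorphic off the graph, which must vanish; thus the given boundary values are
  the explicit ones.\<close>

lemma muskat_imp_contour:
  fixes k \<mu> g \<rho>plus \<rho>minus :: real
  assumes k: "0 < k" and \<mu>: "0 < \<mu>"
    and bp: "bulk_equations k \<mu> g \<rho>plus (region 1) vp pp"
    and bm: "bulk_equations k \<mu> g \<rho>minus (region (-1)) vm pm"
    and press: "\<And>x. pp (x, h x) = pm (x, h x)"
    and normal: "\<And>x. vp (x, h x) \<bullet> unit_normal h x = vm (x, h x) \<bullet> unit_normal h x"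
    and cvp: "continuous_on (closure (region 1)) vp" and Cvp: "C1_on (region 1) vp"
    and cvm: "continuous_on (closure (region (-1))) vm" and Cvm: "C1_on (region (-1)) vm"
    and Cpp: "C1_on_closure (region 1) pp" and Cpm: "C1_on_closure (region (-1)) pm"
  defines "\<kappa> \<equiv> k * (g * (\<rho>minus - \<rho>plus)) / (4 * pi * \<mu>)"
  shows "vp (x, h x) \<bullet> (- h' x, 1) = - \<kappa> * (Re (reg_cauchy x 0) + h' x * (- Im (reg_cauchy x 0)))"
proof -
  note P = bulk_solution_conv[OF disjI1[OF refl] k \<mu> bp cvp Cvp Cpp]
  note M = bulk_solution_conv[OF disjI2[OF refl] k \<mu> bm cvm Cvm Cpm]
  have graph: "(s, h s) \<in> closure (region 1)" "(s, h s) \<in> closure (region (-1))" for s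
    using closure_region[of 1] closure_region[of "-1"] by simp_all
  have cg: "continuous_on UNIV (\<lambda>s. vp (s, h s))" "continuous_on UNIV (\<lambda>s. vm (s, h s))"
    by (rule continuous_on_compose2[OF cvp], auto intro!: continuous_intros graph)
      (rule continuous_on_compose2[OF cvm], auto intro!: continuous_intros graph)
  \<comment> \<open>Equal pressures have equal increments along every arc of the graph. So the
    difference of the tangential pressure gradients, which is continuous, integrates to 0 over all
    intervals and is 0 pointwise.\<close>
  have tangential: "(vp (s, h s) - vm (s, h s)) \<bullet> (1, h' s) = k / \<mu> * (g * (\<rho>minus - \<rho>plus)) * h' s" for s
  proof -
    let ?f = "\<lambda>s. darcy_gradient k \<mu> g \<rho>plus vp (s, h s) \<bullet> (1, h' s) - darcy_gradient k \<mu> g \<rho>minus vm (s, h s) \<bullet> (1, h' s)"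
    have "?f s = 0"
    proof (rule eq_0_if_integrals_eq_0[where f = ?f])
      show "continuous_on UNIV ?f" by (intro continuous_intros cg)
      fix a b :: real assume "a \<le> b"
      from has_integral_diff[OF P(5)[OF this] M(5)[OF this]]
      show "(?f has_integral 0) {a..b}" by (simp only: press diff_self)
    qed
    then have "\<mu> / k * ((vp (s, h s) - vm (s, h s)) \<bullet> (1, h' s)) = g * (\<rho>minus - \<rho>plus) * h' s"
      by (simp add: inner_diff_left inner_0_Pair algebra_simps)
    then have "k / \<mu> * (\<mu> / k * ((vp (s, h s) - vm (s, h s)) \<bullet> (1, h' s))) = k / \<mu> * (g * (\<rho>minus - \<rho>plus) * h' s)"
      by (rule arg_cong)
    then show ?thesis using k \<mu> by simp
  qed
  have norm0: "(vp (s, h s) - vm (s, h s)) \<bullet> (- h' s, 1) = 0" for s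
  proof -
    have "1 + (h' s)\<^sup>2 > 0" by (simp add: add_pos_nonneg)
    then have "1 / sqrt (1 + (h' s)\<^sup>2) \<noteq> 0" by simp
    from mult_left_cancel[THEN iffD1, OF this normal[of s, unfolded unit_normal_def deriv_h inner_scaleR_right]]
    show ?thesis by (simp add: inner_diff_left)
  qed
  \<comment> \<open>Multiplication by \<zeta>' collects the tangential component of the velocity
    jump in the real part and minus its normal component in the imaginary part.\<close>
  have jump: "cvel vp (crv s) - cvel vm (crv s) = of_real (4 * pi * \<kappa>) * dens s" for s
  proof -
    have e: "(cvel vp (crv s) - cvel vm (crv s)) * dcrv s =
        Complex ((vp (s, h s) - vm (s, h s)) \<bullet> (1, h' s)) (- ((vp (s, h s) - vm (s, h s)) \<bullet> (- h' s, 1)))"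
      by (simp add: cvel_def crv_def dcrv_def complex_eq_iff inner_prod_def algebra_simps)
    have "k / \<mu> * (g * (\<rho>minus - \<rho>plus)) * h' s = 4 * pi * \<kappa> * h' s" by (simp add: \<kappa>_def)
    then have "(cvel vp (crv s) - cvel vm (crv s)) * dcrv s = of_real (4 * pi * \<kappa>) * of_real (h' s)"
      unfolding e tangential norm0 by (simp add: complex_eq_iff)
    also have "\<dots> = of_real (4 * pi * \<kappa>) * dens s * dcrv s" by (simp only: dens_mult_dcrv mult.assoc)
    finally show ?thesis using dcrv_nonzero[of s] by simp
  qed
  define Ep Em where "Ep z = cvel vp z - \<i> * of_real \<kappa> * cauchy_ext 1 z"
    and "Em z = cvel vm z - \<i> * of_real \<kappa> * cauchy_ext (-1) z" for z
  define E where "E z = (if Im z \<ge> h (Re z) then Ep z else Em z)" for z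
  have Esides: "E z = Ep z" if "z \<in> side 1" for z using that by (simp add: E_def side_def)
  have Esides': "E z = Em z" if "z \<in> side (-1)" for z using that by (simp add: E_def side_def)
  have split: "z \<in> side 1 \<or> z \<in> side (-1)" if "Im z \<noteq> h (Re z)" for z
    using that by (auto simp: side_def)
  have cE: "continuous_on UNIV E"
  proof -
    let ?S = "{z. 1 * (Im z - h (Re z)) \<ge> 0}" and ?T = "{z. -1 * (Im z - h (Re z)) \<ge> 0}"
    have "continuous_on (?S \<union> ?T) E"
      unfolding E_def[abs_def]
    proof (rule continuous_on_cases)
      show "closed ?S" "closed ?T" by (intro closed_Collect_le continuous_intros)+
      show "continuous_on ?S Ep" unfolding Ep_def[abs_def]
        by (intro continuous_intros P(2) continuous_on_subset[OF cauchy_ext_continuous]) auto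
      show "continuous_on ?T Em" unfolding Em_def[abs_def]
        by (intro continuous_intros M(2) continuous_on_subset[OF cauchy_ext_continuous]) auto
      have eq: "Ep z = Em z" if "Im z = h (Re z)" for z
      proof -
        have z: "z = crv (Re z)" using that by (simp add: crv_def complex_eq_iff)
        have "Ep (crv s) - Em (crv s) = 0" for s
        proof -
          have "Ep (crv s) - Em (crv s) = (cvel vp (crv s) - cvel vm (crv s)) -
              \<i> * of_real \<kappa> * (cauchy_ext 1 (crv s) - cauchy_ext (-1) (crv s))"
            by (simp add: Ep_def Em_def algebra_simps)
          also have "\<dots> = 0" unfolding jump cauchy_ext_graph by (simp add: algebra_simps)
          finally show ?thesis .
        qed
        then show ?thesis using z by (metis eq_iff_diff_eq_0)
      qed
      show "\<forall>z. z \<in> ?S \<and> \<not> h (Re z) \<le> Im z \<or> z \<in> ?T \<and> h (Re z) \<le> Im z \<longrightarrow> Ep z = Em z"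
        using eq by auto
    qed
    moreover have "?S \<union> ?T = UNIV" by auto
    ultimately show ?thesis by (simp only:)
  qed
  have E0: "E z = 0" if "Im z \<noteq> h (Re z)" for z
  proof (rule periodic_decaying_eq_0[OF cE])
    have "E holomorphic_on side 1"
    proof (rule holomorphic_transform)
      show "Ep holomorphic_on side 1"
        unfolding Ep_def[abs_def] by (intro holomorphic_intros P(1) cauchy_ext_side) simp
    qed (simp add: Esides)
    moreover have "E holomorphic_on side (-1)"
    proof (rule holomorphic_transform)
      show "Em holomorphic_on side (-1)"
        unfolding Em_def[abs_def] by (intro holomorphic_intros M(1) cauchy_ext_side) simp
    qed (simp add: Esides')
    ultimately have "E holomorphic_on (side 1 \<union> side (-1))"
      by (rule holomorphic_on_Un) (rule open_side)+
    moreover have "side 1 \<union> side (-1) = {z. Im z \<noteq> h (Re z)}" by (auto simp: side_def)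
    ultimately show "E holomorphic_on {z. Im z \<noteq> h (Re z)}" by (simp only:)
    show "E (z + 2 * of_real pi) = E z" if "Im z \<noteq> h (Re z)" for z
      using split[OF that]
    proof
      assume z: "z \<in> side 1"
      show ?thesis
        using P(3)[OF z] cauchy_ext_side(2)[OF disjI1[OF refl] z]
        by (simp only: Esides[OF z] Esides[OF side_periodic[OF z]] Ep_def)
    next
      assume z: "z \<in> side (-1)"
      show ?thesis
        using M(3)[OF z] cauchy_ext_side(2)[OF disjI2[OF refl] z]
        by (simp only: Esides'[OF z] Esides'[OF side_periodic[OF z]] Em_def)
    qed
    show "\<exists>R. \<forall>z. R < \<bar>Im z\<bar> \<longrightarrow> norm (E z) < \<epsilon>" if \<epsilon>: "\<epsilon> > 0" for \<epsilon>
    proof -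
      obtain B where B: "B \<ge> 0" "\<And>x. \<bar>h x\<bar> \<le> B" using h_bounded by blast
      define \<delta> where "\<delta> = \<epsilon> / (2 * (\<bar>\<kappa>\<bar> + 1))"
      have \<delta>: "\<delta> > 0" using \<epsilon> by (simp add: \<delta>_def)
      have \<epsilon>2: "\<epsilon> / 2 > 0" using \<epsilon> by simp
      obtain R1 where R1: "\<forall>z\<in>side 1. \<bar>Im z\<bar> > R1 \<longrightarrow> norm (cvel vp z) < \<epsilon> / 2" using P(4)[OF \<epsilon>2] by blast
      obtain R2 where R2: "\<forall>z\<in>side (-1). \<bar>Im z\<bar> > R2 \<longrightarrow> norm (cvel vm z) < \<epsilon> / 2" using M(4)[OF \<epsilon>2] by blast
      obtain R3 where R3: "\<forall>z\<in>side 1. \<bar>Im z\<bar> > R3 \<longrightarrow> norm (cauchy_ext 1 z) < \<delta>"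
        using cauchy_ext_side(3)[OF disjI1[OF refl] \<delta>] by blast
      obtain R4 where R4: "\<forall>z\<in>side (-1). \<bar>Im z\<bar> > R4 \<longrightarrow> norm (cauchy_ext (-1) z) < \<delta>"
        using cauchy_ext_side(3)[OF disjI2[OF refl] \<delta>] by blast
      have small: "norm (u - \<i> * of_real \<kappa> * w) < \<epsilon>" if "norm u < \<epsilon> / 2" "norm w < \<delta>" for u w
      proof -
        have "norm (u - \<i> * of_real \<kappa> * w) \<le> norm u + \<bar>\<kappa>\<bar> * norm w"
          using norm_triangle_ineq4[of u "\<i> * of_real \<kappa> * w"] by (simp add: norm_mult)
        also have "\<bar>\<kappa>\<bar> * norm w \<le> (\<bar>\<kappa>\<bar> + 1) * \<delta>" using that by (intro mult_mono) auto
        also have "(\<bar>\<kappa>\<bar> + 1) * \<delta> = \<epsilon> / 2" by (simp add: \<delta>_def field_simps)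
        finally show ?thesis using that by simp
      qed
      have "norm (E z) < \<epsilon>" if z: "\<bar>Im z\<bar> > \<bar>R1\<bar> + \<bar>R2\<bar> + \<bar>R3\<bar> + \<bar>R4\<bar> + B" for z
      proof -
        have R: "\<bar>Im z\<bar> > R1" "\<bar>Im z\<bar> > R2" "\<bar>Im z\<bar> > R3" "\<bar>Im z\<bar> > R4" and "Im z \<noteq> h (Re z)"
          using z B(1) B(2)[of "Re z"] by linarith+
        from split[OF this(5)] show ?thesis
        proof
          assume "z \<in> side 1"
          then show ?thesis unfolding Esides[OF \<open>z \<in> side 1\<close>] Ep_def using R1 R3 R by (intro small) auto
        next
          assume "z \<in> side (-1)"
          then show ?thesis unfolding Esides'[OF \<open>z \<in> side (-1)\<close>] Em_def using R2 R4 R by (intro small) auto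
        qed
      qed
      then show ?thesis by blast
    qed
  qed (rule that)
  \<comment> \<open>The uniqueness theorem speaks of points off the graph; the value on it follows
    by continuity from above.\<close>
  have "E (crv x) = 0"
  proof (rule LIMSEQ_unique)
    have "(\<lambda>n. crv x + \<i> * of_real (inverse (of_nat (Suc n)))) \<longlonglongrightarrow> crv x + \<i> * of_real 0"
      by (intro tendsto_intros LIMSEQ_inverse_real_of_nat)
    then show "(\<lambda>n. E (crv x + \<i> * of_real (inverse (of_nat (Suc n))))) \<longlonglongrightarrow> E (crv x)"
      by (intro continuous_on_tendsto_compose[OF cE]) simp_all
    have "E (crv x + \<i> * of_real (inverse (of_nat (Suc n)))) = 0" for n
    proof (rule E0)
      have "inverse (of_nat (Suc n)) \<noteq> (0 :: real)" by simp
      then show "Im (crv x + \<i> * of_real (inverse (of_nat (Suc n)))) \<noteq> h (Re (crv x + \<i> * of_real (inverse (of_nat (Suc n)))))"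
        unfolding crv_def by (simp del: of_nat_Suc)
    qed
    then show "(\<lambda>n. E (crv x + \<i> * of_real (inverse (of_nat (Suc n))))) \<longlonglongrightarrow> 0"
      by (simp only: tendsto_const)
  qed
  then have "cvel vp (crv x) = \<i> * of_real \<kappa> * cauchy_ext 1 (crv x)"
    by (simp add: E_def Ep_def crv_def)
  then show ?thesis using vel_graph_normal[of "cvel vp" x \<kappa> 1] by (simp only: vel_cvel)
qed

end

text \<open>The problem frozen at one time, with the time derivative as a given function
  \<open>df\<close>. It is kept apart from the quantifier over time because the fields at different
  times are not related by any condition.\<close>

definition muskat_instant ::
  "real \<Rightarrow> real \<Rightarrow> real \<Rightarrow> real \<Rightarrow> real \<Rightarrow> (real \<Rightarrow> real) \<Rightarrow> (real \<Rightarrow> real) \<Rightarrow>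
   (real \<times> real \<Rightarrow> real \<times> real) \<Rightarrow> (real \<times> real \<Rightarrow> real \<times> real) \<Rightarrow>
   (real \<times> real \<Rightarrow> real) \<Rightarrow> (real \<times> real \<Rightarrow> real) \<Rightarrow> bool" where
  "muskat_instant k \<mu> g \<rho>plus \<rho>minus h df vp vm pp pm \<longleftrightarrow>
     periodic h \<and>
     bulk_equations k \<mu> g \<rho>plus (Omega_plus h) vp pp \<and>
     bulk_equations k \<mu> g \<rho>minus (Omega_minus h) vm pm \<and>
     (\<forall>x. pp (x, h x) - pm (x, h x) = 0 \<and>
          vp (x, h x) \<bullet> unit_normal h x = vm (x, h x) \<bullet> unit_normal h x) \<and>
     (\<forall>x. df x = vp (x, h x) \<bullet> (- deriv h x, 1) \<and> df x = vm (x, h x) \<bullet> (- deriv h x, 1)) \<and>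
     regular_flow (Omega_plus h) (Omega_minus h) vp vm pp pm"

definition contour_instant ::
  "real \<Rightarrow> real \<Rightarrow> real \<Rightarrow> (real \<Rightarrow> real) \<Rightarrow> (real \<Rightarrow> real) \<Rightarrow> bool" where
  "contour_instant k \<mu> \<Delta> h df \<longleftrightarrow>
     (\<forall>x. \<exists>J1 J2.
        has_pv_integral (\<lambda>s. deriv h (x - s) *
          (T_diff h x s * (1 + (tan (s / 2))\<^sup>2) / ((tan (s / 2))\<^sup>2 + (T_diff h x s)\<^sup>2))) J1 \<and>
        has_pv_integral (\<lambda>s. deriv h (x - s) *
          (tan (s / 2) * (1 - (T_diff h x s)\<^sup>2) / ((tan (s / 2))\<^sup>2 + (T_diff h x s)\<^sup>2))) J2 \<and>
        df x = - (k * \<Delta> / (4 * pi * \<mu>)) * deriv h x * J1 - k * \<Delta> / (4 * pi * \<mu>) * J2)"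

text \<open>For a Hoelder graph both principal values exist at every x and are unique, so the
  existential quantifiers collapse to a formula for \<open>df\<close>.\<close>

lemma (in holder_graph) contour_instant_iff:
  "contour_instant k \<mu> \<Delta> h df \<longleftrightarrow>
    (\<forall>x. df x = - (k * \<Delta> / (4 * pi * \<mu>)) * (Re (reg_cauchy x 0) + h' x * (- Im (reg_cauchy x 0))))"
proof -
  have "(\<exists>J1 J2. has_pv_integral (\<lambda>s. deriv h (x - s) *
          (T_diff h x s * (1 + (tan (s / 2))\<^sup>2) / ((tan (s / 2))\<^sup>2 + (T_diff h x s)\<^sup>2))) J1 \<and>
        has_pv_integral (\<lambda>s. deriv h (x - s) *
          (tan (s / 2) * (1 - (T_diff h x s)\<^sup>2) / ((tan (s / 2))\<^sup>2 + (T_diff h x s)\<^sup>2))) J2 \<and>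
        df x = - (k * \<Delta> / (4 * pi * \<mu>)) * deriv h x * J1 - k * \<Delta> / (4 * pi * \<mu>) * J2) \<longleftrightarrow>
      df x = - (k * \<Delta> / (4 * pi * \<mu>)) * (Re (reg_cauchy x 0) + h' x * (- Im (reg_cauchy x 0)))"
    (is "(\<exists>J1 J2. ?P J1 \<and> ?Q J2 \<and> ?D J1 J2) \<longleftrightarrow> ?R") for x
  proof -
    have "?D (- Im (reg_cauchy x 0)) (Re (reg_cauchy x 0)) \<longleftrightarrow> ?R"
      unfolding deriv_h by (simp add: algebra_simps)
    moreover have "?P J1 \<longleftrightarrow> J1 = - Im (reg_cauchy x 0)" "?Q J2 \<longleftrightarrow> J2 = Re (reg_cauchy x 0)" for J1 J2
      using contour_principal_values[of x] has_pv_integral_unique by blast+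
    ultimately show ?thesis by (simp only: simp_thms ex_simps)
  qed
  then show ?thesis unfolding contour_instant_def by (simp only:)
qed

text \<open>Membership in H^2 makes the graph an instance of \<open>holder_graph\<close> with
  exponent 1/4. Both formulations then say that \<open>df\<close> is one and the same explicit
  function.\<close>

theorem muskat_instant_iff_contour_instant:
  fixes k \<mu> g \<rho>plus \<rho>minus :: real
  assumes H2: "h \<in> Sobolev_circle 2" and cont: "continuous_on UNIV h" and k: "0 < k" and \<mu>: "0 < \<mu>"
  shows "(\<exists>vp vm pp pm. muskat_instant k \<mu> g \<rho>plus \<rho>minus h df vp vm pp pm) \<longleftrightarrow>
    contour_instant k \<mu> (g * (\<rho>minus - \<rho>plus)) h df"
proof -
  have per: "periodic h" using H2 by (simp add: Sobolev_circle_def L2_circle_def)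
  obtain h' C where h': "\<And>x. (h has_real_derivative h' x) (at x)"
    and holder: "\<And>x y. \<bar>h' x - h' y\<bar> \<le> C * \<bar>x - y\<bar> powr (1/4)"
    by (rule Sobolev_circle_2_regular[OF H2 cont]) blast
  have ch': "continuous_on UNIV h'"
    unfolding continuous_on_def
  proof
    fix x :: real
    have "((\<lambda>y. \<bar>y - x\<bar>) \<longlongrightarrow> \<bar>x - x\<bar>) (at x)" by (intro tendsto_intros)
    then have "((\<lambda>y. C * \<bar>y - x\<bar> powr (1/4)) \<longlongrightarrow> C * (0 powr (1/4))) (at x)"
      by (intro tendsto_mult tendsto_const tendsto_powr') auto
    then have "((\<lambda>y. C * \<bar>y - x\<bar> powr (1/4)) \<longlongrightarrow> 0) (at x)" by simp
    then have "((\<lambda>y. h' y - h' x) \<longlongrightarrow> 0) (at x)"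
      by (rule Lim_null_comparison[rotated]) (simp add: holder)
    then show "(h' \<longlongrightarrow> h' x) (at x)" by (subst Lim_null)
  qed
  interpret holder_graph h h' C "1/4"
    by standard (use per h' ch' holder in \<open>simp_all add: periodic_def\<close>)
  have hd: "deriv h = h'" by (rule ext) (rule deriv_h)
  let ?v = "\<lambda>x. - (k * (g * (\<rho>minus - \<rho>plus)) / (4 * pi * \<mu>)) * (Re (reg_cauchy x 0) + h' x * (- Im (reg_cauchy x 0)))"
  show ?thesis
    unfolding contour_instant_iff
  proof
    assume "\<exists>vp vm pp pm. muskat_instant k \<mu> g \<rho>plus \<rho>minus h df vp vm pp pm"
    then obtain vp vm pp pm where m: "muskat_instant k \<mu> g \<rho>plus \<rho>minus h df vp vm pp pm" by blast
    note m = m[unfolded muskat_instant_def Omega_eq_region]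
    have "vp (x, h x) \<bullet> (- h' x, 1) = ?v x" for x
      by (rule muskat_imp_contour[OF k \<mu>, of g \<rho>plus vp pp \<rho>minus vm pm]) (use m in simp_all)
    moreover have "df x = vp (x, h x) \<bullet> (- h' x, 1)" for x
      using m unfolding hd by blast
    ultimately show "\<forall>x. df x = ?v x" by simp
  next
    assume df: "\<forall>x. df x = ?v x"
    obtain vp vm pp pm where v:
      "bulk_equations k \<mu> g \<rho>plus (region 1) vp pp \<and> bulk_equations k \<mu> g \<rho>minus (region (-1)) vm pm \<and>
      (\<forall>x. pp (x, h x) = pm (x, h x) \<and> vp (x, h x) \<bullet> (- h' x, 1) = ?v x \<and> vm (x, h x) \<bullet> (- h' x, 1) = ?v x) \<and>
      regular_flow (region 1) (region (-1)) vp vm pp pm"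
      using contour_imp_muskat[OF k \<mu>, of g \<rho>plus \<rho>minus] by blast
    have n: "vp (x, h x) \<bullet> (- h' x, 1) = df x" "vm (x, h x) \<bullet> (- h' x, 1) = df x" "pp (x, h x) = pm (x, h x)" for x
      using v df by auto
    have "muskat_instant k \<mu> g \<rho>plus \<rho>minus h df vp vm pp pm"
      unfolding muskat_instant_def Omega_eq_region unit_normal_def hd inner_scaleR_right n
      using per v by simp
    then show "\<exists>vp vm pp pm. muskat_instant k \<mu> g \<rho>plus \<rho>minus h df vp vm pp pm" by blast
  qed
qed

text \<open>The equivalence at a fixed time holds for every function \<open>df\<close>, so the same
  representative of the time derivative serves in both formulations. From the contour problem to the
  Muskat problem, the fields found at each instant are collected into functions of time by
  choice.\<close>

theorem proposition2p1:
  fixes T :: ereal and k \<mu> g \<rho>plus \<rho>minus :: real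
    and f :: "real \<Rightarrow> real \<Rightarrow> real" and f0 :: "real \<Rightarrow> real"
  assumes "0 < T" and "0 < k" and "0 < \<mu>" and "0 < g * (\<rho>minus - \<rho>plus)"
    and "f0 \<in> L2_circle"
  shows
    "(interface_regular T f \<and>
      (\<exists>vplus vminus pplus pminus.
         solves_muskat T k \<mu> g \<rho>plus \<rho>minus f0 f vplus vminus pplus pminus \<and>
         (\<forall>t\<in>time_open T.
            continuous_on (closure (Omega_plus (f t))) (vplus t) \<and>
            C1_on (Omega_plus (f t)) (vplus t) \<and>
            continuous_on (closure (Omega_minus (f t))) (vminus t) \<and>
            C1_on (Omega_minus (f t)) (vminus t) \<and>
            C1_on_closure (Omega_plus (f t)) (pplus t) \<and>
            C2_on (Omega_plus (f t)) (pplus t) \<and>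
            C1_on_closure (Omega_minus (f t)) (pminus t) \<and>
            C2_on (Omega_minus (f t)) (pminus t))))
     \<longleftrightarrow>
     (interface_regular T f \<and>
      solves_contour T k \<mu> (g * (\<rho>minus - \<rho>plus)) f0 f)"
    (is "_ \<and> ?M \<longleftrightarrow> _ \<and> ?C")
proof (rule conj_cong[OF refl])
  assume reg: "interface_regular T f"
  let ?I = "time_open T" and ?\<Delta> = "g * (\<rho>minus - \<rho>plus)"
  let ?m = "\<lambda>t df. muskat_instant k \<mu> g \<rho>plus \<rho>minus (f t) df"
  have iff: "(\<exists>vp vm pp pm. ?m t df vp vm pp pm) \<longleftrightarrow> contour_instant k \<mu> ?\<Delta> (f t) df" if "t \<in> ?I" for t df
    using reg that assms(2,3) unfolding interface_regular_def
    by (intro muskat_instant_iff_contour_instant) auto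
  have C: "?C \<longleftrightarrow> (\<forall>t\<in>?I. \<exists>df. has_L2_derivative ?I f df t \<and> contour_instant k \<mu> ?\<Delta> (f t) df) \<and>
      (AE x in lebesgue. f 0 x = f0 x)"
    unfolding solves_contour_def contour_instant_def ..
  have M: "?M \<longleftrightarrow> (\<exists>vp vm pp pm. \<forall>t\<in>?I. \<exists>df. has_L2_derivative ?I f df t \<and> ?m t df (vp t) (vm t) (pp t) (pm t)) \<and>
      (AE x in lebesgue. f 0 x = f0 x)"
  proof
    assume ?M
    then obtain vp vm pp pm where s: "solves_muskat T k \<mu> g \<rho>plus \<rho>minus f0 f vp vm pp pm"
      and r: "\<forall>t\<in>?I. regular_flow (Omega_plus (f t)) (Omega_minus (f t)) (vp t) (vm t) (pp t) (pm t)"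
      by blast
    note s = s[unfolded solves_muskat_def]
    have "\<exists>df. has_L2_derivative ?I f df t \<and> ?m t df (vp t) (vm t) (pp t) (pm t)" if t: "t \<in> ?I" for t
      using bspec[OF conjunct1[OF s] t] bspec[OF r t] unfolding muskat_instant_def by blast
    then show "(\<exists>vp vm pp pm. \<forall>t\<in>?I. \<exists>df. has_L2_derivative ?I f df t \<and> ?m t df (vp t) (vm t) (pp t) (pm t)) \<and>
      (AE x in lebesgue. f 0 x = f0 x)"
      using conjunct2[OF s] by blast
  next
    assume a: "(\<exists>vp vm pp pm. \<forall>t\<in>?I. \<exists>df. has_L2_derivative ?I f df t \<and> ?m t df (vp t) (vm t) (pp t) (pm t)) \<and>
      (AE x in lebesgue. f 0 x = f0 x)"
    then obtain vp vm pp pm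
      where m: "\<forall>t\<in>?I. \<exists>df. has_L2_derivative ?I f df t \<and> ?m t df (vp t) (vm t) (pp t) (pm t)" by blast
    have s: "solves_muskat T k \<mu> g \<rho>plus \<rho>minus f0 f vp vm pp pm"
      unfolding solves_muskat_def
    proof (intro conjI ballI)
      fix t assume "t \<in> ?I"
      from bspec[OF m this] obtain df where d: "has_L2_derivative ?I f df t" and
        i: "?m t df (vp t) (vm t) (pp t) (pm t)" by blast
      note i = i[unfolded muskat_instant_def]
      show "periodic (f t)" "bulk_equations k \<mu> g \<rho>plus (Omega_plus (f t)) (vp t) (pp t)"
        "bulk_equations k \<mu> g \<rho>minus (Omega_minus (f t)) (vm t) (pm t)"
        "\<forall>x. pp t (x, f t x) - pm t (x, f t x) = 0 \<and>
           vp t (x, f t x) \<bullet> unit_normal (f t) x = vm t (x, f t x) \<bullet> unit_normal (f t) x"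
        "\<exists>df. has_L2_derivative ?I f df t \<and>
           (\<forall>x. df x = vp t (x, f t x) \<bullet> (- deriv (f t) x, 1) \<and> df x = vm t (x, f t x) \<bullet> (- deriv (f t) x, 1))"
        using d i by blast+
    qed (use a in blast)
    have r: "\<forall>t\<in>?I. regular_flow (Omega_plus (f t)) (Omega_minus (f t)) (vp t) (vm t) (pp t) (pm t)"
    proof
      fix t assume "t \<in> ?I"
      from bspec[OF m this] show "regular_flow (Omega_plus (f t)) (Omega_minus (f t)) (vp t) (vm t) (pp t) (pm t)"
        unfolding muskat_instant_def by blast
    qed
    show ?M
      by (intro exI[of _ vp] exI[of _ vm] exI[of _ pp] exI[of _ pm] conjI s r)
  qed
  show "?M \<longleftrightarrow> ?C"
    unfolding M C
  proof (rule conj_cong[OF _ refl], rule iffI)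
    assume "\<exists>vp vm pp pm. \<forall>t\<in>?I. \<exists>df. has_L2_derivative ?I f df t \<and> ?m t df (vp t) (vm t) (pp t) (pm t)"
    then show "\<forall>t\<in>?I. \<exists>df. has_L2_derivative ?I f df t \<and> contour_instant k \<mu> ?\<Delta> (f t) df"
      using iff by blast
  next
    assume "\<forall>t\<in>?I. \<exists>df. has_L2_derivative ?I f df t \<and> contour_instant k \<mu> ?\<Delta> (f t) df"
    then have "\<forall>t\<in>?I. \<exists>vp vm pp pm df. has_L2_derivative ?I f df t \<and> ?m t df vp vm pp pm"
      using iff by blast
    then show "\<exists>vp vm pp pm. \<forall>t\<in>?I. \<exists>df. has_L2_derivative ?I f df t \<and> ?m t df (vp t) (vm t) (pp t) (pm t)"
      by metis
  qed
qed

end
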